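(* Let $A \in \mathbb{R}^{m\times n}$ and $B\in \mathbb{R}^{l\times n}$. Then, for any $p\in[1,\infty]$, $$\max_{\|B v\|_p\leq 1}\|A v\|_{\infty} = \max_{i\in\{1,\dots,m\}} \ \min_{\beta\in\mathbb{R}^l,\ B^\top\beta = A^\top e_i} \ \|\beta\|_{p^*},$$ which can be evaluated in polynomial time with respect to $l$, $m$, and $n$.
   Context: The maximum on the left is over $v\in\mathbb{R}^n$ and is understood as $\infty$ if the problem is unbounded; a minimum over an empty set is $\infty$ by convention. $\|\cdot\|_p$ is the vector $p$-norm, $p^*$ is the Hölder conjugate of $p$ (i.e. $\frac1p+\frac1{p^*}=1$, with $1^*=\infty$, $\infty^*=1$), and $e_i$ is the $i$-th canonical basis vector of $\mathbb{R}^m$. Evaluation in polynomial time is meant in the usual sense of convex optimization: each inner minimum is a convex optimization problem with linear equality constraints, solvable by, e.g., interior point methods. *)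

theory Defs
  imports
    "Jordan_Normal_Form.Matrix"
    "HOL-Library.Extended_Real"
begin

section \<open>Vector norms and the two optimization problems\<close>

text \<open>The \<open>p\<close>-norm for \<open>p \<in> [1,\<infinity>]\<close>; the inserted \<open>0\<close> matters only for the vector of
  dimension \<open>0\<close>, whose norm is \<open>0\<close>.\<close>

definition pnorm :: "ereal \<Rightarrow> real vec \<Rightarrow> real" where
  "pnorm p x =
    (if p = \<infinity> then Max (insert 0 ((\<lambda>i. \<bar>x $ i\<bar>) ` {..<dim_vec x}))
     else (\<Sum>i<dim_vec x. \<bar>x $ i\<bar> powr real_of_ereal p) powr (1 / real_of_ereal p))"

definition hoelder_conj :: "ereal \<Rightarrow> ereal" where
  "hoelder_conj p = (if p = 1 then \<infinity> else if p = \<infinity> then 1 else p / (p - 1))"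

lemma hoelder_conj_iff:
  assumes "1 \<le> p" and "1 \<le> q"
  shows "q = hoelder_conj p \<longleftrightarrow> 1 / p + 1 / q = 1"
proof (cases p)
  case (real r)
  note p = this
  show ?thesis
  proof (cases q)
    case (real s)
    then show ?thesis using assms p
      by (auto simp: hoelder_conj_def one_ereal_def divide_simps algebra_simps)
  next
    case PInf
    then show ?thesis using assms p
      by (auto simp: hoelder_conj_def one_ereal_def divide_simps)
  next
    case MInf
    then show ?thesis using assms by auto
  qed
next
  case PInf
  show ?thesis
  proof (cases q)
    case (real s)
    then show ?thesis using assms PInf
      by (auto simp: hoelder_conj_def one_ereal_def divide_simps)
  next
    case q: PInf
    then show ?thesis using assms PInf
      by (auto simp: hoelder_conj_def one_ereal_def)
  next
    case MInf
    then show ?thesis using assms by auto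
  qed
next
  case MInf
  then show ?thesis using assms by auto
qed

definition primal_feasible :: "ereal \<Rightarrow> real mat \<Rightarrow> real vec set" where
  "primal_feasible p B = {v \<in> carrier_vec (dim_col B). pnorm p (B *\<^sub>v v) \<le> 1}"

text \<open>Row and basis-vector indices start at \<open>0\<close>.\<close>

definition dual_feasible :: "real mat \<Rightarrow> real mat \<Rightarrow> nat \<Rightarrow> real vec set" where
  "dual_feasible A B i =
    {\<beta> \<in> carrier_vec (dim_row B).
       transpose_mat B *\<^sub>v \<beta> = transpose_mat A *\<^sub>v unit_vec (dim_row A) i}"

text \<open>The values are taken in the extended reals: the supremum over a set of reals without upper
  bound and the infimum over the empty set are both \<open>\<infinity>\<close>.\<close>

definition primal_value :: "ereal \<Rightarrow> real mat \<Rightarrow> real mat \<Rightarrow> ereal" where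
  "primal_value p A B = (SUP v \<in> primal_feasible p B. ereal (pnorm \<infinity> (A *\<^sub>v v)))"

definition dual_value :: "ereal \<Rightarrow> real mat \<Rightarrow> real mat \<Rightarrow> nat \<Rightarrow> ereal" where
  "dual_value p A B i = (INF \<beta> \<in> dual_feasible A B i. ereal (pnorm (hoelder_conj p) \<beta>))"

definition convex_problem :: "real vec set \<Rightarrow> (real vec \<Rightarrow> real) \<Rightarrow> bool" where
  "convex_problem S f \<longleftrightarrow>
    (\<forall>x\<in>S. \<forall>y\<in>S. \<forall>t. 0 \<le> t \<and> t \<le> 1 \<longrightarrow>
      t \<cdot>\<^sub>v x + (1 - t) \<cdot>\<^sub>v y \<in> S \<and>
      f (t \<cdot>\<^sub>v x + (1 - t) \<cdot>\<^sub>v y) \<le> t * f x + (1 - t) * f y)"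


section \<open>Polynomial time in the real arithmetic model\<close>

text \<open>
  The model of computation of convex optimization (Ben-Tal and Nemirovski, \<open>Lectures on Modern
  Convex Optimization\<close>, the chapter on polynomial time solvability): an idealized computer stores real
  numbers exactly and performs the four arithmetic operations, comparisons and powers of reals
  at unit cost.

  A program works on natural-number registers, used as counters and array indices, and on
  two-dimensional real arrays, both named by natural numbers.  The only operations on registers
  are \<open>0\<close>, copying, successor and comparison, and the only real constants are \<open>0\<close> and \<open>1\<close>,
  so that neither indices nor constants can encode additional information.  Arithmetic is total as
  in HOL: division by \<open>0\<close> gives \<open>0\<close>, and \<open>powr\<close> takes the absolute value of a negative base.
\<close>

datatype nexp = NZero | NReg nat | NSuc nexp

datatype rexp =
    RZero
  | ROne
  | RCell nat nexp nexp  \<comment> \<open>array name, row index, column index\<close>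
  | RAdd rexp rexp
  | RSub rexp rexp
  | RMul rexp rexp
  | RDiv rexp rexp
  | RPow rexp rexp

datatype test = NLess nexp nexp | RLess rexp rexp

datatype com =
    Skip
  | NAssign nat nexp
  | RAssign nat nexp nexp rexp
  | Seq com com
  | Cond test com com
  | While test com

record state =
  reg :: "nat \<Rightarrow> nat"
  arr :: "nat \<Rightarrow> nat \<Rightarrow> nat \<Rightarrow> real"

fun nval :: "nexp \<Rightarrow> state \<Rightarrow> nat" where
  "nval NZero s = 0"
| "nval (NReg r) s = reg s r"
| "nval (NSuc e) s = Suc (nval e s)"

fun rval :: "rexp \<Rightarrow> state \<Rightarrow> real" where
  "rval RZero s = 0"
| "rval ROne s = 1"
| "rval (RCell a i j) s = arr s a (nval i s) (nval j s)"
| "rval (RAdd e f) s = rval e s + rval f s"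
| "rval (RSub e f) s = rval e s - rval f s"
| "rval (RMul e f) s = rval e s * rval f s"
| "rval (RDiv e f) s = rval e s / rval f s"
| "rval (RPow e f) s = rval e s powr rval f s"

fun tval :: "test \<Rightarrow> state \<Rightarrow> bool" where
  "tval (NLess e f) s \<longleftrightarrow> nval e s < nval f s"
| "tval (RLess e f) s \<longleftrightarrow> rval e s < rval f s"

fun ncost :: "nexp \<Rightarrow> nat" where
  "ncost NZero = 1"
| "ncost (NReg r) = 1"
| "ncost (NSuc e) = Suc (ncost e)"

fun rcost :: "rexp \<Rightarrow> nat" where
  "rcost RZero = 1"
| "rcost ROne = 1"
| "rcost (RCell a i j) = Suc (ncost i + ncost j)"
| "rcost (RAdd e f) = Suc (rcost e + rcost f)"
| "rcost (RSub e f) = Suc (rcost e + rcost f)"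
| "rcost (RMul e f) = Suc (rcost e + rcost f)"
| "rcost (RDiv e f) = Suc (rcost e + rcost f)"
| "rcost (RPow e f) = Suc (rcost e + rcost f)"

fun tcost :: "test \<Rightarrow> nat" where
  "tcost (NLess e f) = Suc (ncost e + ncost f)"
| "tcost (RLess e f) = Suc (rcost e + rcost f)"

text \<open>\<open>exec c s t s'\<close>: started in \<open>s\<close>, the program \<open>c\<close> halts in \<open>s'\<close> after \<open>t\<close> elementary
  operations.\<close>

inductive exec :: "com \<Rightarrow> state \<Rightarrow> nat \<Rightarrow> state \<Rightarrow> bool" where
  Skip: "exec Skip s 1 s"
| NAssign: "exec (NAssign r e) s (Suc (ncost e)) (s\<lparr>reg := (reg s)(r := nval e s)\<rparr>)"
| RAssign: "exec (RAssign a i j e) s (Suc (ncost i + ncost j + rcost e))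
    (s\<lparr>arr := (arr s)(a := (arr s a)(nval i s := (arr s a (nval i s))(nval j s := rval e s)))\<rparr>)"
| Seq: "exec c s t s' \<Longrightarrow> exec d s' u s'' \<Longrightarrow> exec (Seq c d) s (t + u) s''"
| CondTrue: "tval b s \<Longrightarrow> exec c s t s' \<Longrightarrow> exec (Cond b c d) s (tcost b + t) s'"
| CondFalse: "\<not> tval b s \<Longrightarrow> exec d s t s' \<Longrightarrow> exec (Cond b c d) s (tcost b + t) s'"
| WhileTrue: "tval b s \<Longrightarrow> exec c s t s' \<Longrightarrow> exec (While b c) s' u s'' \<Longrightarrow>
    exec (While b c) s (tcost b + t + u) s''"
| WhileFalse: "\<not> tval b s \<Longrightarrow> exec (While b c) s (tcost b) s"

lemma exec_deterministic:
  assumes "exec c s t s'" and "exec c s u s''"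
  shows "t = u \<and> s' = s''"
  using assms
proof (induction arbitrary: u s'' rule: exec.induct)
  case (Skip s) then show ?case by (auto elim: exec.cases)
next
  case (NAssign r e s) then show ?case by (auto elim: exec.cases)
next
  case (RAssign a i j e s) then show ?case by (auto elim: exec.cases)
next
  case (Seq c s t s' d v s1)
  from Seq.prems show ?case
    by (cases rule: exec.cases) (use Seq.IH in blast)+
next
  case (CondTrue b s c t s' d)
  from CondTrue.prems show ?case
    by (cases rule: exec.cases) (use CondTrue.IH CondTrue.hyps in blast)+
next
  case (CondFalse b s d t s' c)
  from CondFalse.prems show ?case
    by (cases rule: exec.cases) (use CondFalse.IH CondFalse.hyps in blast)+
next
  case (WhileTrue b s c t s' v s1)
  from WhileTrue.prems show ?case
    by (cases rule: exec.cases) (use WhileTrue.IH WhileTrue.hyps in blast)+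
next
  case (WhileFalse b s c)
  from WhileFalse.prems show ?case
    by (cases rule: exec.cases) (use WhileFalse.hyps in blast)+
qed

text \<open>Input: the dimensions \<open>l\<close>, \<open>m\<close>, \<open>n\<close> in the registers \<open>0\<close>, \<open>1\<close>, \<open>2\<close>, the matrices \<open>A\<close>
  and \<open>B\<close> in the arrays \<open>0\<close> and \<open>1\<close>, the exponent \<open>p\<close> and the accuracy \<open>\<epsilon>\<close> in the
  array \<open>2\<close>.  As \<open>real_of_ereal \<infinity> = 0\<close>, the exponent \<open>\<infinity>\<close> is encoded by \<open>0\<close>.\<close>

definition mat_entries :: "real mat \<Rightarrow> nat \<Rightarrow> nat \<Rightarrow> real" where
  "mat_entries M i j = (if i < dim_row M \<and> j < dim_col M then M $$ (i, j) else 0)"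

definition input_state :: "ereal \<Rightarrow> real mat \<Rightarrow> real mat \<Rightarrow> real \<Rightarrow> state" where
  "input_state p A B \<epsilon> =
    \<lparr>reg = (\<lambda>_. 0)(0 := dim_row B, 1 := dim_row A, 2 := dim_col A),
     arr = (\<lambda>_ _ _. 0)
       (0 := mat_entries A,
        1 := mat_entries B,
        2 := (\<lambda>i j. if i = 0 \<and> j = 0 then real_of_ereal p
                    else if i = 0 \<and> j = 1 then \<epsilon> else 0))\<rparr>"

text \<open>Output: register \<open>3\<close> tells whether the value is \<open>\<infinity>\<close>; if it is finite, the first cell of
  array \<open>3\<close> holds it up to the relative error \<open>\<epsilon>\<close>.\<close>

definition output_approximates :: "real \<Rightarrow> ereal \<Rightarrow> state \<Rightarrow> bool" where
  "output_approximates \<epsilon> y s \<longleftrightarrow>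
    (y = \<infinity> \<and> reg s 3 = 1) \<or>
    (\<exists>z. y = ereal z \<and> reg s 3 = 0 \<and> \<bar>arr s 3 0 0 - z\<bar> \<le> \<epsilon> * \<bar>z\<bar>)"

text \<open>One program evaluates \<open>F A B\<close> for all matrices \<open>A\<close>, \<open>B\<close> of all sizes and to every
  accuracy \<open>\<epsilon>\<close>. The number of operations is bounded by a polynomial in \<open>l\<close>, \<open>m\<close>, \<open>n\<close> times the
  number of accuracy digits, whatever the entries of the matrices are.\<close>

definition poly_time_evaluable :: "ereal \<Rightarrow> (real mat \<Rightarrow> real mat \<Rightarrow> ereal) \<Rightarrow> bool" where
  "poly_time_evaluable p F \<longleftrightarrow>
    (\<exists>(c :: com) (C :: real) (k :: nat). \<forall>l m n A B \<epsilon>.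
       0 < m \<longrightarrow> A \<in> carrier_mat m n \<longrightarrow> B \<in> carrier_mat l n \<longrightarrow> 0 < \<epsilon> \<longrightarrow> \<epsilon> < 1 \<longrightarrow>
       (\<exists>t s. exec c (input_state p A B \<epsilon>) t s \<and>
              real t \<le> C * real (l + m + n) ^ k * (1 + ln (1 / \<epsilon>)) \<and>
              output_approximates \<epsilon> (F A B) s))"

end

theory Submission
  imports Defs "HOL-Analysis.Function_Topology" "HOL-Analysis.Convex" "Jordan_Normal_Form.Determinant"
begin

text \<open>\<^bold>\<open>Duality.\<close> Fix a row \<open>a\<close> of \<open>A\<close>. The largest value of \<open>a \<cdot> v\<close> subject to \<open>\<parallel>B v\<parallel>\<^sub>p \<le> 1\<close> is the norm of
the functional \<open>B v \<mapsto> a \<cdot> v\<close> on the range of \<open>B\<close>. The vectors \<open>\<beta>\<close> with \<open>B\<^sup>T \<beta> = a\<close> are precisely the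
extensions of this functional to the whole space, and by Hoelder's inequality and its sharpness the
norm of such an extension is the conjugate norm of \<open>\<beta>\<close>. So the claim for one row says that the
functional has an extension of the same norm, which is the Hahn-Banach theorem
(\<open>extend_dominated\<close>, \<open>bounded_functional_representable\<close>). If \<open>a\<close> does not vanish on the kernel of \<open>B\<close>,
there is no such functional; then the maximum is infinite and no \<open>\<beta>\<close> is feasible. Finite extrema are
attained by compactness.

\<^bold>\<open>Polynomial time.\<close> The number of operations may depend on the accuracy but not on the entries of the
matrices, so all scales have to be found by the program itself. For each row the following is done.

\<^item> The columns of \<open>B\<close> are processed one by one to obtain the orthogonal projection \<open>Q\<close> onto their
  complement and the solution \<open>c\<close> of \<open>B\<^sup>T c = a\<close> of least Euclidean norm, if there is a solution
  (\<open>projects_step\<close>, \<open>solves_step\<close>). The feasible set is then \<open>c + range Q\<close>, and the norm of \<open>c\<close> is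
  optimal up to the factor \<open>l\<close> (\<open>norm_c_le\<close>). This determines the scale of the problem up to a
  polynomial factor, whatever the entries are.

\<^item> The norm is minimized by the simplex variant of the ellipsoid method, due to Yamnitsky and Levin.
  A simplex is cut through its centroid along a subgradient, and the remaining part is enclosed in
  a new simplex that shares a vertex with the old one and arises by rescaling the edges at that
  vertex. To measure the progress, \<open>l + 1\<close> affinely independent points that are almost optimal are
  fixed. As long as none of them is cut off, the determinant of the matrix of their barycentric
  coordinates grows by the factor \<open>1 + 1 / (8 (l + 1)\<^sup>2)\<close> in every step (\<open>simplex_step\<close>), but it
  never exceeds \<open>(l + 1) ^ (l + 1)\<close> (\<open>volume_ratio_le\<close>). Therefore one of them is cut off after
  a number of steps that is a polynomial in \<open>l\<close> times the number of accuracy digits, and then an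
  almost optimal value has been seen (\<open>cut_invariant_end\<close>).

\<^item> For \<open>p = 1\<close> the norm to be minimized is the maximum norm. It is replaced by the norm of the large
  finite exponent \<open>4 (l + 1) / \<epsilon>\<close>, which changes it by a factor of at most \<open>1 + \<epsilon> / 2\<close>
  (\<open>exponent_norm\<close>). So a single program text with the exponent as a parameter serves all \<open>p\<close>.

The program is verified in a calculus of total correctness whose judgement includes a bound on the
running time that is read off from the syntax of the program (\<open>tot\<close>).\<close>

section \<open>The p-norms\<close>

text \<open>Vectors of dimension \<open>l\<close> are mostly represented by functions of which only the first \<open>l\<close> values
matter. Dimensions can then vary within a proof, and the product topology is available for
compactness arguments.\<close>

definition pn :: "ereal \<Rightarrow> nat \<Rightarrow> (nat \<Rightarrow> real) \<Rightarrow> real" where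
  "pn p l x = pnorm p (vec l x)"

lemma pn_infinity: "pn \<infinity> l x = Max (insert 0 ((\<lambda>i. \<bar>x i\<bar>) ` {..<l}))"
proof -
  have "(\<lambda>i. \<bar>vec l x $ i\<bar>) ` {..<l} = (\<lambda>i. \<bar>x i\<bar>) ` {..<l}"
    by (intro image_cong) auto
  then show ?thesis by (simp add: pn_def pnorm_def)
qed

lemma pn_real: "pn (ereal r) l x = (\<Sum>i<l. \<bar>x i\<bar> powr r) powr (1 / r)"
  by (simp add: pn_def pnorm_def)

lemma pn_one: "pn 1 l x = (\<Sum>i<l. \<bar>x i\<bar>)"
  unfolding one_ereal_def pn_real by (simp add: sum_nonneg)

lemma pn_cong:
  assumes "\<And>i. i < l \<Longrightarrow> x i = y i"
  shows "pn p l x = pn p l y"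
proof -
  have "vec l x = vec l y" using assms by auto
  then show ?thesis by (simp add: pn_def)
qed

lemma pn_vec: "v \<in> carrier_vec l \<Longrightarrow> pnorm p v = pn p l (\<lambda>i. v $ i)"
  unfolding pn_def by (rule arg_cong[of _ _ "pnorm p"], rule eq_vecI) simp_all

lemma ereal_ge_1_cases:
  fixes p :: ereal
  assumes "1 \<le> p"
  obtains "p = \<infinity>" | r where "p = ereal r" "1 \<le> r"
  using assms by (cases p) auto

lemma pn_nonneg: "0 \<le> pn p l x"
  unfolding pn_def pnorm_def by auto

lemma abs_le_pn:
  assumes "1 \<le> p" "i < l"
  shows "\<bar>x i\<bar> \<le> pn p l x"
  using assms(1)
proof (cases rule: ereal_ge_1_cases)
  case 1
  then show ?thesis using assms(2) by (auto simp: pn_infinity intro!: Max_ge)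
next
  case (2 r)
  have "\<bar>x i\<bar> = (\<bar>x i\<bar> powr r) powr (1 / r)" using 2 by (simp add: powr_powr)
  also have "\<dots> \<le> (\<Sum>i<l. \<bar>x i\<bar> powr r) powr (1 / r)"
    using 2 assms(2) by (intro powr_mono2 member_le_sum) auto
  finally show ?thesis using 2 by (simp add: pn_real)
qed

lemma pn_le_sum:
  assumes "1 \<le> p"
  shows "pn p l x \<le> (\<Sum>i<l. \<bar>x i\<bar>)"
  using assms
proof (cases rule: ereal_ge_1_cases)
  case 1
  have "\<bar>x i\<bar> \<le> (\<Sum>i<l. \<bar>x i\<bar>)" if "i < l" for i
    using that by (intro member_le_sum) auto
  then show ?thesis using 1 by (auto simp: pn_infinity sum_nonneg)
next
  case (2 r)
  define S where "S = (\<Sum>i<l. \<bar>x i\<bar>)"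
  have S: "0 \<le> S" by (simp add: S_def sum_nonneg)
  have *: "t powr r = t * t powr (r - 1)" if "0 \<le> t" for t :: real
    using that by (cases "t = 0") (auto simp: powr_diff)
  have "(\<Sum>i<l. \<bar>x i\<bar> powr r) \<le> (\<Sum>i<l. \<bar>x i\<bar> * S powr (r - 1))"
  proof (rule sum_mono)
    fix i assume i: "i \<in> {..<l}"
    have "\<bar>x i\<bar> \<le> S" unfolding S_def using i by (intro member_le_sum) auto
    then show "\<bar>x i\<bar> powr r \<le> \<bar>x i\<bar> * S powr (r - 1)"
      using 2 by (subst *) (auto intro!: mult_left_mono powr_mono2)
  qed
  also have "\<dots> = S powr r" using *[OF S] by (simp add: S_def sum_distrib_right)
  finally have "(\<Sum>i<l. \<bar>x i\<bar> powr r) powr (1/r) \<le> (S powr r) powr (1/r)"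
    using 2 by (intro powr_mono2) (auto intro: sum_nonneg)
  then show ?thesis using 2 S by (simp add: pn_real S_def[symmetric] powr_powr)
qed

lemma pn_eq_0:
  assumes "1 \<le> p" "pn p l x = 0" "i < l"
  shows "x i = 0"
  using abs_le_pn[OF assms(1,3), of x] assms(2) by simp

lemma pn_zero: "1 \<le> p \<Longrightarrow> (\<And>i. i < l \<Longrightarrow> x i = 0) \<Longrightarrow> pn p l x = 0"
  using pn_le_sum[of p l x] pn_nonneg[of p l x] by simp

text \<open>Conjugacy as a symmetric relation, split into the cases that the proofs have to distinguish.\<close>

definition conjugate :: "ereal \<Rightarrow> ereal \<Rightarrow> bool" where
  "conjugate p q \<longleftrightarrow> (p = 1 \<and> q = \<infinity>) \<or> (p = \<infinity> \<and> q = 1) \<or>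
    (\<exists>r s. p = ereal r \<and> q = ereal s \<and> 1 < r \<and> 1 < s \<and> 1 / r + 1 / s = 1)"

lemma conjugate_sym: "conjugate p q \<Longrightarrow> conjugate q p"
  by (auto simp: conjugate_def add.commute)

lemma conjugate_ge_1: assumes "conjugate p q" shows "1 \<le> p" "1 \<le> q"
  using assms by (auto simp: conjugate_def one_ereal_def)

lemma conjugate_hoelder_conj:
  assumes "1 \<le> p"
  shows "conjugate p (hoelder_conj p)"
  using assms
proof (cases rule: ereal_ge_1_cases)
  case (2 r)
  show ?thesis
  proof (cases "r = 1")
    case False
    then have "1 / r + 1 / (r / (r - 1)) = 1" "1 < r / (r - 1)"
      using 2 by (simp_all add: field_simps)
    then show ?thesis using 2 False
      by (auto simp: conjugate_def hoelder_conj_def one_ereal_def)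
  qed (use 2 in \<open>simp add: conjugate_def hoelder_conj_def one_ereal_def\<close>)
qed (simp add: conjugate_def hoelder_conj_def one_ereal_def)

text \<open>Young's inequality is applied to the vectors scaled to norm \<open>1\<close>, and the resulting inequalities are
added up.\<close>

lemma hoelder_pos:
  assumes r: "1 < r" "1 < s" "1 / r + 1 / s = (1::real)"
    and X: "0 < pn (ereal r) l x" and Y: "0 < pn (ereal s) l y"
  shows "(\<Sum>i<l. \<bar>x i\<bar> * \<bar>y i\<bar>) \<le> pn (ereal r) l x * pn (ereal s) l y"
proof -
  define X where "X = pn (ereal r) l x"
  define Y where "Y = pn (ereal s) l y"
  have XY: "0 < X" "0 < Y" using assms by (auto simp: X_def Y_def)
  have Xr: "X powr r = (\<Sum>i<l. \<bar>x i\<bar> powr r)" and Ys: "Y powr s = (\<Sum>i<l. \<bar>y i\<bar> powr s)"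
    using r by (simp_all add: X_def Y_def pn_real powr_powr sum_nonneg)
  have "(\<Sum>i<l. (\<bar>x i\<bar> / X) * (\<bar>y i\<bar> / Y)) \<le>
      (\<Sum>i<l. (\<bar>x i\<bar> / X) powr r / r + (\<bar>y i\<bar> / Y) powr s / s)"
    using r XY by (intro sum_mono Youngs_inequality) auto
  also have "\<dots> = (\<Sum>i<l. \<bar>x i\<bar> powr r) / X powr r / r + (\<Sum>i<l. \<bar>y i\<bar> powr s) / Y powr s / s"
    using XY by (simp add: sum.distrib powr_divide sum_divide_distrib)
  also have "\<dots> = 1" using XY r by (simp flip: Xr Ys)
  finally have "(\<Sum>i<l. \<bar>x i\<bar> * \<bar>y i\<bar>) / (X * Y) \<le> 1"
    by (simp add: sum_divide_distrib)
  then show ?thesis using XY by (simp add: X_def Y_def divide_le_eq)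
qed

lemma hoelder_one_infinity: "(\<Sum>i<l. \<bar>x i\<bar> * \<bar>y i\<bar>) \<le> pn 1 l x * pn \<infinity> l y"
  unfolding pn_one sum_distrib_right
  by (intro sum_mono mult_left_mono abs_le_pn) auto

lemma hoelder:
  assumes "conjugate p q"
  shows "\<bar>\<Sum>i<l. x i * y i\<bar> \<le> pn p l x * pn q l y"
proof -
  note ge1 = conjugate_ge_1[OF assms]
  have "\<bar>\<Sum>i<l. x i * y i\<bar> \<le> (\<Sum>i<l. \<bar>x i\<bar> * \<bar>y i\<bar>)"
    by (rule order.trans[OF sum_abs]) (simp add: abs_mult)
  also have "\<dots> \<le> pn p l x * pn q l y"
  proof (cases "pn p l x = 0 \<or> pn q l y = 0")
    case True
    then have "(\<Sum>i<l. \<bar>x i\<bar> * \<bar>y i\<bar>) = 0"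
      using pn_eq_0[OF ge1(1), of l x] pn_eq_0[OF ge1(2), of l y] by (intro sum.neutral) auto
    then show ?thesis by (simp add: pn_nonneg)
  next
    case False
    then have pos: "0 < pn p l x" "0 < pn q l y"
      using pn_nonneg[of p l x] pn_nonneg[of q l y] by linarith+
    from assms consider "p = 1" "q = \<infinity>" | "p = \<infinity>" "q = 1"
      | r s where "p = ereal r" "q = ereal s" "1 < r" "1 < s" "1 / r + 1 / s = 1"
      by (auto simp: conjugate_def)
    then show ?thesis
    proof cases
      case 1 then show ?thesis by (simp add: hoelder_one_infinity)
    next
      case 2 then show ?thesis using hoelder_one_infinity[where l = l and x = y and y = x] by (simp add: mult.commute)
    next
      case 3 then show ?thesis using hoelder_pos pos by simp
    qed
  qed
  finally show ?thesis .
qed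

text \<open>Hoelder's inequality is sharp: the signs of \<open>x\<close> for \<open>p = 1\<close>, a signed unit vector at an entry of
largest modulus for \<open>p = \<infinity>\<close>, and the normalized gradient of the norm otherwise.\<close>

lemma norming_vector:
  assumes "conjugate p q"
  shows "\<exists>y. pn q l y \<le> 1 \<and> (\<Sum>i<l. x i * y i) = pn p l x"
proof -
  note ge1 = conjugate_ge_1[OF assms]
  from assms consider "p = 1" "q = \<infinity>" | "p = \<infinity>" "q = 1"
    | r s where "p = ereal r" "q = ereal s" "1 < r" "1 < s" "1 / r + 1 / s = 1"
    by (auto simp: conjugate_def)
  then show ?thesis
  proof cases
    case 1
    have "pn q l (\<lambda>i. sgn (x i)) \<le> 1" unfolding 1 pn_infinity by (auto simp: abs_sgn_eq)
    moreover have "(\<Sum>i<l. x i * sgn (x i)) = pn p l x" unfolding 1 pn_one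
      by (simp add: abs_sgn)
    ultimately show ?thesis by blast
  next
    case 2
    have "pn \<infinity> l x \<in> insert 0 ((\<lambda>i. \<bar>x i\<bar>) ` {..<l})"
      unfolding pn_infinity by (intro Max_in) auto
    then consider "pn \<infinity> l x = 0" | k where "k < l" "pn \<infinity> l x = \<bar>x k\<bar>" by auto
    then show ?thesis
    proof cases
      case a: 1
      show ?thesis using a 2 by (intro exI[of _ "\<lambda>_. 0"]) (simp add: pn_one)
    next
      case k: 2
      let ?y = "\<lambda>i. if i = k then sgn (x k) else 0"
      have "(\<Sum>i<l. \<bar>?y i\<bar>) = (\<Sum>i<l. if i = k then \<bar>sgn (x k)\<bar> else 0)"
        by (intro sum.cong) auto
      then have "pn q l ?y \<le> 1" using k 2 by (simp add: pn_one abs_sgn_eq)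
      moreover have "(\<Sum>i<l. x i * ?y i) = (\<Sum>i<l. if i = k then x k * sgn (x k) else 0)"
        by (intro sum.cong) auto
      then have "(\<Sum>i<l. x i * ?y i) = pn p l x" using k 2 by (simp add: abs_sgn)
      ultimately show ?thesis by blast
    qed
  next
    case 3
    define X where "X = pn p l x"
    show ?thesis
    proof (cases "X = 0")
      case True
      then show ?thesis using pn_zero[OF ge1(2), of l "\<lambda>_. 0"] unfolding X_def
        by (intro exI[of _ "\<lambda>_. 0"]) simp
    next
      case False
      then have X: "0 < X" using pn_nonneg[of p l x] unfolding X_def by linarith
      have Xr: "X powr r = (\<Sum>i<l. \<bar>x i\<bar> powr r)"
        using 3 by (simp add: X_def pn_real powr_powr sum_nonneg)
      have rs: "(r - 1) * s = r" using 3(3,4,5) by (simp add: field_simps)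
      let ?y = "\<lambda>i. sgn (x i) * \<bar>x i\<bar> powr (r - 1) / X powr (r - 1)"
      have "(\<Sum>i<l. \<bar>?y i\<bar> powr s) = (\<Sum>i<l. \<bar>x i\<bar> powr r / X powr r)"
        using X by (intro sum.cong) (auto simp: abs_mult abs_sgn_eq powr_divide powr_powr rs)
      also have "\<dots> = 1" using X by (simp flip: sum_divide_distrib Xr)
      finally have "pn q l ?y = 1" by (simp add: 3 pn_real)
      moreover have "(\<Sum>i<l. x i * ?y i) = (\<Sum>i<l. \<bar>x i\<bar> powr r / X powr (r - 1))"
      proof (intro sum.cong refl)
        fix i
        have "x i * sgn (x i) * \<bar>x i\<bar> powr (r - 1) = \<bar>x i\<bar> powr r"
          by (cases "x i = 0") (auto simp: powr_diff simp flip: abs_sgn)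
        then show "x i * ?y i = \<bar>x i\<bar> powr r / X powr (r - 1)" by simp
      qed
      then have "(\<Sum>i<l. x i * ?y i) = X powr r / X powr (r - 1)"
        by (simp add: Xr sum_divide_distrib)
      then have "(\<Sum>i<l. x i * ?y i) = X" using X by (simp flip: powr_diff)
      ultimately show ?thesis by (intro exI[of _ ?y] conjI) (simp_all add: X_def)
    qed
  qed
qed

text \<open>Together, Hoelder's inequality and norming vectors exhibit the norm as a supremum of linear
functionals. The triangle inequality and homogeneity are immediate from this description, for all
exponents at once.\<close>

lemma pn_le_iff:
  assumes "conjugate p q"
  shows "pn q l \<beta> \<le> M \<longleftrightarrow> (\<forall>x. pn p l x \<le> 1 \<longrightarrow> (\<Sum>i<l. \<beta> i * x i) \<le> M)"
proof
  assume M: "pn q l \<beta> \<le> M"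
  show "\<forall>x. pn p l x \<le> 1 \<longrightarrow> (\<Sum>i<l. \<beta> i * x i) \<le> M"
  proof (intro allI impI)
    fix x assume "pn p l x \<le> 1"
    then have "pn q l \<beta> * pn p l x \<le> pn q l \<beta>" by (simp add: mult_left_le pn_nonneg)
    then show "(\<Sum>i<l. \<beta> i * x i) \<le> M"
      using hoelder[OF conjugate_sym[OF assms], where l = l and x = \<beta> and y = x] M by linarith
  qed
next
  assume "\<forall>x. pn p l x \<le> 1 \<longrightarrow> (\<Sum>i<l. \<beta> i * x i) \<le> M"
  then show "pn q l \<beta> \<le> M" using norming_vector[OF conjugate_sym[OF assms], where l = l and x = \<beta>] by force
qed

lemma pn_triangle:
  assumes "1 \<le> q"
  shows "pn q l (\<lambda>i. x i + y i) \<le> pn q l x + pn q l y"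
proof -
  define p where "p = hoelder_conj q"
  have c: "conjugate p q"
    unfolding p_def by (rule conjugate_sym[OF conjugate_hoelder_conj[OF assms]])
  show ?thesis unfolding pn_le_iff[OF c]
  proof (intro allI impI)
    fix z assume "pn p l z \<le> 1"
    then have "(\<Sum>i<l. x i * z i) \<le> pn q l x" "(\<Sum>i<l. y i * z i) \<le> pn q l y"
      using pn_le_iff[OF c] by blast+
    then show "(\<Sum>i<l. (x i + y i) * z i) \<le> pn q l x + pn q l y"
      by (simp add: distrib_right sum.distrib)
  qed
qed

lemma pn_scale:
  assumes "1 \<le> q"
  shows "pn q l (\<lambda>i. a * x i) = \<bar>a\<bar> * pn q l x"
proof (rule antisym)
  have le: "pn q l (\<lambda>i. a * x i) \<le> \<bar>a\<bar> * pn q l x" for a x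
  proof -
    define p where "p = hoelder_conj q"
    have c: "conjugate p q"
      unfolding p_def by (rule conjugate_sym[OF conjugate_hoelder_conj[OF assms]])
    show ?thesis unfolding pn_le_iff[OF c]
    proof (intro allI impI)
      fix z assume z: "pn p l z \<le> 1"
      have "(\<Sum>i<l. a * x i * z i) \<le> \<bar>a\<bar> * \<bar>\<Sum>i<l. x i * z i\<bar>"
        by (simp add: mult.assoc flip: sum_distrib_left abs_mult)
      also have "\<dots> \<le> \<bar>a\<bar> * (pn q l x * pn p l z)"
        by (intro mult_left_mono hoelder conjugate_sym[OF c]) auto
      also have "\<dots> \<le> \<bar>a\<bar> * pn q l x"
        using z by (intro mult_left_mono) (auto simp: mult_left_le pn_nonneg)
      finally show "(\<Sum>i<l. a * x i * z i) \<le> \<bar>a\<bar> * pn q l x" .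
    qed
  qed
  show "pn q l (\<lambda>i. a * x i) \<le> \<bar>a\<bar> * pn q l x" by (rule le)
  show "\<bar>a\<bar> * pn q l x \<le> pn q l (\<lambda>i. a * x i)"
  proof (cases "a = 0")
    case False
    then show ?thesis using le[of "1/a" "\<lambda>i. a * x i"] by (simp add: field_simps)
  qed (simp add: pn_nonneg)
qed

lemma pn_diff_le:
  assumes "1 \<le> q"
  shows "pn q l x - pn q l y \<le> (\<Sum>i<l. \<bar>x i - y i\<bar>)"
  using pn_triangle[OF assms, of l y "\<lambda>i. x i - y i"] pn_le_sum[OF assms, of l "\<lambda>i. x i - y i"]
  by simp

lemma pn_convex:
  assumes "1 \<le> q" "0 \<le> t" "t \<le> 1"
  shows "pn q l (\<lambda>i. t * x i + (1 - t) * y i) \<le> t * pn q l x + (1 - t) * pn q l y"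
  using pn_triangle[OF assms(1), of l "\<lambda>i. t * x i" "\<lambda>i. (1 - t) * y i"] assms
  by (simp add: pn_scale)

lemma continuous_on_coordinate [continuous_intros]: "continuous_on S (\<lambda>x :: nat \<Rightarrow> real. x i)"
  by (rule continuous_on_subset[OF continuous_on_product_coordinates]) simp

text \<open>By the triangle inequality, every norm is Lipschitz continuous with respect to the sum norm.\<close>

lemma continuous_on_pn:
  assumes "1 \<le> q"
  shows "continuous_on S (pn q l)"
proof (clarsimp simp: continuous_on_def)
  fix x :: "nat \<Rightarrow> real" assume "x \<in> S"
  have "((\<lambda>y. \<Sum>i<l. \<bar>y i - x i\<bar>) \<longlongrightarrow> (\<Sum>i<l. \<bar>x i - x i\<bar>)) (at x within S)"
    using \<open>x \<in> S\<close> continuous_on_def[of S "\<lambda>y. \<Sum>i<l. \<bar>y i - x i\<bar>"]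
    by (auto intro!: continuous_intros)
  then have lim: "((\<lambda>y. \<Sum>i<l. \<bar>y i - x i\<bar>) \<longlongrightarrow> 0) (at x within S)" by simp
  have "((\<lambda>y. pn q l y - pn q l x) \<longlongrightarrow> 0) (at x within S)"
  proof (rule tendsto_0_le[OF lim, of _ 1], rule always_eventually, rule allI)
    fix y
    show "norm (pn q l y - pn q l x) \<le> norm (\<Sum>i<l. \<bar>y i - x i\<bar>) * 1"
      using pn_diff_le[OF assms, of l y x] pn_diff_le[OF assms, of l x y]
      by (simp add: abs_minus_commute abs_le_iff)
  qed
  then show "(pn q l \<longlongrightarrow> pn q l x) (at x within S)" by (simp add: LIM_zero_iff)
qed

lemma compact_box:
  fixes l :: nat and R :: real
  shows "compact {x :: nat \<Rightarrow> real. (\<forall>i<l. \<bar>x i\<bar> \<le> R) \<and> (\<forall>i\<ge>l. x i = 0)}"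
proof -
  have "compactin (product_topology (\<lambda>_. euclidean) UNIV)
     (PiE UNIV (\<lambda>i. if i < l then {-R..R} else {0 :: real}))"
    unfolding compactin_PiE by auto
  moreover have "(PiE UNIV (\<lambda>i. if i < l then {-R..R} else {0 :: real})) =
    {x :: nat \<Rightarrow> real. (\<forall>i<l. \<bar>x i\<bar> \<le> R) \<and> (\<forall>i\<ge>l. x i = 0)}"
    (is "?L = ?R")
  proof (rule Set.set_eqI)
    fix x :: "nat \<Rightarrow> real"
    have "x \<in> ?L \<longleftrightarrow> (\<forall>i. x i \<in> (if i < l then {-R..R} else {0 :: real}))" by (simp add: PiE_iff)
    also have "\<dots> \<longleftrightarrow> (\<forall>i. (i < l \<longrightarrow> \<bar>x i\<bar> \<le> R) \<and> (l \<le> i \<longrightarrow> x i = 0))"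
    proof (intro iff_allI)
      fix i show "x i \<in> (if i < l then {-R..R} else {0}) \<longleftrightarrow>
          (i < l \<longrightarrow> \<bar>x i\<bar> \<le> R) \<and> (l \<le> i \<longrightarrow> x i = 0)"
        by (cases "i < l") (auto simp: abs_le_iff)
    qed
    also have "\<dots> \<longleftrightarrow> x \<in> ?R" by blast
    finally show "x \<in> ?L \<longleftrightarrow> x \<in> ?R" .
  qed
  ultimately show ?thesis by (simp add: euclidean_product_topology)
qed

section \<open>Extension of dominated linear functionals\<close>

text \<open>The step of the Hahn-Banach theorem: a linear functional that is dominated by a sublinear \<open>N\<close> is
extended by one further direction \<open>e\<close>. The admissible values at \<open>e\<close> lie between the numbers
\<open>a y - N (T y - e)\<close> and \<open>N (T z + e) - a z\<close>, and the former are below the latter by the triangle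
inequality.

The functional is given on coordinates \<open>y\<close> instead of on the span of the columns of \<open>T\<close>. So the
columns may be dependent, and it need not be known that the functional is well defined on the span.\<close>

lemma extend_dominated_step:
  fixes N :: "(nat \<Rightarrow> real) \<Rightarrow> real" and T :: "nat \<Rightarrow> nat \<Rightarrow> real"
  assumes tri: "\<And>x y. N (\<lambda>i. x i + y i) \<le> N x + N y"
    and hom: "\<And>a x. 0 \<le> a \<Longrightarrow> N (\<lambda>i. a * x i) = a * N x"
    and dom: "\<And>y. (\<Sum>k<K. a k * y k) \<le> N (\<lambda>i. \<Sum>k<K. y k * T k i)"
  shows "\<exists>\<alpha>. \<forall>y t. (\<Sum>k<K. a k * y k) + \<alpha> * t \<le> N (\<lambda>i. (\<Sum>k<K. y k * T k i) + t * e i)"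
proof -
  let ?L = "\<lambda>y. \<Sum>k<K. a k * y k" and ?T = "\<lambda>y i. \<Sum>k<K. y k * T k i"
  define S where "S = {?L y - N (\<lambda>i. ?T y i - e i) | y. True}"
  have key: "?L y - N (\<lambda>i. ?T y i - e i) \<le> N (\<lambda>i. ?T z i + e i) - ?L z" for y z
  proof -
    have "?L y + ?L z = ?L (\<lambda>k. y k + z k)"
      by (simp add: distrib_left sum.distrib)
    also have "\<dots> \<le> N (?T (\<lambda>k. y k + z k))" by (rule dom)
    also have "?T (\<lambda>k. y k + z k) = (\<lambda>i. (?T y i - e i) + (?T z i + e i))"
      by (simp add: distrib_right sum.distrib)
    also have "N \<dots> \<le> N (\<lambda>i. ?T y i - e i) + N (\<lambda>i. ?T z i + e i)" by (rule tri)
    finally show ?thesis by simp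
  qed
  have bdd: "bdd_above S" and ne: "S \<noteq> {}"
    using key[where z = "\<lambda>_. 0"] unfolding S_def
    by (auto intro!: bdd_aboveI[of _ "N (\<lambda>i. ?T (\<lambda>_. 0) i + e i) - ?L (\<lambda>_. 0)"])
  define \<alpha> where "\<alpha> = Sup S"
  have up: "?L y - N (\<lambda>i. ?T y i - e i) \<le> \<alpha>" for y
    unfolding \<alpha>_def by (rule cSup_upper[OF _ bdd]) (auto simp: S_def)
  have low: "\<alpha> \<le> N (\<lambda>i. ?T z i + e i) - ?L z" for z
    unfolding \<alpha>_def by (rule cSup_least[OF ne]) (auto simp: S_def intro: key[THEN order.trans] key)
  have "?L y + \<alpha> * t \<le> N (\<lambda>i. ?T y i + t * e i)" for y t
  proof (cases t "0 :: real" rule: linorder_cases)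
    case equal
    then show ?thesis using dom[of y] by simp
  next
    case greater
    \<comment> \<open>divide by \<open>t\<close> and use the bound for the direction \<open>e\<close>\<close>
    have "t * (?L (\<lambda>k. y k / t) + \<alpha>) \<le> t * N (\<lambda>i. ?T (\<lambda>k. y k / t) i + e i)"
      using low[of "\<lambda>k. y k / t"] greater by (intro mult_left_mono) auto
    also have "\<dots> = N (\<lambda>i. t * (?T (\<lambda>k. y k / t) i + e i))"
      using greater by (simp add: hom)
    finally show ?thesis using greater
      by (simp add: distrib_left sum_distrib_left mult.commute)
  next
    case less
    have "- t * (?L (\<lambda>k. y k / - t) - \<alpha>) \<le> - t * N (\<lambda>i. ?T (\<lambda>k. y k / - t) i - e i)"
      using up[of "\<lambda>k. y k / - t"] less by (intro mult_left_mono) auto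
    also have "\<dots> = N (\<lambda>i. - t * (?T (\<lambda>k. y k / - t) i - e i))"
      using less by (simp only: hom)
    finally show ?thesis using less
      by (simp add: right_diff_distrib sum_distrib_left sum_negf mult.commute)
  qed
  then show ?thesis by blast
qed

text \<open>All unit vectors are adjoined in turn.\<close>

lemma extend_dominated:
  fixes N :: "(nat \<Rightarrow> real) \<Rightarrow> real" and B :: "nat \<Rightarrow> nat \<Rightarrow> real"
  assumes tri: "\<And>x y. N (\<lambda>i. x i + y i) \<le> N x + N y"
    and hom: "\<And>a x. 0 \<le> a \<Longrightarrow> N (\<lambda>i. a * x i) = a * N x"
    and dom: "\<And>y. (\<Sum>k<n. a k * y k) \<le> N (\<lambda>i. \<Sum>k<n. y k * B i k)"
  shows "\<exists>\<beta>. \<forall>y x. (\<Sum>k<n. a k * y k) + (\<Sum>j<l. \<beta> j * x j)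
      \<le> N (\<lambda>i. (\<Sum>k<n. y k * B i k) + (if i < l then x i else 0))"
proof (induction l)
  case 0
  then show ?case using dom by simp
next
  case (Suc l)
  then obtain \<beta> where \<beta>: "\<And>y x. (\<Sum>k<n. a k * y k) + (\<Sum>j<l. \<beta> j * x j)
      \<le> N (\<lambda>i. (\<Sum>k<n. y k * B i k) + (if i < l then x i else 0))" by blast
  \<comment> \<open>the coordinates of \<open>y\<close> and \<open>x\<close> side by side\<close>
  define a' where "a' k = (if k < n then a k else \<beta> (k - n))" for k
  define T where "T k i = (if k < n then B i k else if i = k - n then 1 else 0)" for k i
  have split: "(\<Sum>k<n + l. f k) = (\<Sum>k<n. f k) + (\<Sum>j<l. f (n + j))" for f :: "nat \<Rightarrow> real"
    by (induction l) auto
  have a'_sum: "(\<Sum>k<n + l. a' k * y k) = (\<Sum>k<n. a k * y k) + (\<Sum>j<l. \<beta> j * y (n + j))" for y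
    unfolding split by (simp add: a'_def)
  have T_sum: "(\<Sum>k<n + l. y k * T k i) =
      (\<Sum>k<n. y k * B i k) + (if i < l then y (n + i) else 0)" for y i
    unfolding split by (simp add: T_def if_distrib[of "\<lambda>z. _ * z"] cong: if_cong)
  have "(\<Sum>k<n + l. a' k * y k) \<le> N (\<lambda>i. \<Sum>k<n + l. y k * T k i)" for y
    unfolding a'_sum T_sum using \<beta>[of y "\<lambda>i. y (n + i)"] by simp
  from extend_dominated_step[where e = "\<lambda>i. if i = l then 1 else 0", OF tri hom this]
  obtain \<alpha> where \<alpha>: "\<And>y t. (\<Sum>k<n + l. a' k * y k) + \<alpha> * t
      \<le> N (\<lambda>i. (\<Sum>k<n + l. y k * T k i) + t * (if i = l then 1 else 0))" by blast
  show ?case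
  proof (intro exI[of _ "\<beta>(l := \<alpha>)"] allI)
    fix y x :: "nat \<Rightarrow> real"
    let ?z = "\<lambda>k. if k < n then y k else x (k - n)"
    have "(\<Sum>k<n. a k * y k) + (\<Sum>j<Suc l. (\<beta>(l := \<alpha>)) j * x j) =
        (\<Sum>k<n + l. a' k * ?z k) + \<alpha> * x l"
      unfolding a'_sum by simp
    also have "\<dots> \<le> N (\<lambda>i. (\<Sum>k<n + l. ?z k * T k i) + x l * (if i = l then 1 else 0))" by (rule \<alpha>)
    also have "(\<lambda>i. (\<Sum>k<n + l. ?z k * T k i) + x l * (if i = l then 1 else 0)) =
        (\<lambda>i. (\<Sum>k<n. y k * B i k) + (if i < Suc l then x i else 0))"
      unfolding T_sum by (auto simp: fun_eq_iff less_Suc_eq)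
    finally show "(\<Sum>k<n. a k * y k) + (\<Sum>j<Suc l. (\<beta>(l := \<alpha>)) j * x j)
      \<le> N (\<lambda>i. (\<Sum>k<n. y k * B i k) + (if i < Suc l then x i else 0))" .
  qed
qed

definition feasible :: "nat \<Rightarrow> nat \<Rightarrow> (nat \<Rightarrow> nat \<Rightarrow> real) \<Rightarrow> (nat \<Rightarrow> real) \<Rightarrow> (nat \<Rightarrow> real) set" where
  "feasible l n B a = {\<beta>. \<forall>k<n. (\<Sum>i<l. B i k * \<beta> i) = a k}"

lemma feasible_inner:
  assumes "\<beta> \<in> feasible l n B a"
  shows "(\<Sum>i<l. \<beta> i * (\<Sum>k<n. B i k * y k)) = (\<Sum>k<n. a k * y k)"
proof -
  have "(\<Sum>i<l. \<beta> i * (\<Sum>k<n. B i k * y k)) = (\<Sum>k<n. \<Sum>i<l. B i k * \<beta> i * y k)"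
    by (subst sum.swap) (simp add: sum_distrib_left mult_ac)
  also have "\<dots> = (\<Sum>k<n. a k * y k)"
    using assms by (intro sum.cong) (auto simp: feasible_def simp flip: sum_distrib_right)
  finally show ?thesis .
qed

text \<open>The coefficients at the adjoined unit vectors form \<open>\<beta>\<close>. On the kernel pairs \<open>(y, - B y)\<close> the
dominating norm vanishes, hence so does the extended functional, which says \<open>B\<^sup>T \<beta> = a\<close>; on the
pairs \<open>(0, x)\<close> domination bounds the conjugate norm of \<open>\<beta>\<close>.\<close>

lemma bounded_functional_representable:
  assumes c: "conjugate p q" and M: "0 \<le> M"
    and dom: "\<And>y. (\<Sum>k<n. a k * y k) \<le> M * pn p l (\<lambda>i. \<Sum>k<n. B i k * y k)"
  shows "\<exists>\<beta>\<in>feasible l n B a. pn q l \<beta> \<le> M"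
proof -
  note ge1 = conjugate_ge_1[OF c]
  let ?N = "\<lambda>x. M * pn p l x"
  have tri: "?N (\<lambda>i. x i + y i) \<le> ?N x + ?N y" for x y
    using pn_triangle[OF ge1(1), of l x y] M by (simp add: mult_left_mono flip: distrib_left)
  have hom: "?N (\<lambda>i. t * x i) = t * ?N x" if "0 \<le> t" for t x
    using that by (simp add: pn_scale[OF ge1(1)])
  have "(\<Sum>k<n. a k * y k) \<le> M * pn p l (\<lambda>i. \<Sum>k<n. y k * B i k)" for y
    using dom[of y] by (simp add: mult.commute)
  from extend_dominated[of ?N, OF tri hom this, of l]
  obtain \<beta> where \<beta>: "\<And>y x. (\<Sum>k<n. a k * y k) + (\<Sum>j<l. \<beta> j * x j)
      \<le> M * pn p l (\<lambda>i. (\<Sum>k<n. y k * B i k) + (if i < l then x i else 0))" by blast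
  have "pn q l \<beta> \<le> M"
    unfolding pn_le_iff[OF c]
  proof (intro allI impI)
    fix x assume "pn p l x \<le> 1"
    moreover have "pn p l (\<lambda>i. if i < l then x i else 0) = pn p l x" by (rule pn_cong) simp
    ultimately have "M * pn p l (\<lambda>i. if i < l then x i else 0) \<le> M"
      using M by (simp add: mult_left_le)
    then show "(\<Sum>i<l. \<beta> i * x i) \<le> M" using \<beta>[of "\<lambda>_. 0" x] by simp
  qed
  moreover have "\<beta> \<in> feasible l n B a"
    unfolding feasible_def
  proof (intro CollectI allI impI)
    fix k assume k: "k < n"
    \<comment> \<open>on the graph \<open>x = - B y\<close> the bound vanishes, so the functional does\<close>
    have le: "(\<Sum>k<n. a k * y k) + (\<Sum>j<l. \<beta> j * - (\<Sum>k<n. y k * B j k)) \<le> 0" for y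
    proof -
      have "pn p l (\<lambda>i. (\<Sum>k<n. y k * B i k) + (if i < l then - (\<Sum>k<n. y k * B i k) else 0)) = 0"
        by (rule pn_zero[OF ge1(1)]) simp
      then show ?thesis using \<beta>[of y "\<lambda>i. - (\<Sum>k<n. y k * B i k)"] by simp
    qed
    have unit: "(\<Sum>k'<n. f k' * (if k' = k then s else 0)) = f k * s" for f and s :: real
      using k by (simp add: if_distrib[of "\<lambda>z. _ * z"] cong: if_cong)
    have unit': "(\<Sum>k'<n. (if k' = k then s else 0) * f k') = f k * s" for f and s :: real
      using unit[of f s] by (simp add: mult.commute)
    have "a k - (\<Sum>j<l. \<beta> j * B j k) \<le> 0"
      using le[of "\<lambda>k'. if k' = k then 1 else 0"] by (simp add: unit unit' sum_negf)
    moreover have "- a k + (\<Sum>j<l. \<beta> j * B j k) \<le> 0"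
      using le[of "\<lambda>k'. if k' = k then - 1 else 0"] by (simp add: unit unit' sum_negf)
    ultimately show "(\<Sum>i<l. B i k * \<beta> i) = a k" by (simp add: mult.commute)
  qed
  ultimately show ?thesis by blast
qed

text \<open>The feasible set is closed, and the sublevel sets of the norm lie in boxes. Coordinates beyond \<open>l\<close>
are set to \<open>0\<close> to make the box compact.\<close>

lemma dual_attained:
  assumes q: "1 \<le> q" and ne: "feasible l n B a \<noteq> {}"
  shows "\<exists>\<beta>\<in>feasible l n B a. \<forall>\<gamma>\<in>feasible l n B a. pn q l \<beta> \<le> pn q l \<gamma>"
proof -
  obtain \<beta>0 where \<beta>0: "\<beta>0 \<in> feasible l n B a" using ne by blast
  define R where "R = pn q l \<beta>0"
  define trunc where "trunc \<beta> = (\<lambda>i. if i < l then \<beta> i else 0)" for \<beta> :: "nat \<Rightarrow> real"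
  have pn_trunc: "pn q l (trunc \<beta>) = pn q l \<beta>" for \<beta> by (rule pn_cong) (simp add: trunc_def)
  let ?box = "{x :: nat \<Rightarrow> real. (\<forall>i<l. \<bar>x i\<bar> \<le> R) \<and> (\<forall>i\<ge>l. x i = 0)}"
  define K where "K = ?box \<inter> feasible l n B a"
  have "closed (feasible l n B a)"
  proof -
    have "feasible l n B a = (\<Inter>k\<in>{..<n}. {\<beta>. (\<Sum>i<l. B i k * \<beta> i) = a k})"
      by (auto simp: feasible_def)
    then show ?thesis by (auto intro!: closed_INT closed_Collect_eq continuous_intros)
  qed
  then have cpt: "compact K" unfolding K_def by (intro compact_Int_closed compact_box)
  have mem: "trunc \<beta> \<in> K"
    if "\<beta> \<in> feasible l n B a" "pn q l \<beta> \<le> R" for \<beta>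
    using that order.trans[OF abs_le_pn[OF q, of _ l \<beta>], of _ R] by (auto simp: K_def trunc_def feasible_def)
  have ne': "K \<noteq> {}" using mem[OF \<beta>0] unfolding R_def by blast
  from continuous_attains_inf[OF cpt ne' continuous_on_pn[OF q]]
  obtain \<beta> where \<beta>: "\<beta> \<in> K"
    "\<And>\<gamma>. \<gamma> \<in> K \<Longrightarrow> pn q l \<beta> \<le> pn q l \<gamma>" by blast
  have "pn q l \<beta> \<le> pn q l \<gamma>" if "\<gamma> \<in> feasible l n B a" for \<gamma>
  proof (cases "pn q l \<gamma> \<le> R")
    case True
    then show ?thesis using \<beta>(2)[OF mem[OF that True]] by (simp add: pn_trunc)
  next
    case False
    have "pn q l \<beta> \<le> pn q l \<beta>0" using \<beta>(2)[OF mem[OF \<beta>0]] by (simp add: pn_trunc R_def)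
    then show ?thesis using False by (simp add: R_def)
  qed
  then show ?thesis using \<beta>(1) unfolding K_def by blast
qed

section \<open>Orthogonal projection along the columns\<close>

definition app :: "nat \<Rightarrow> (nat \<Rightarrow> nat \<Rightarrow> real) \<Rightarrow> (nat \<Rightarrow> real) \<Rightarrow> nat \<Rightarrow> real" where
  "app l Q x r = (\<Sum>s<l. Q r s * x s)"

definition inner_prod :: "nat \<Rightarrow> (nat \<Rightarrow> real) \<Rightarrow> (nat \<Rightarrow> real) \<Rightarrow> real" where
  "inner_prod l x y = (\<Sum>i<l. x i * y i)"

text \<open>The orthogonal projection onto the complement of the first \<open>j\<close> columns of \<open>B\<close>: a symmetric
  idempotent that kills these columns and differs from the identity by their combinations.\<close>

definition projects :: "nat \<Rightarrow> nat \<Rightarrow> (nat \<Rightarrow> nat \<Rightarrow> real) \<Rightarrow> (nat \<Rightarrow> nat \<Rightarrow> real) \<Rightarrow> bool" where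
  "projects l j B Q \<longleftrightarrow>
     (\<forall>r<l. \<forall>s<l. Q r s = Q s r) \<and>
     (\<forall>x. \<forall>r<l. app l Q (app l Q x) r = app l Q x r) \<and>
     (\<forall>k<j. \<forall>r<l. app l Q (\<lambda>s. B s k) r = 0) \<and>
     (\<forall>x. \<exists>\<gamma>. \<forall>r<l. x r - app l Q x r = (\<Sum>k<j. \<gamma> k * B r k))"

lemma inner_prod_commute: "inner_prod l x y = inner_prod l y x"
  by (simp add: inner_prod_def mult.commute)

lemma inner_prod_cong:
  "(\<And>i. i < l \<Longrightarrow> x i = x' i) \<Longrightarrow> (\<And>i. i < l \<Longrightarrow> y i = y' i) \<Longrightarrow> inner_prod l x y = inner_prod l x' y'"
  by (simp add: inner_prod_def)

lemma app_cong:
  "(\<And>s. s < l \<Longrightarrow> Q r s = Q' r s) \<Longrightarrow> (\<And>i. i < l \<Longrightarrow> x i = x' i) \<Longrightarrow> app l Q x r = app l Q' x' r"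
  by (simp add: app_def)

lemma app_add: "app l Q (\<lambda>s. x s + y s) r = app l Q x r + app l Q y r"
  by (simp add: app_def distrib_left sum.distrib)

lemma app_diff: "app l Q (\<lambda>s. x s - y s) r = app l Q x r - app l Q y r"
  by (simp add: app_def right_diff_distrib sum_subtractf)

lemma app_scale: "app l Q (\<lambda>s. a * x s) r = a * app l Q x r"
  by (simp add: app_def sum_distrib_left mult_ac)

lemma inner_prod_add_right: "inner_prod l z (\<lambda>s. x s + y s) = inner_prod l z x + inner_prod l z y"
  by (simp add: inner_prod_def distrib_left sum.distrib)

lemma inner_prod_diff_right: "inner_prod l z (\<lambda>s. x s - y s) = inner_prod l z x - inner_prod l z y"
  by (simp add: inner_prod_def right_diff_distrib sum_subtractf)

lemma inner_prod_scale_right: "inner_prod l z (\<lambda>s. a * x s) = a * inner_prod l z x"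
  by (simp add: inner_prod_def sum_distrib_left mult_ac)

lemma inner_prod_sum_right:
  "inner_prod l z (\<lambda>s. \<Sum>k<j. g k * b s k) = (\<Sum>k<j. g k * inner_prod l z (\<lambda>s. b s k))"
  unfolding inner_prod_def sum_distrib_left by (subst sum.swap) (simp add: mult_ac)

lemma inner_prod_self_eq_0: "inner_prod l u u = 0 \<longleftrightarrow> (\<forall>i<l. u i = 0)"
  by (auto simp: inner_prod_def sum_nonneg_eq_0_iff)

lemma inner_prod_app_symmetric:
  assumes "\<forall>r<l. \<forall>s<l. Q r s = Q s r"
  shows "inner_prod l x (app l Q y) = inner_prod l (app l Q x) y"
proof -
  have "inner_prod l x (app l Q y) = (\<Sum>s<l. \<Sum>r<l. x r * (Q r s * y s))"
    unfolding inner_prod_def app_def sum_distrib_left by (rule sum.swap)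
  also have "\<dots> = (\<Sum>s<l. \<Sum>r<l. Q s r * x r * y s)"
    using assms by (intro sum.cong) (auto simp: mult_ac)
  finally show ?thesis by (simp add: inner_prod_def app_def sum_distrib_right)
qed

lemma app_rank_one_update:
  assumes "\<And>s. s < l \<Longrightarrow> Q' r s = Q r s - u r * u s / d"
  shows "app l Q' x r = app l Q x r - u r * (inner_prod l u x / d)"
proof -
  have "app l Q' x r = (\<Sum>s<l. Q r s * x s - u r / d * (u s * x s))"
    unfolding app_def by (intro sum.cong) (auto simp: assms algebra_simps)
  then show ?thesis
    by (simp add: app_def inner_prod_def sum_subtractf sum_distrib_left sum_divide_distrib)
qed

lemma projects_0:
  assumes "\<And>r s. r < l \<Longrightarrow> s < l \<Longrightarrow> Q r s = (if r = s then 1 else 0)"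
  shows "projects l 0 B Q"
proof -
  have "app l Q x r = x r" if "r < l" for x r
  proof -
    have "app l Q x r = (\<Sum>s<l. if s = r then x s else 0)"
      unfolding app_def using that assms by (intro sum.cong) auto
    then show ?thesis using that by simp
  qed
  then show ?thesis using assms unfolding projects_def
    by (auto cong: app_cong)
qed

lemma projects_D:
  assumes "projects l j B Q"
  shows projects_symmetric: "\<forall>r<l. \<forall>s<l. Q r s = Q s r"
    and projects_idem: "\<And>x r. r < l \<Longrightarrow> app l Q (app l Q x) r = app l Q x r"
    and projects_column: "\<And>k r. k < j \<Longrightarrow> r < l \<Longrightarrow> app l Q (\<lambda>s. B s k) r = 0"
    and projects_span: "\<And>x. \<exists>\<gamma>. \<forall>r<l. x r - app l Q x r = (\<Sum>k<j. \<gamma> k * B r k)"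
  using assms unfolding projects_def by blast+

text \<open>The vector \<open>u = Q b\<close> is the part of the next column \<open>b\<close> that is orthogonal to the earlier columns.\<close>

lemma projected_column:
  assumes P: "projects l j B Q" and u: "\<And>r. r < l \<Longrightarrow> u r = app l Q (\<lambda>s. B s j) r"
  shows projected_column_fixed: "\<And>r. r < l \<Longrightarrow> app l Q u r = u r"
    and inner_projected_column: "\<And>x. inner_prod l u x = inner_prod l (app l Q x) (\<lambda>s. B s j)"
    and inner_projected_column_self: "inner_prod l u (\<lambda>s. B s j) = inner_prod l u u"
proof -
  let ?b = "\<lambda>s. B s j"
  show Qu: "app l Q u r = u r" if "r < l" for r
  proof -
    have "app l Q u r = app l Q (app l Q ?b) r" by (rule app_cong) (auto simp: u)
    then show ?thesis using projects_idem[OF P that] u[OF that] by simp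
  qed
  show inner_u: "inner_prod l u x = inner_prod l (app l Q x) ?b" for x
  proof -
    have "inner_prod l u x = inner_prod l x (app l Q ?b)"
      using u by (subst inner_prod_commute) (rule inner_prod_cong, auto)
    then show ?thesis by (simp add: inner_prod_app_symmetric[OF projects_symmetric[OF P]])
  qed
  have "inner_prod l (app l Q u) ?b = inner_prod l u ?b" by (rule inner_prod_cong) (auto simp: Qu)
  then show "inner_prod l u ?b = inner_prod l u u" using inner_u[of u] by simp
qed

text \<open>Passing to the next column subtracts the projection onto the line of \<open>u\<close>. If the column depends on
the earlier ones, then \<open>u = 0\<close>, and since division by \<open>0\<close> gives \<open>0\<close> the matrix does not change.\<close>

lemma projects_step:
  assumes P: "projects l j B Q"
    and u: "\<And>r. r < l \<Longrightarrow> u r = app l Q (\<lambda>s. B s j) r"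
    and Q': "\<And>r s. r < l \<Longrightarrow> s < l \<Longrightarrow> Q' r s = Q r s - u r * u s / inner_prod l u u"
  shows "projects l (Suc j) B Q'"
proof -
  let ?b = "\<lambda>s. B s j" and ?uu = "inner_prod l u u"
  note idem = projects_idem[OF P] and kill = projects_column[OF P] and span = projects_span[OF P]
  have Qu: "\<And>r. r < l \<Longrightarrow> app l Q u r = u r"
    and inner_u: "\<And>x. inner_prod l u x = inner_prod l (app l Q x) ?b"
    and ub: "inner_prod l u ?b = ?uu"
    using projected_column[OF P u] by blast+
  have app': "app l Q' x r = app l Q x r - u r * (inner_prod l u x / ?uu)" if "r < l" for x r
    using that Q' by (intro app_rank_one_update) auto
  have uQ: "inner_prod l u (app l Q x) = inner_prod l u x" for x
    unfolding inner_u using idem by (intro inner_prod_cong) auto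
  have u0: "u r = 0" if "?uu = 0" "r < l" for r using that by (simp add: inner_prod_self_eq_0)
  have "Q' r s = Q' s r" if "r < l" "s < l" for r s
    using that projects_symmetric[OF P] by (simp add: Q' mult.commute)
  moreover have "app l Q' (app l Q' x) r = app l Q' x r" if r: "r < l" for x r
  proof -
    define t where "t = inner_prod l u x / ?uu"
    have "app l Q' (app l Q' x) r = app l Q' (\<lambda>s. app l Q x s - t * u s) r"
      using app' by (intro app_cong) (auto simp: t_def mult.commute)
    also have "\<dots> = app l Q (app l Q x) r - t * app l Q u r
        - u r * ((inner_prod l u (app l Q x) - t * ?uu) / ?uu)"
      unfolding app'[OF r] app_diff app_scale inner_prod_diff_right inner_prod_scale_right
      by (simp add: diff_divide_distrib right_diff_distrib)
    also have "\<dots> = app l Q x r - t * u r - u r * ((inner_prod l u x - t * ?uu) / ?uu)"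
      using r by (simp add: idem Qu uQ)
    also have "\<dots> = app l Q x r - u r * t"
      using r u0 by (cases "?uu = 0") (auto simp: t_def diff_divide_distrib)
    finally show ?thesis using r by (simp add: app' t_def)
  qed
  moreover have "app l Q' (\<lambda>s. B s k) r = 0" if "k < Suc j" "r < l" for k r
  proof (cases "k = j")
    case True
    then show ?thesis using that u0 by (cases "?uu = 0") (auto simp: app' ub simp flip: u)
  next
    case False
    then have k: "k < j" using that by simp
    have "inner_prod l u (\<lambda>s. B s k) = 0" unfolding inner_u
      using kill[OF k] by (simp add: inner_prod_def)
    then show ?thesis using that kill[OF k] by (simp add: app')
  qed
  moreover have "\<exists>\<gamma>. \<forall>r<l. x r - app l Q' x r = (\<Sum>k<Suc j. \<gamma> k * B r k)" for x
  proof -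
    obtain \<gamma> where \<gamma>: "\<forall>r<l. x r - app l Q x r = (\<Sum>k<j. \<gamma> k * B r k)"
      using span[of x] by blast
    obtain \<delta> where \<delta>: "\<forall>r<l. ?b r - app l Q ?b r = (\<Sum>k<j. \<delta> k * B r k)"
      using span[of ?b] by blast
    define t where "t = inner_prod l u x / ?uu"
    have "x r - app l Q' x r = (\<Sum>k<Suc j. ((\<lambda>k. \<gamma> k - t * \<delta> k)(j := t)) k * B r k)"
      if r: "r < l" for r
    proof -
      have "x r - app l Q' x r = (\<Sum>k<j. \<gamma> k * B r k) + t * (B r j - (\<Sum>k<j. \<delta> k * B r k))"
        using r \<gamma> \<delta> u[OF r] by (simp add: app' t_def algebra_simps)
      then show ?thesis
        by (simp add: sum_subtractf sum_distrib_left algebra_simps)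
    qed
    then show ?thesis by blast
  qed
  ultimately show ?thesis unfolding projects_def by blast
qed

lemma projects_exists: "\<exists>Q. projects l j B Q"
proof (induction j)
  case 0
  show ?case using projects_0[of l "\<lambda>r s. if r = s then 1 else 0"] by blast
next
  case (Suc j)
  then obtain Q where Q: "projects l j B Q" by blast
  show ?case by (rule exI, rule projects_step[OF Q refl refl])
qed

text \<open>The first condition says that \<open>c\<close> is a combination of the first \<open>j\<close> columns, which makes it
  the solution of least Euclidean norm.\<close>

definition solves :: "nat \<Rightarrow> nat \<Rightarrow> (nat \<Rightarrow> nat \<Rightarrow> real) \<Rightarrow> (nat \<Rightarrow> real) \<Rightarrow>
    (nat \<Rightarrow> nat \<Rightarrow> real) \<Rightarrow> (nat \<Rightarrow> real) \<Rightarrow> bool" where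
  "solves l j B a Q c \<longleftrightarrow> (\<forall>r<l. app l Q c r = 0) \<and>
     (feasible l j B a \<noteq> {} \<longrightarrow> c \<in> feasible l j B a)"

lemma feasible_iff: "c \<in> feasible l j B a \<longleftrightarrow> (\<forall>k<j. inner_prod l c (\<lambda>s. B s k) = a k)"
  by (simp add: feasible_def inner_prod_def mult.commute)

text \<open>Adding a multiple of \<open>u\<close> adjusts the equation of the new column without disturbing the earlier ones,
to which \<open>u\<close> is orthogonal. If \<open>u = 0\<close>, nothing is added; then the new equation is a consequence of
the earlier ones whenever the system is consistent.\<close>

lemma solves_step:
  assumes P: "projects l j B Q" and S: "solves l j B a Q c"
    and u: "\<And>r. r < l \<Longrightarrow> u r = app l Q (\<lambda>s. B s j) r"
    and Q': "\<And>r s. r < l \<Longrightarrow> s < l \<Longrightarrow> Q' r s = Q r s - u r * u s / inner_prod l u u"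
    and c': "\<And>r. r < l \<Longrightarrow> c' r = c r + (a j - inner_prod l c (\<lambda>s. B s j)) / inner_prod l u u * u r"
  shows "solves l (Suc j) B a Q' c'"
proof -
  let ?b = "\<lambda>s. B s j" and ?uu = "inner_prod l u u"
  define \<kappa> where "\<kappa> = (a j - inner_prod l c ?b) / ?uu"
  note kill = projects_column[OF P] and span = projects_span[OF P]
  have Qu: "\<And>r. r < l \<Longrightarrow> app l Q u r = u r"
    and inner_u: "\<And>x. inner_prod l u x = inner_prod l (app l Q x) ?b"
    and ub: "inner_prod l u ?b = ?uu"
    using projected_column[OF P u] by blast+
  from S have Qc: "\<And>r. r < l \<Longrightarrow> app l Q c r = 0" by (simp add: solves_def)
  have app': "app l Q' x r = app l Q x r - u r * (inner_prod l u x / ?uu)" if "r < l" for x r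
    using that Q' by (intro app_rank_one_update) auto
  have uc: "inner_prod l u c = 0" unfolding inner_u using Qc by (simp add: inner_prod_def)
  have u0: "u r = 0" if "?uu = 0" "r < l" for r using that by (simp add: inner_prod_self_eq_0)
  have inner_c': "inner_prod l x c' = inner_prod l x c + \<kappa> * inner_prod l x u" for x
  proof -
    have "inner_prod l x c' = inner_prod l x (\<lambda>r. c r + \<kappa> * u r)"
      by (rule inner_prod_cong) (auto simp: c' \<kappa>_def)
    then show ?thesis by (simp add: inner_prod_add_right inner_prod_scale_right)
  qed
  have inner_c'_left: "inner_prod l c' x = inner_prod l c x + \<kappa> * inner_prod l u x" for x
    using inner_c'[of x] by (simp only: inner_prod_commute[of l x])
  have "app l Q' c' r = 0" if r: "r < l" for r
  proof -
    have "app l Q c' r = app l Q (\<lambda>r. c r + \<kappa> * u r) r"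
      by (rule app_cong) (auto simp: c' \<kappa>_def)
    also have "\<dots> = \<kappa> * u r" using r by (simp add: app_add app_scale Qc Qu)
    finally show ?thesis using r u0
      by (cases "?uu = 0") (auto simp: app' inner_c' uc)
  qed
  moreover have "c' \<in> feasible l (Suc j) B a" if ne: "feasible l (Suc j) B a \<noteq> {}"
  proof -
    obtain \<beta> where \<beta>: "\<beta> \<in> feasible l (Suc j) B a" using ne by blast
    then have "\<beta> \<in> feasible l j B a" by (auto simp: feasible_def)
    then have "c \<in> feasible l j B a" using S unfolding solves_def by blast
    then have c: "\<And>k. k < j \<Longrightarrow> inner_prod l c (\<lambda>s. B s k) = a k"
      by (simp add: feasible_iff)
    have "inner_prod l c' (\<lambda>s. B s k) = a k" if k: "k < Suc j" for k
    proof (cases "k = j")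
      case True
      show ?thesis
      proof (cases "?uu = 0")
        case False
        then show ?thesis unfolding True inner_c'_left ub by (simp add: \<kappa>_def)
      next
        case uu: True
        \<comment> \<open>the new column depends on the earlier ones, and consistency forces the equation\<close>
        obtain \<gamma> where \<gamma>: "\<forall>r<l. ?b r - app l Q ?b r = (\<Sum>k<j. \<gamma> k * B r k)"
          using span[of ?b] by blast
        have b: "?b r = (\<Sum>k<j. \<gamma> k * B r k)" if r: "r < l" for r
        proof -
          have "?b r - u r = (\<Sum>k<j. \<gamma> k * B r k)" using \<gamma> r u[OF r] by simp
          then show ?thesis using u0[OF uu r] by simp
        qed
        have inner_b: "inner_prod l z ?b = (\<Sum>k<j. \<gamma> k * inner_prod l z (\<lambda>s. B s k))" for z
          unfolding inner_prod_sum_right[symmetric] by (rule inner_prod_cong) (auto simp: b)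
        have \<beta>_eq: "inner_prod l \<beta> (\<lambda>s. B s k) = a k" if "k < Suc j" for k
          using \<beta> that unfolding feasible_iff by blast
        have "a j = inner_prod l \<beta> ?b" using \<beta>_eq[of j] by simp
        also have "\<dots> = (\<Sum>k<j. \<gamma> k * a k)"
          unfolding inner_b by (intro sum.cong) (auto simp: \<beta>_eq)
        also have "\<dots> = inner_prod l c ?b" using c inner_b[of c] by simp
        finally show ?thesis unfolding True inner_c'_left by (simp add: \<kappa>_def)
      qed
    next
      case False
      then have k: "k < j" using that by simp
      have "inner_prod l u (\<lambda>s. B s k) = 0" unfolding inner_u
        using kill[OF k] by (simp add: inner_prod_def)
      then show ?thesis using c[OF k] by (simp add: inner_c'_left)
    qed
    then show ?thesis by (simp add: feasible_iff)
  qed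
  ultimately show ?thesis unfolding solves_def by blast
qed

section \<open>Attainment of the maximum\<close>

text \<open>The range of \<open>B\<close> is the kernel of the projection \<open>Q\<close>, hence closed, and \<open>w \<mapsto> \<beta> \<cdot> w\<close> attains its
maximum \<open>M\<close> on the unit ball of the range. The Hahn-Banach theorem yields a feasible vector of norm
at most \<open>M\<close>, so \<open>M\<close> is not smaller than the norm of the optimal \<open>\<beta>\<close>.\<close>

lemma primal_attained:
  assumes c: "conjugate p q" and \<beta>: "\<beta> \<in> feasible l n B a"
    and opt: "\<And>\<gamma>. \<gamma> \<in> feasible l n B a \<Longrightarrow> pn q l \<beta> \<le> pn q l \<gamma>"
  shows "\<exists>v. pn p l (\<lambda>i. \<Sum>k<n. B i k * v k) \<le> 1 \<and> (\<Sum>k<n. a k * v k) = pn q l \<beta>"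
proof -
  note ge1 = conjugate_ge_1[OF c]
  obtain Q where Q: "projects l n B Q" using projects_exists by blast
  let ?Bv = "\<lambda>v i. \<Sum>k<n. B i k * v k"
  let ?box = "{x :: nat \<Rightarrow> real. (\<forall>i<l. \<bar>x i\<bar> \<le> 1) \<and> (\<forall>i\<ge>l. x i = 0)}"
  define K where "K = ?box \<inter> ({x. pn p l x \<le> 1} \<inter> (\<Inter>r\<in>{..<l}. {x. app l Q x r = 0}))"
  have "compact K" unfolding K_def app_def
    by (intro compact_Int_closed compact_box closed_Int closed_INT ballI closed_Collect_eq
        closed_Collect_le continuous_intros continuous_on_pn ge1)
  moreover have "K \<noteq> {}"
  proof -
    have "(\<lambda>_. 0) \<in> K" using pn_zero[OF ge1(1), of l "\<lambda>_. 0"] by (simp add: K_def app_def)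
    then show ?thesis by blast
  qed
  moreover have "continuous_on K (\<lambda>w. \<Sum>i<l. \<beta> i * w i)" by (intro continuous_intros)
  ultimately obtain w where w: "w \<in> K"
    and max: "\<And>x. x \<in> K \<Longrightarrow> (\<Sum>i<l. \<beta> i * x i) \<le> (\<Sum>i<l. \<beta> i * w i)"
    by (meson continuous_attains_sup)
  define M where "M = (\<Sum>i<l. \<beta> i * w i)"
  from Q obtain v where "\<forall>r<l. w r - app l Q w r = (\<Sum>k<n. v k * B r k)"
    unfolding projects_def by blast
  then have v: "w r = ?Bv v r" if "r < l" for r
    using that w by (simp add: K_def mult.commute)
  have av: "(\<Sum>k<n. a k * v k) = M"
    using feasible_inner[OF \<beta>, of v] v by (simp add: M_def)
  have M0: "0 \<le> M" using max[of "\<lambda>_. 0"] pn_zero[OF ge1(1), of l "\<lambda>_. 0"]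
    by (simp add: K_def app_def M_def)
  have "(\<Sum>k<n. a k * y k) \<le> M * pn p l (?Bv y)" for y
  proof (cases "pn p l (?Bv y) = 0")
    case True
    then have "\<And>i. i < l \<Longrightarrow> ?Bv y i = 0" using pn_eq_0[OF ge1(1)] by blast
    then show ?thesis using feasible_inner[OF \<beta>, of y] True by simp
  next
    case False
    define t where "t = pn p l (?Bv y)"
    have t: "0 < t" using False pn_nonneg[of p l "?Bv y"] unfolding t_def by linarith
    let ?x = "\<lambda>i. if i < l then (1 / t) * ?Bv y i else 0"
    have "pn p l ?x = pn p l (\<lambda>i. (1 / t) * ?Bv y i)" by (rule pn_cong) simp
    also have "\<dots> = 1" unfolding pn_scale[OF ge1(1)] t_def[symmetric] using t by simp
    finally have 1: "pn p l ?x = 1" .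
    have "app l Q ?x r = 0" if r: "r < l" for r
    proof -
      have "app l Q ?x r = (1 / t) * app l Q (?Bv y) r"
        unfolding app_scale[symmetric] by (rule app_cong) auto
      also have "app l Q (?Bv y) r = (\<Sum>k<n. y k * app l Q (\<lambda>s. B s k) r)"
        unfolding app_def sum_distrib_left by (subst sum.swap) (simp add: mult_ac)
      finally show ?thesis using Q r by (simp add: projects_def)
    qed
    then have "?x \<in> K" using 1 abs_le_pn[OF ge1(1), of _ l ?x] by (simp add: K_def)
    from max[OF this] have "(\<Sum>i<l. \<beta> i * ((1 / t) * ?Bv y i)) \<le> M"
      by (simp add: M_def)
    also have "(\<Sum>i<l. \<beta> i * ((1 / t) * ?Bv y i)) = (\<Sum>i<l. \<beta> i * ?Bv y i) / t"
      unfolding sum_divide_distrib by (intro sum.cong) auto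
    finally have "(\<Sum>i<l. \<beta> i * ?Bv y i) / t \<le> M" .
    then show ?thesis using t feasible_inner[OF \<beta>, of y] by (simp add: t_def divide_le_eq)
  qed
  from bounded_functional_representable[OF c M0 this]
  obtain \<gamma> where "\<gamma> \<in> feasible l n B a" "pn q l \<gamma> \<le> M" by blast
  with opt have "pn q l \<beta> \<le> M" by force
  moreover have pw: "pn p l (?Bv v) \<le> 1"
    using w v pn_cong[of l w "?Bv v" p] by (auto simp: K_def)
  moreover have "M \<le> pn q l \<beta>"
    unfolding M_def using w pn_le_iff[OF c] by (auto simp: K_def)
  ultimately show ?thesis using av by auto
qed

section \<open>Cutting a simplex\<close>

definition coords_mat :: "nat \<Rightarrow> (nat \<Rightarrow> nat \<Rightarrow> real) \<Rightarrow> real mat" where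
  "coords_mat N L = mat N N (\<lambda>(j, i). L j i)"

text \<open>If the rows of \<open>L\<close> are barycentric coordinates of \<open>N\<close> points, this is the volume of the simplex
spanned by these points divided by the volume of the simplex that the coordinates refer to.\<close>

definition volume_ratio :: "nat \<Rightarrow> (nat \<Rightarrow> nat \<Rightarrow> real) \<Rightarrow> real" where
  "volume_ratio N L = \<bar>Determinant.det (coords_mat N L)\<bar>"

text \<open>The row \<open>L j\<close> contains the barycentric coordinates of the point \<open>Z j\<close> with respect to the simplex
with the vertices \<open>V i\<close>.\<close>

definition barycentric :: "nat \<Rightarrow> nat \<Rightarrow> (nat \<Rightarrow> nat \<Rightarrow> real) \<Rightarrow> (nat \<Rightarrow> nat \<Rightarrow> real) \<Rightarrow>
    (nat \<Rightarrow> nat \<Rightarrow> real) \<Rightarrow> bool" where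
  "barycentric N l V Z L \<longleftrightarrow> (\<forall>j<N. (\<forall>i<N. 0 \<le> L j i) \<and> (\<Sum>i<N. L j i) = 1 \<and>
     (\<forall>r<l. Z j r = (\<Sum>i<N. L j i * V i r)))"

text \<open>All entries are in \<open>[0, 1]\<close>, so the Leibniz formula has \<open>N!\<close> terms of modulus at most \<open>1\<close>.\<close>

lemma volume_ratio_le:
  assumes "barycentric N l V Z L"
  shows "volume_ratio N L \<le> real N ^ N"
proof -
  have car: "coords_mat N L \<in> carrier_mat N N" by (simp add: coords_mat_def)
  have entry: "0 \<le> L j i \<and> L j i \<le> 1" if "j < N" "i < N" for i j
  proof -
    have "L j i \<le> (\<Sum>i<N. L j i)"
      using assms that by (intro member_le_sum) (auto simp: barycentric_def)
    then show ?thesis using assms that by (auto simp: barycentric_def)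
  qed
  have "volume_ratio N L \<le>
      (\<Sum>p | p permutes {0..<N}. \<bar>signof p * (\<Prod>i = 0..<N. coords_mat N L $$ (i, p i))\<bar>)"
    unfolding volume_ratio_def det_def'[OF car] by (rule sum_abs)
  also have "\<dots> \<le> (\<Sum>p | p permutes {0..<N}. 1)"
  proof (rule sum_mono)
    fix p assume "p \<in> {p. p permutes {0..<N}}"
    then have p: "p i < N" if "i < N" for i using that permutes_in_image[of p "{0..<N}" i] by simp
    have "\<bar>\<Prod>i = 0..<N. coords_mat N L $$ (i, p i)\<bar> = (\<Prod>i = 0..<N. L i (p i))"
      unfolding abs_prod using p entry by (intro prod.cong) (auto simp: coords_mat_def)
    also have "\<dots> \<le> 1" using p entry by (intro prod_le_1) auto
    finally show "\<bar>signof p * (\<Prod>i = 0..<N. coords_mat N L $$ (i, p i))\<bar> \<le> (1 :: real)"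
      by (simp add: abs_mult sign_def)
  qed
  also have "\<dots> = fact N" using card_permutations[of "{0..<N}" N] by simp
  also have "\<dots> \<le> real N ^ N" using fact_le_power[of N, where 'a = real] by simp
  finally show ?thesis .
qed

text \<open>Only the identity contributes to the Leibniz formula: a permutation with a nonzero term maps
  every row to itself or to \<open>k0\<close>, and it fixes \<open>k0\<close>.\<close>

lemma det_one_column:
  fixes E :: "nat \<Rightarrow> nat \<Rightarrow> real"
  assumes k0: "k0 < N" and E: "\<And>i k. i < N \<Longrightarrow> k < N \<Longrightarrow> i \<noteq> k \<Longrightarrow> k \<noteq> k0 \<Longrightarrow> E i k = 0"
  shows "Determinant.det (coords_mat N E) = (\<Prod>i<N. E i i)"
proof -
  have car: "coords_mat N E \<in> carrier_mat N N" by (simp add: coords_mat_def)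
  let ?t = "\<lambda>p. signof p * (\<Prod>i = 0..<N. coords_mat N E $$ (i, p i))"
  have "?t p = 0" if p: "p permutes {0..<N}" "p \<noteq> id" for p
  proof -
    have lt: "p i < N" if "i < N" for i using that permutes_in_image[OF p(1), of i] by simp
    have "\<exists>i<N. p i \<noteq> i \<and> p i \<noteq> k0"
    proof (rule ccontr)
      assume "\<not> ?thesis"
      then have *: "p i = i \<or> p i = k0" if "i < N" for i using that by blast
      have "p k0 = k0" using *[OF k0] by blast
      then have "p i = i" if "i < N" for i
        using *[OF that] permutes_inj[OF p(1)] by (metis injD)
      then have "p = id" using p(1) by (auto simp: fun_eq_iff permutes_def)
      then show False using p(2) by blast
    qed
    then obtain i where i: "i < N" "p i \<noteq> i" "p i \<noteq> k0" by blast
    then have "coords_mat N E $$ (i, p i) = 0" using lt E[of i "p i"] by (simp add: coords_mat_def)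
    then have "(\<Prod>i = 0..<N. coords_mat N E $$ (i, p i)) = 0" using i by (intro prod_zero) auto
    then show ?thesis by simp
  qed
  then have "(\<Sum>p | p permutes {0..<N}. ?t p) = (\<Sum>p\<in>{id}. ?t p)"
    by (intro sum.mono_neutral_right) (auto simp: permutes_id finite_permutations)
  then show ?thesis unfolding det_def'[OF car]
    by (simp add: coords_mat_def lessThan_atLeast0 sign_id)
qed

lemma ln_one_plus_ge: "x - 2 * x\<^sup>2 \<le> ln (1 + x)" if "- 1/2 \<le> x" for x :: real
proof (cases "0 \<le> x")
  case True
  show ?thesis
  proof (cases "x \<le> 1")
    case le1: True
    have "x - x\<^sup>2 \<le> ln (1 + x)" using True le1 by (rule ln_one_plus_pos_lower_bound)
    then show ?thesis using zero_le_power2[of x] by linarith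
  next
    case False
    then have "x * 1 \<le> x * x" by (intro mult_left_mono) auto
    then have "x - 2 * x\<^sup>2 \<le> 0" using False unfolding power2_eq_square by linarith
    also have "0 \<le> ln (1 + x)" using True by simp
    finally show ?thesis .
  qed
next
  case False
  then show ?thesis using ln_one_minus_pos_lower_bound[of "- x"] that by simp
qed

text \<open>The factor by which one cut increases the determinant. To first order in \<open>\<theta>\<close> it is
  \<open>1 + \<theta> (\<Sum>k\<noteq>k0. t k) = 1 + \<theta>\<close>, and the second order term is at most \<open>2 \<theta>\<^sup>2 N\<^sup>2\<close>; the chosen \<open>\<theta>\<close>
  maximizes the difference.\<close>

lemma prod_growth:
  fixes t :: "nat \<Rightarrow> real"
  assumes N: "0 < N" and k0: "k0 < N" and sum0: "(\<Sum>k<N. t k) = 0"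
    and t0: "t k0 = - 1" and ge: "\<And>k. k < N \<Longrightarrow> - 1 \<le> t k"
  defines "\<theta> \<equiv> 1 / (4 * (real N)\<^sup>2)"
  shows "1 + 1 / (8 * (real N)\<^sup>2) \<le> (\<Prod>k\<in>{..<N} - {k0}. 1 + \<theta> * t k)"
proof -
  let ?K = "{..<N} - {k0}"
  have N1: "1 \<le> (real N)\<^sup>2" using N by (simp add: one_le_power)
  then have \<theta>: "0 < \<theta>" "\<theta> \<le> 1/4"
    using N frac_le[of 1 1 4 "4 * (real N)\<^sup>2"] by (simp_all add: \<theta>_def)
  have half: "- 1/2 \<le> \<theta> * t k" if "k < N" for k
  proof -
    have "- (\<theta> * 1) \<le> \<theta> * t k"
      using mult_left_mono[OF ge[OF that], of \<theta>] \<theta> by simp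
    then show ?thesis using \<theta> by simp
  qed
  have nn: "0 \<le> t k + 1" if "k < N" for k using ge[OF that] by simp
  have sumK: "(\<Sum>k\<in>?K. t k) = 1" using sum0 k0 t0 by (simp add: sum_diff1)
  have "(\<Sum>k\<in>?K. (t k)\<^sup>2) = (\<Sum>k\<in>?K. (t k + 1)\<^sup>2 - 2 * t k - 1)"
    by (intro sum.cong) (auto simp: power2_eq_square algebra_simps)
  also have "\<dots> = (\<Sum>k\<in>?K. (t k + 1)\<^sup>2) - 2 - real (card ?K)"
    by (simp add: sum_subtractf sumK flip: sum_distrib_left)
  also have "\<dots> \<le> (\<Sum>k\<in>?K. (t k + 1)\<^sup>2)" by simp
  also have "\<dots> \<le> (\<Sum>k<N. (t k + 1)\<^sup>2)" by (intro sum_mono2) auto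
  also have "\<dots> \<le> (\<Sum>k<N. (t k + 1) * (\<Sum>i<N. t i + 1))"
  proof (rule sum_mono)
    fix k assume "k \<in> {..<N}"
    then show "(t k + 1)\<^sup>2 \<le> (t k + 1) * (\<Sum>i<N. t i + 1)"
      unfolding power2_eq_square using nn
      by (intro mult_left_mono member_le_sum[where f = "\<lambda>i. t i + 1"]) auto
  qed
  also have "\<dots> = (real N)\<^sup>2"
    unfolding sum_distrib_right[symmetric] by (simp add: sum.distrib sum0 power2_eq_square)
  finally have sq: "(\<Sum>k\<in>?K. (t k)\<^sup>2) \<le> (real N)\<^sup>2" .
  have "1 / (8 * (real N)\<^sup>2) = \<theta> - 2 * \<theta>\<^sup>2 * (real N)\<^sup>2"
    using N by (simp add: \<theta>_def power2_eq_square field_simps)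
  also have "\<dots> \<le> \<theta> - 2 * \<theta>\<^sup>2 * (\<Sum>k\<in>?K. (t k)\<^sup>2)"
    using sq by (simp add: mult_left_mono)
  also have "\<dots> = (\<Sum>k\<in>?K. \<theta> * t k - 2 * (\<theta> * t k)\<^sup>2)"
    by (simp add: sum_subtractf power_mult_distrib sumK mult.assoc flip: sum_distrib_left)
  also have "\<dots> \<le> (\<Sum>k\<in>?K. ln (1 + \<theta> * t k))"
    using half by (intro sum_mono ln_one_plus_ge) auto
  also have "\<dots> = ln (\<Prod>k\<in>?K. 1 + \<theta> * t k)"
  proof (rule ln_prod[symmetric])
    fix k assume "k \<in> ?K"
    then show "1 + \<theta> * t k \<noteq> 0" using half[of k] by auto
  qed simp
  finally have le: "1 / (8 * (real N)\<^sup>2) \<le> ln (\<Prod>k\<in>?K. 1 + \<theta> * t k)" .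
  have pos: "0 < (\<Prod>k\<in>?K. 1 + \<theta> * t k)"
  proof (rule prod_pos)
    fix k assume "k \<in> ?K"
    then show "0 < 1 + \<theta> * t k" using half[of k] by simp
  qed
  then show ?thesis using le ln_le_minus_one[OF pos] by linarith
qed

text \<open>The half-space \<open>w \<cdot> (x - v) \<le> 0\<close> through the centroid \<open>v\<close> is given, in barycentric coordinates \<open>\<lambda>\<close>, by
\<open>(\<Sum>k. \<lambda> k * h k) \<le> 0\<close>. Let \<open>k0\<close> be the vertex that lies deepest in it and \<open>t k = h k / - h k0\<close>. The edge
from \<open>k0\<close> to \<open>k\<close> is divided by \<open>1 + \<theta> t k\<close>, so edges that leave the half-space become shorter and the
others become longer. In the new coordinates \<open>\<lambda> k\<close> is multiplied by \<open>1 + \<theta> t k\<close> for \<open>k \<noteq> k0\<close>, and the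
coordinate at \<open>k0\<close>, being the complement to \<open>1\<close>, remains nonnegative precisely because of the
inequality of the half-space. The change of coordinates is linear with the determinant
\<open>\<Prod>k\<noteq>k0. 1 + \<theta> t k\<close>.\<close>

lemma simplex_step:
  fixes V Z L :: "nat \<Rightarrow> nat \<Rightarrow> real"
  assumes bary: "barycentric N l V Z L" and N: "0 < N"
    and v: "\<And>r. r < l \<Longrightarrow> v r = (\<Sum>k<N. V k r) / real N"
    and h: "\<And>k. k < N \<Longrightarrow> h k = inner_prod l w (\<lambda>r. V k r - v r)"
    and cut: "\<And>j. j < N \<Longrightarrow> inner_prod l w (\<lambda>r. Z j r - v r) < 0"
    and k0: "k0 < N" "\<And>k. k < N \<Longrightarrow> h k0 \<le> h k"
    and V': "\<And>k r. k < N \<Longrightarrow> r < l \<Longrightarrow>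
      V' k r = V k0 r + (V k r - V k0 r) / (1 + 1 / (4 * (real N)\<^sup>2) * (h k / - h k0))"
  shows "\<exists>L'. barycentric N l V' Z L' \<and>
    (1 + 1 / (8 * (real N)\<^sup>2)) * volume_ratio N L \<le> volume_ratio N L'"
proof -
  define \<theta> where "\<theta> = 1 / (4 * (real N)\<^sup>2)"
  define t where "t k = h k / - h k0" for k
  define a where "a k = 1 + \<theta> * t k" for k
  define S where "S j = (\<Sum>k<N. L j k * t k)" for j
  from bary have L0: "\<And>j i. j < N \<Longrightarrow> i < N \<Longrightarrow> 0 \<le> L j i"
    and L1: "\<And>j. j < N \<Longrightarrow> (\<Sum>i<N. L j i) = 1"
    and LZ: "\<And>j r. j < N \<Longrightarrow> r < l \<Longrightarrow> Z j r = (\<Sum>i<N. L j i * V i r)"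
    by (auto simp: barycentric_def)
  have hsum: "(\<Sum>k<N. h k) = 0"
  proof -
    have "(\<Sum>k<N. h k) = (\<Sum>k<N. \<Sum>r<l. w r * (V k r - v r))"
      using h by (simp add: inner_prod_def)
    also have "\<dots> = (\<Sum>r<l. w r * ((\<Sum>k<N. V k r) - real N * v r))"
      by (subst sum.swap) (simp add: sum_subtractf flip: sum_distrib_left)
    also have "\<dots> = 0" using v N by simp
    finally show ?thesis .
  qed
  have Lh: "(\<Sum>k<N. L j k * h k) = inner_prod l w (\<lambda>r. Z j r - v r)" if j: "j < N" for j
  proof -
    have "(\<Sum>k<N. L j k * h k) = (\<Sum>k<N. \<Sum>r<l. w r * (L j k * V k r - L j k * v r))"
      using h by (simp add: inner_prod_def sum_distrib_left algebra_simps)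
    also have "\<dots> = (\<Sum>r<l. w r * ((\<Sum>k<N. L j k * V k r) - (\<Sum>k<N. L j k) * v r))"
      by (subst sum.swap) (simp add: sum_subtractf sum_distrib_right flip: sum_distrib_left)
    finally show ?thesis using LZ[OF j] L1[OF j] by (simp add: inner_prod_def)
  qed
  \<comment> \<open>a test point lies strictly on the kept side, so some vertex does\<close>
  have neg: "h k0 < 0"
  proof (rule ccontr)
    assume "\<not> h k0 < 0"
    then have "0 \<le> L 0 k * h k" if "k < N" for k
      using k0(2)[OF that] L0[OF N that] by (intro mult_nonneg_nonneg) auto
    then have "0 \<le> (\<Sum>k<N. L 0 k * h k)" by (intro sum_nonneg) auto
    then show False using cut[OF N] Lh[OF N] by simp
  qed
  have t_ge: "- 1 \<le> t k" if "k < N" for k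
    using k0(2)[OF that] neg by (simp add: t_def field_simps)
  have tk0: "t k0 = - 1" using neg by (simp add: t_def)
  have tsum: "(\<Sum>k<N. t k) = 0"
  proof -
    have "(\<Sum>k<N. t k) = (\<Sum>k<N. h k) / - h k0" unfolding t_def by (rule sum_divide_distrib[symmetric])
    then show ?thesis by (simp add: hsum)
  qed
  have S_neg: "S j < 0" if "j < N" for j
  proof -
    have "S j = (\<Sum>k<N. L j k * h k) / - h k0"
      unfolding S_def t_def sum_divide_distrib by (intro sum.cong) auto
    also have "\<dots> < 0" unfolding Lh[OF that] using cut[OF that] neg by (intro divide_neg_pos) auto
    finally show ?thesis .
  qed
  have N1: "1 \<le> (real N)\<^sup>2" using N by (simp add: one_le_power)
  then have \<theta>: "0 < \<theta>" "\<theta> \<le> 1/4"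
    using N frac_le[of 1 1 4 "4 * (real N)\<^sup>2"] by (simp_all add: \<theta>_def)
  have a_pos: "0 < a k" if "k < N" for k
  proof -
    have "- \<theta> \<le> \<theta> * t k" using mult_left_mono[OF t_ge[OF that], of \<theta>] \<theta> by simp
    then show ?thesis using \<theta> by (simp add: a_def)
  qed
  define L' where "L' j k = L j k * a k - (if k = k0 then \<theta> * S j else 0)" for j k
  have L'0: "0 \<le> L' j k" if "j < N" "k < N" for j k
    using that L0 a_pos[of k] \<theta> S_neg[of j]
    by (auto simp: L'_def intro!: mult_nonneg_nonneg add_nonneg_nonneg mult_pos_neg[THEN less_imp_le]
        simp: diff_ge_0_iff_ge intro: order.trans[OF mult_pos_neg[THEN less_imp_le]])
  have L'1: "(\<Sum>k<N. L' j k) = 1" if "j < N" for j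
    using L1[OF that] k0(1)
    by (simp add: L'_def a_def S_def sum_subtractf distrib_left sum.distrib sum_distrib_left mult_ac)
  have L'Z: "Z j r = (\<Sum>k<N. L' j k * V' k r)" if j: "j < N" and r: "r < l" for j r
  proof -
    have "(\<Sum>k<N. L' j k * V' k r) = (\<Sum>k<N. L' j k * V k0 r + L j k * (V k r - V k0 r))"
    proof (intro sum.cong refl)
      fix k assume k: "k \<in> {..<N}"
      have V'k: "V' k r = V k0 r + (V k r - V k0 r) / a k"
        using V'[of k r] k r by (simp add: a_def t_def \<theta>_def)
      show "L' j k * V' k r = L' j k * V k0 r + L j k * (V k r - V k0 r)"
      proof (cases "k = k0")
        case True
        then show ?thesis using V'k by simp
      next
        case False
        then have "L' j k = L j k * a k" by (simp add: L'_def)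
        then show ?thesis using a_pos[of k] k unfolding V'k by (simp add: distrib_left)
      qed
    qed
    also have "\<dots> = (\<Sum>k<N. L' j k) * V k0 r + (\<Sum>k<N. L j k * V k r) - (\<Sum>k<N. L j k) * V k0 r"
      by (simp add: sum.distrib right_diff_distrib sum_subtractf sum_distrib_right)
    also have "\<dots> = Z j r" using L'1[OF j] L1[OF j] LZ[OF j r] by simp
    finally show ?thesis by simp
  qed
  define E where "E i k = (if i = k then a k else 0) - (if k = k0 then \<theta> * t i else 0)" for i k
  have mult: "coords_mat N L' = coords_mat N L * coords_mat N E"
  proof (rule eq_matI)
    fix j k assume "j < dim_row (coords_mat N L * coords_mat N E)"
      "k < dim_col (coords_mat N L * coords_mat N E)"
    then have jk: "j < N" "k < N" by (auto simp: coords_mat_def)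
    have "(\<Sum>i<N. L j i * E i k) = (\<Sum>i<N. (if i = k then L j k * a k else 0) -
        (if k = k0 then \<theta> * (L j i * t i) else 0))"
      by (intro sum.cong) (auto simp: E_def algebra_simps)
    also have "\<dots> = L' j k"
      using jk by (simp add: sum_subtractf L'_def S_def sum_distrib_left)
    finally show "coords_mat N L' $$ (j, k) = (coords_mat N L * coords_mat N E) $$ (j, k)"
      using jk by (simp add: coords_mat_def scalar_prod_def lessThan_atLeast0)
  qed (auto simp: coords_mat_def)
  have "Determinant.det (coords_mat N E) = (\<Prod>i<N. E i i)"
    by (rule det_one_column[OF k0(1)]) (auto simp: E_def)
  also have "\<dots> = E k0 k0 * (\<Prod>i\<in>{..<N} - {k0}. E i i)"
    using k0(1) by (intro prod.remove) auto
  also have "E k0 k0 = 1" by (simp add: E_def a_def)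
  also have "(\<Prod>i\<in>{..<N} - {k0}. E i i) = (\<Prod>i\<in>{..<N} - {k0}. 1 + \<theta> * t i)"
    by (intro prod.cong) (auto simp: E_def a_def)
  finally have "1 + 1 / (8 * (real N)\<^sup>2) \<le> Determinant.det (coords_mat N E)"
    using prod_growth[of N k0 t, OF N k0(1) tsum tk0 t_ge] by (simp add: \<theta>_def)
  then have "(1 + 1 / (8 * (real N)\<^sup>2)) * volume_ratio N L \<le> volume_ratio N E * volume_ratio N L"
    by (intro mult_right_mono) (auto simp: volume_ratio_def)
  also have "\<dots> = volume_ratio N L'"
    unfolding volume_ratio_def mult by (subst det_mult[of _ N]) (auto simp: coords_mat_def abs_mult)
  finally have "(1 + 1 / (8 * (real N)\<^sup>2)) * volume_ratio N L
    \<le> volume_ratio N L'" .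
  moreover have "barycentric N l V' Z L'" using L'0 L'1 L'Z by (auto simp: barycentric_def)
  ultimately show ?thesis by blast
qed

text \<open>The simplex at the corner \<open>(- R, \<dots>, - R)\<close> of the cube \<open>[- R, R]\<^sup>l\<close> whose edges at this corner have
the length \<open>4 l R\<close> and the coordinate directions.\<close>

definition initial_simplex :: "nat \<Rightarrow> real \<Rightarrow> nat \<Rightarrow> nat \<Rightarrow> real" where
  "initial_simplex l R k r = (if k = Suc r then 4 * real l * R - R else - R)"

text \<open>The point \<open>z\<close> and the vertices moved almost all the way to \<open>z\<close>. By convexity a function is almost as
small at these points as it is at \<open>z\<close>.\<close>

definition test_points :: "real \<Rightarrow> (nat \<Rightarrow> nat \<Rightarrow> real) \<Rightarrow> (nat \<Rightarrow> real) \<Rightarrow> nat \<Rightarrow> nat \<Rightarrow> real" where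
  "test_points \<eta> V z j r = (if j = 0 then z r else (1 - \<eta>) * z r + \<eta> * V j r)"

text \<open>The simplex has twice the size that is needed to contain the cube, so the coordinate of \<open>z\<close> at the
vertex \<open>0\<close> is at least \<open>1/2\<close>. The matrix of coordinates is the product of a lower triangular matrix
with the diagonal \<open>1, \<eta>, \<dots>, \<eta>\<close> and an upper triangular one whose diagonal consists of this
coordinate and ones.\<close>

lemma initial_barycentric:
  assumes R: "0 < R" and z: "\<And>r. r < l \<Longrightarrow> \<bar>z r\<bar> \<le> R" and \<eta>: "0 \<le> \<eta>" "\<eta> \<le> 1"
  defines "V \<equiv> initial_simplex l R"
  shows "\<exists>L. barycentric (Suc l) l V (test_points \<eta> V z) L \<and>
    \<eta> ^ l / 2 \<le> volume_ratio (Suc l) L"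
proof -
  define m where "m r = (z r + R) / (4 * real l * R)" for r
  define lam where "lam k = (if k = 0 then 1 - (\<Sum>r<l. m r) else m (k - 1))" for k
  have m: "0 \<le> m r" "m r \<le> 1 / (2 * real l)" if "r < l" for r
    using z[OF that] R that by (auto simp: m_def abs_le_iff field_simps)
  have "(\<Sum>r<l. m r) \<le> (\<Sum>r<l. 1 / (2 * real l))" using m by (intro sum_mono) auto
  then have half: "1/2 \<le> lam 0" by (cases "l = 0") (auto simp: lam_def)
  have shift: "(\<Sum>k<Suc l. f k) = f 0 + (\<Sum>r<l. f (Suc r))" for f :: "nat \<Rightarrow> real"
    by (rule sum.lessThan_Suc_shift)
  have lam0: "0 \<le> lam k" if "k < Suc l" for k
    using that half m(1)[of "k - 1"] by (cases k) (auto simp: lam_def)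
  have lam1: "(\<Sum>k<Suc l. lam k) = 1" by (simp add: shift lam_def del: sum.lessThan_Suc)
  have lamz: "z r = (\<Sum>k<Suc l. lam k * V k r)" if r: "r < l" for r
  proof -
    have "(\<Sum>k<Suc l. lam k * V k r) =
        (\<Sum>k<Suc l. lam k * - R + (if k = Suc r then lam k * (4 * real l * R) else 0))"
      by (intro sum.cong) (auto simp: V_def initial_simplex_def algebra_simps)
    also have "\<dots> = (\<Sum>k<Suc l. lam k) * - R + lam (Suc r) * (4 * real l * R)"
      using r by (simp add: sum.distrib sum_subtractf sum_distrib_right del: sum.lessThan_Suc)
    also have "\<dots> = z r" using r R unfolding lam1 by (simp add: lam_def m_def)
    finally show ?thesis by simp
  qed
  define L where "L j i = (if j = 0 then lam i else (1 - \<eta>) * lam i + (if i = j then \<eta> else 0))" for j i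
  have "barycentric (Suc l) l V (test_points \<eta> V z) L"
    unfolding barycentric_def
  proof (intro allI impI conjI)
    fix j i assume "j < Suc l" "i < Suc l"
    then show "0 \<le> L j i" using lam0 \<eta> by (auto simp: L_def)
  next
    fix j assume "j < Suc l"
    then show "(\<Sum>i<Suc l. L j i) = 1"
      using lam1 by (cases "j = 0") (auto simp: L_def sum.distrib simp flip: sum_distrib_left
          simp del: sum.lessThan_Suc)
  next
    fix j r assume j: "j < Suc l" and r: "r < l"
    have "(\<Sum>i<Suc l. L j i * V i r) = (1 - \<eta>) * (\<Sum>i<Suc l. lam i * V i r) + \<eta> * V j r"
      if "j \<noteq> 0"
    proof -
      have "(\<Sum>i<Suc l. L j i * V i r) =
          (\<Sum>i<Suc l. (1 - \<eta>) * (lam i * V i r) + (if i = j then \<eta> * V j r else 0))"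
        using that by (intro sum.cong) (auto simp: L_def algebra_simps)
      then show ?thesis using j by (simp add: sum.distrib sum_distrib_left del: sum.lessThan_Suc)
    qed
    then show "test_points \<eta> V z j r = (\<Sum>i<Suc l. L j i * V i r)"
      using lamz[OF r] by (auto simp: test_points_def L_def simp del: sum.lessThan_Suc)
  qed
  moreover have "\<eta> ^ l / 2 \<le> volume_ratio (Suc l) L"
  proof -
    define T :: "nat \<Rightarrow> nat \<Rightarrow> real" where
      "T j k = (if j = 0 then (if k = 0 then 1 else 0)
         else if k = 0 then 1 - \<eta> else if k = j then \<eta> else 0)" for j k
    define M where "M k i = (if k = 0 then lam i else if i = k then 1 else 0)" for k i
    have "coords_mat (Suc l) L = coords_mat (Suc l) T * coords_mat (Suc l) M"
    proof (rule eq_matI)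
      fix j i assume "j < dim_row (coords_mat (Suc l) T * coords_mat (Suc l) M)"
        "i < dim_col (coords_mat (Suc l) T * coords_mat (Suc l) M)"
      then have ji: "j < Suc l" "i < Suc l" by (auto simp: coords_mat_def)
      have "(\<Sum>k<Suc l. T j k * M k i) = T j 0 * lam i + (\<Sum>r<l. T j (Suc r) * M (Suc r) i)"
        unfolding shift by (simp add: M_def)
      also have "(\<Sum>r<l. T j (Suc r) * M (Suc r) i) =
          (\<Sum>r<l. if r = j - 1 then (if j \<noteq> 0 \<and> i = j then \<eta> else 0) else 0)"
        by (intro sum.cong) (auto simp: T_def M_def)
      also have "\<dots> = (if j \<noteq> 0 \<and> i = j then \<eta> else 0)"
        using ji by (cases j) auto
      also have "T j 0 * lam i + \<dots> = L j i" by (auto simp: T_def L_def)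
      finally show "coords_mat (Suc l) L $$ (j, i) = (coords_mat (Suc l) T * coords_mat (Suc l) M) $$ (j, i)"
        using ji by (simp add: coords_mat_def scalar_prod_def lessThan_atLeast0 del: sum.op_ivl_Suc)
    qed (auto simp: coords_mat_def)
    moreover have "Determinant.det (coords_mat (Suc l) T) = \<eta> ^ l"
    proof -
      have "Determinant.det (coords_mat (Suc l) T) = (\<Prod>i<Suc l. T i i)"
        by (rule det_one_column[of 0]) (auto simp: T_def)
      also have "\<dots> = \<eta> ^ l" unfolding prod.lessThan_Suc_shift by (simp add: T_def)
      finally show ?thesis .
    qed
    moreover have "Determinant.det (coords_mat (Suc l) M) = lam 0"
    proof -
      have "Determinant.det (coords_mat (Suc l) M) = prod_list (diag_mat (coords_mat (Suc l) M))"
        by (rule det_upper_triangular[of _ "Suc l"]) (auto simp: coords_mat_def M_def)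
      also have "\<dots> = (\<Prod>i<Suc l. M i i)"
        by (simp add: prod_list_diag_prod coords_mat_def lessThan_atLeast0 del: prod.op_ivl_Suc)
      also have "\<dots> = lam 0" unfolding prod.lessThan_Suc_shift by (simp add: M_def)
      finally show ?thesis .
    qed
    ultimately have "Determinant.det (coords_mat (Suc l) L) = \<eta> ^ l * lam 0"
      by (simp add: det_mult[of _ "Suc l"] coords_mat_def)
    moreover have "\<eta> ^ l * (1/2) \<le> \<eta> ^ l * lam 0" using half \<eta> by (intro mult_left_mono) auto
    ultimately show ?thesis by (simp add: volume_ratio_def)
  qed
  ultimately show ?thesis by blast
qed

section \<open>Minimizing a norm over an affine space by cutting simplices\<close>

text \<open>Convexity of \<open>\<bar>a\<bar> powr q\<close>. The formula for the subgradient avoids the sign function and is correct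
at \<open>a = 0\<close>, where it gives \<open>0\<close>, and for \<open>q = 1\<close>, where it gives the sign of \<open>a\<close>.\<close>

lemma powr_subgradient:
  fixes a b :: real
  assumes "1 \<le> q"
  shows "\<bar>a\<bar> powr q + q * (a * \<bar>a\<bar> powr (q - 2)) * (b - a) \<le> \<bar>b\<bar> powr q"
proof (cases "a = 0")
  case False
  have split: "\<bar>a\<bar> powr q = \<bar>a\<bar> * \<bar>a\<bar> powr (q - 1)" "\<bar>a\<bar> powr (q - 1) = \<bar>a\<bar> * \<bar>a\<bar> powr (q - 2)"
    using False powr_add[of "\<bar>a\<bar>" 1 "q - 1"] powr_add[of "\<bar>a\<bar>" 1 "q - 2"] by simp_all
  have aa: "a * \<bar>a\<bar> powr (q - 2) * a = \<bar>a\<bar> powr q"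
    unfolding split by (simp add: abs_mult_self_eq mult_ac)
  have "a * b \<le> \<bar>a\<bar> * \<bar>b\<bar>" by (metis abs_ge_self abs_mult)
  then have "a * b * \<bar>a\<bar> powr (q - 2) \<le> \<bar>a\<bar> * \<bar>b\<bar> * \<bar>a\<bar> powr (q - 2)"
    by (intro mult_right_mono) auto
  then have ab: "a * \<bar>a\<bar> powr (q - 2) * b \<le> \<bar>b\<bar> * \<bar>a\<bar> powr (q - 1)"
    unfolding split(2) by (simp add: mult_ac)
  have young: "q * (\<bar>b\<bar> * \<bar>a\<bar> powr (q - 1)) \<le> \<bar>b\<bar> powr q + (q - 1) * \<bar>a\<bar> powr q"
  proof (cases "q = 1")
    case True
    then show ?thesis using False by simp
  next
    case q: False
    then have q1: "1 < q" using assms by simp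
    have "\<bar>b\<bar> * \<bar>a\<bar> powr (q - 1) \<le> \<bar>b\<bar> powr q / q + (\<bar>a\<bar> powr (q - 1)) powr (q / (q - 1)) / (q / (q - 1))"
      using q1 by (intro Youngs_inequality) (auto simp: field_simps)
    also have "(\<bar>a\<bar> powr (q - 1)) powr (q / (q - 1)) = \<bar>a\<bar> powr q"
      using q1 by (simp add: powr_powr)
    finally show ?thesis using q1 by (simp add: field_simps)
  qed
  have "\<bar>a\<bar> powr q + q * (a * \<bar>a\<bar> powr (q - 2)) * (b - a)
      = q * (a * \<bar>a\<bar> powr (q - 2) * b) - (q - 1) * \<bar>a\<bar> powr q"
    unfolding aa[symmetric] by (simp add: algebra_simps)
  also have "\<dots> \<le> q * (\<bar>b\<bar> * \<bar>a\<bar> powr (q - 1)) - (q - 1) * \<bar>a\<bar> powr q"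
    using mult_left_mono[OF ab, of q] assms by simp
  finally show ?thesis using young by linarith
qed (use assms in simp)

lemma sum_abs_square_le: "(\<Sum>r<l. \<bar>x r\<bar>)\<^sup>2 \<le> real l * inner_prod l x x"
  using Cauchy_Schwarz_ineq_sum[of "\<lambda>r. \<bar>x r\<bar>" "\<lambda>_. 1" "{..<l}"]
  by (simp add: inner_prod_def power2_eq_square mult.commute abs_mult_self_eq)

lemma inner_prod_self_le: "inner_prod l x x \<le> (\<Sum>r<l. \<bar>x r\<bar>)\<^sup>2"
proof -
  have "inner_prod l x x = (\<Sum>r<l. \<bar>x r\<bar> * \<bar>x r\<bar>)" by (simp add: inner_prod_def abs_mult_self_eq)
  also have "\<dots> \<le> (\<Sum>r<l. \<bar>x r\<bar> * (\<Sum>s<l. \<bar>x s\<bar>))"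
    by (intro sum_mono mult_left_mono member_le_sum) auto
  finally show ?thesis by (simp add: power2_eq_square sum_distrib_right)
qed

lemma inner_prod_self_nonneg: "0 \<le> inner_prod l x x"
  by (auto simp: inner_prod_def intro: sum_nonneg)

lemma inner_prod_diff_left: "inner_prod l (\<lambda>r. x r - y r) z = inner_prod l x z - inner_prod l y z"
  by (simp add: inner_prod_def left_diff_distrib sum_subtractf)

text \<open>Minimization of a norm with a finite exponent over the solutions of \<open>B\<^sup>T \<beta> = a\<close>, with the data
that the first phase of the program provides, and with a solution \<open>opt\<close> of least norm as reference.\<close>

locale affine_norm_problem =
  fixes l n :: nat and B :: "nat \<Rightarrow> nat \<Rightarrow> real" and a :: "nat \<Rightarrow> real"
    and Q :: "nat \<Rightarrow> nat \<Rightarrow> real" and c :: "nat \<Rightarrow> real" and q :: real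
    and opt :: "nat \<Rightarrow> real"
  assumes q: "1 \<le> q"
    and projects: "projects l n B Q"
    and Qc: "\<And>r. r < l \<Longrightarrow> app l Q c r = 0"
    and c: "c \<in> feasible l n B a"
    and opt: "opt \<in> feasible l n B a"
    and opt_le: "\<And>\<gamma>. \<gamma> \<in> feasible l n B a \<Longrightarrow> pn (ereal q) l opt \<le> pn (ereal q) l \<gamma>"
begin

abbreviation norm_q :: "(nat \<Rightarrow> real) \<Rightarrow> real" where
  "norm_q \<equiv> pn (ereal q) l"

text \<open>The feasible set is parametrized by the whole space, not by the range of \<open>Q\<close>, so that the
dimension of the simplices is known without computing a rank.\<close>

definition point :: "(nat \<Rightarrow> real) \<Rightarrow> nat \<Rightarrow> real" where
  "point z r = c r + app l Q z r"

definition objective :: "(nat \<Rightarrow> real) \<Rightarrow> real" where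
  "objective z = norm_q (point z)"

definition zopt :: "nat \<Rightarrow> real" where
  "zopt r = opt r - c r"

definition subgradient :: "(nat \<Rightarrow> real) \<Rightarrow> nat \<Rightarrow> real" where
  "subgradient z = app l Q (\<lambda>r. point z r * \<bar>point z r\<bar> powr (q - 2))"

lemma q_ereal: "1 \<le> ereal q" using q by simp

lemma Q_symmetric: "\<forall>r<l. \<forall>s<l. Q r s = Q s r"
  by (rule projects_symmetric[OF projects])

lemma Q_idem: "r < l \<Longrightarrow> app l Q (app l Q x) r = app l Q x r"
  by (rule projects_idem[OF projects])

lemma Q_column: "k < n \<Longrightarrow> r < l \<Longrightarrow> app l Q (\<lambda>s. B s k) r = 0"
  by (rule projects_column[OF projects])

lemma point_feasible: "point z \<in> feasible l n B a"
  unfolding feasible_iff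
proof (intro allI impI)
  fix k assume k: "k < n"
  have "inner_prod l (app l Q z) (\<lambda>s. B s k) = inner_prod l z (app l Q (\<lambda>s. B s k))"
    by (rule inner_prod_app_symmetric[OF Q_symmetric, symmetric])
  also have "\<dots> = 0" using Q_column[OF k] by (simp add: inner_prod_def)
  finally have "inner_prod l (\<lambda>s. B s k) (app l Q z) = 0" by (simp add: inner_prod_commute)
  moreover have "inner_prod l (\<lambda>s. B s k) c = a k"
    using c k unfolding feasible_iff by (simp add: inner_prod_commute)
  moreover have "inner_prod l (\<lambda>s. B s k) (point z) = inner_prod l (\<lambda>s. B s k) c +
      inner_prod l (\<lambda>s. B s k) (app l Q z)"
    unfolding point_def by (rule inner_prod_add_right)
  ultimately show "inner_prod l (point z) (\<lambda>s. B s k) = a k" by (simp add: inner_prod_commute)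
qed

lemma opt_le_objective: "norm_q opt \<le> objective z"
  unfolding objective_def by (rule opt_le[OF point_feasible])

lemma Q_zopt: assumes r: "r < l" shows "app l Q zopt r = zopt r"
proof -
  have zero: "inner_prod l zopt (\<lambda>s. B s k) = 0" if "k < n" for k
    using c opt that unfolding feasible_iff zopt_def by (simp add: inner_prod_diff_left)
  obtain \<gamma> where \<gamma>: "\<forall>r<l. zopt r - app l Q zopt r = (\<Sum>k<n. \<gamma> k * B r k)"
    using projects unfolding projects_def by blast
  let ?d = "\<lambda>r. zopt r - app l Q zopt r"
  have "inner_prod l ?d ?d = inner_prod l ?d (\<lambda>s. \<Sum>k<n. \<gamma> k * B s k)"
    using \<gamma> by (intro inner_prod_cong) auto
  also have "\<dots> = (\<Sum>k<n. \<gamma> k * inner_prod l ?d (\<lambda>s. B s k))" by (rule inner_prod_sum_right)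
  also have "\<dots> = 0"
  proof (intro sum.neutral ballI)
    fix k assume k: "k \<in> {..<n}"
    have "inner_prod l (app l Q zopt) (\<lambda>s. B s k) = inner_prod l zopt (app l Q (\<lambda>s. B s k))"
      by (rule inner_prod_app_symmetric[OF Q_symmetric, symmetric])
    also have "\<dots> = 0" using Q_column k by (simp add: inner_prod_def)
    finally show "\<gamma> k * inner_prod l ?d (\<lambda>s. B s k) = 0"
      using zero k by (simp add: inner_prod_diff_left)
  qed
  finally show ?thesis using r by (simp add: inner_prod_self_eq_0)
qed

lemma objective_zopt: "objective zopt = norm_q opt"
  unfolding objective_def by (rule pn_cong) (simp add: point_def Q_zopt, simp add: zopt_def)

text \<open>The vectors \<open>c\<close> and \<open>opt - c\<close> are orthogonal, so \<open>c \<cdot> c = c \<cdot> opt\<close>. The sum norm and the maximum norm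
enclose every other norm, and they differ by a factor of at most \<open>l\<close>.\<close>

lemma norm_c_le: "norm_q c \<le> real l * norm_q opt"
proof -
  define S where "S = (\<Sum>r<l. \<bar>c r\<bar>)"
  have S0: "0 \<le> S" by (simp add: S_def sum_nonneg)
  have "inner_prod l c zopt = inner_prod l c (app l Q zopt)"
    by (rule inner_prod_cong) (simp_all add: Q_zopt)
  also have "\<dots> = inner_prod l (app l Q c) zopt" by (rule inner_prod_app_symmetric[OF Q_symmetric])
  also have "\<dots> = 0" using Qc by (simp add: inner_prod_def)
  finally have cz: "inner_prod l c zopt = 0" .
  have "inner_prod l c c = inner_prod l c opt - inner_prod l c zopt"
    unfolding zopt_def by (simp add: inner_prod_diff_right)
  also have "\<dots> = inner_prod l c opt" using cz by simp
  also have "\<dots> \<le> (\<Sum>r<l. \<bar>c r\<bar> * norm_q opt)"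
    unfolding inner_prod_def
  proof (rule sum_mono)
    fix r assume "r \<in> {..<l}"
    then have "\<bar>c r\<bar> * \<bar>opt r\<bar> \<le> \<bar>c r\<bar> * norm_q opt"
      using abs_le_pn[OF q_ereal] by (intro mult_left_mono) auto
    then show "c r * opt r \<le> \<bar>c r\<bar> * norm_q opt"
      using abs_ge_self[of "c r * opt r"] by (simp add: abs_mult)
  qed
  also have "\<dots> = S * norm_q opt" by (simp add: S_def sum_distrib_right)
  finally have "real l * inner_prod l c c \<le> real l * (S * norm_q opt)"
    by (intro mult_left_mono) auto
  then have "S * S \<le> S * (real l * norm_q opt)"
    using sum_abs_square_le[of c l] by (simp add: S_def[symmetric] power2_eq_square mult_ac)
  then have "S \<le> real l * norm_q opt"
    using S0 pn_nonneg[of "ereal q" l opt] by (cases "S = 0") auto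
  then show ?thesis using pn_le_sum[OF q_ereal, of l c] by (simp add: S_def)
qed

lemma abs_zopt_le:
  assumes "r < l"
  shows "\<bar>zopt r\<bar> \<le> 2 * norm_q c"
proof -
  have "\<bar>zopt r\<bar> \<le> \<bar>opt r\<bar> + \<bar>c r\<bar>" unfolding zopt_def by simp
  also have "\<dots> \<le> norm_q opt + norm_q c" using assms by (intro add_mono abs_le_pn q_ereal)
  finally show ?thesis using opt_le[OF c] by simp
qed

text \<open>An orthogonal projection does not increase the Euclidean norm.\<close>

lemma objective_le: "objective z \<le> norm_q c + real l * (\<Sum>r<l. \<bar>z r\<bar>)"
proof -
  let ?y = "app l Q z"
  have Qy: "inner_prod l ?y ?y = inner_prod l z ?y"
  proof -
    have "inner_prod l ?y ?y = inner_prod l z (app l Q ?y)"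
      by (rule inner_prod_app_symmetric[OF Q_symmetric, symmetric])
    also have "\<dots> = inner_prod l z ?y" by (rule inner_prod_cong) (simp_all add: Q_idem)
    finally show ?thesis .
  qed
  have "0 \<le> inner_prod l (\<lambda>r. z r - ?y r) (\<lambda>r. z r - ?y r)" by (rule inner_prod_self_nonneg)
  also have "\<dots> = inner_prod l z z - inner_prod l ?y ?y"
    using Qy by (simp add: inner_prod_diff_left inner_prod_diff_right inner_prod_commute[of l ?y z])
  finally have "inner_prod l ?y ?y \<le> (\<Sum>r<l. \<bar>z r\<bar>)\<^sup>2" using inner_prod_self_le[of l z] by linarith
  then have "real l * inner_prod l ?y ?y \<le> real l * (\<Sum>r<l. \<bar>z r\<bar>)\<^sup>2"
    by (intro mult_left_mono) auto
  also have "\<dots> \<le> (real l * real l) * (\<Sum>r<l. \<bar>z r\<bar>)\<^sup>2"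
  proof (rule mult_right_mono)
    show "real l \<le> real l * real l" by (metis le_square of_nat_le_iff of_nat_mult)
  qed simp
  finally have "real l * inner_prod l ?y ?y \<le> (real l * real l) * (\<Sum>r<l. \<bar>z r\<bar>)\<^sup>2" .
  then have "(\<Sum>r<l. \<bar>?y r\<bar>)\<^sup>2 \<le> (real l * (\<Sum>r<l. \<bar>z r\<bar>))\<^sup>2"
    using sum_abs_square_le[of ?y l] by (simp add: power2_eq_square mult_ac)
  then have sum_le: "(\<Sum>r<l. \<bar>?y r\<bar>) \<le> real l * (\<Sum>r<l. \<bar>z r\<bar>)"
    by (rule power2_le_imp_le) (simp add: sum_nonneg)
  have "objective z \<le> norm_q c + norm_q ?y"
    unfolding objective_def point_def by (rule pn_triangle[OF q_ereal])
  also have "norm_q ?y \<le> (\<Sum>r<l. \<bar>?y r\<bar>)" by (rule pn_le_sum[OF q_ereal])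
  finally show ?thesis using sum_le by simp
qed

lemma objective_convex:
  assumes "0 \<le> t" "t \<le> 1"
  shows "objective (\<lambda>r. (1 - t) * x r + t * y r) \<le> (1 - t) * objective x + t * objective y"
proof -
  have "objective (\<lambda>r. (1 - t) * x r + t * y r) = norm_q (\<lambda>r. t * point y r + (1 - t) * point x r)"
    unfolding objective_def point_def app_add app_scale by (simp add: algebra_simps)
  then show ?thesis using pn_convex[OF q_ereal assms, of l "point y" "point x"]
    by (simp add: objective_def add.commute)
qed

text \<open>The powers of the norm are sums of convex functions of the coordinates, and \<open>Q\<close> is symmetric.\<close>

lemma subgradient_separates:
  assumes less: "objective z' < objective z"
  shows "inner_prod l (subgradient z) (\<lambda>r. z' r - z r) < 0"
proof -
  let ?g = "\<lambda>r. point z r * \<bar>point z r\<bar> powr (q - 2)"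
  have "(\<Sum>r<l. \<bar>point z' r\<bar> powr q) < (\<Sum>r<l. \<bar>point z r\<bar> powr q)"
  proof (rule ccontr)
    assume "\<not> ?thesis"
    then have "(\<Sum>r<l. \<bar>point z r\<bar> powr q) powr (1/q) \<le> (\<Sum>r<l. \<bar>point z' r\<bar> powr q) powr (1/q)"
      using q by (intro powr_mono2) (auto intro: sum_nonneg)
    then show False using less by (simp add: objective_def pn_real)
  qed
  moreover have "(\<Sum>r<l. \<bar>point z r\<bar> powr q + q * ?g r * (point z' r - point z r))
      \<le> (\<Sum>r<l. \<bar>point z' r\<bar> powr q)"
    by (intro sum_mono powr_subgradient q)
  ultimately have "q * (\<Sum>r<l. ?g r * (point z' r - point z r)) < 0"
    by (simp add: sum.distrib sum_distrib_left mult.assoc)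
  then have neg: "inner_prod l ?g (\<lambda>r. point z' r - point z r) < 0"
    using q by (simp add: inner_prod_def mult_less_0_iff)
  have "inner_prod l (subgradient z) (\<lambda>r. z' r - z r) = inner_prod l ?g (app l Q (\<lambda>r. z' r - z r))"
    unfolding subgradient_def by (rule inner_prod_app_symmetric[OF Q_symmetric, symmetric])
  also have "app l Q (\<lambda>r. z' r - z r) = (\<lambda>r. point z' r - point z r)"
    by (simp add: fun_eq_iff app_diff point_def)
  finally show ?thesis using neg by simp
qed

text \<open>At a vertex of the initial simplex the objective is at most \<open>11 (l + 1)\<^sup>3\<close> times the optimum, so
moving the vertices to the optimum up to this fraction leaves a relative error of \<open>\<epsilon>\<close>.\<close>

definition shrink :: "real \<Rightarrow> real" where
  "shrink \<epsilon> = \<epsilon> / (11 * real (Suc l) ^ 3)"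

definition start :: "nat \<Rightarrow> nat \<Rightarrow> real" where
  "start = initial_simplex l (2 * norm_q c)"

definition targets :: "real \<Rightarrow> nat \<Rightarrow> nat \<Rightarrow> real" where
  "targets \<epsilon> = test_points (shrink \<epsilon>) start zopt"

lemma objective_targets:
  assumes \<epsilon>: "0 < \<epsilon>" "\<epsilon> < 1" and j: "j < Suc l"
  shows "objective (targets \<epsilon> j) \<le> (1 + \<epsilon>) * norm_q opt"
proof (cases "j = 0")
  case True
  have "objective (targets \<epsilon> j) = norm_q opt"
    unfolding True targets_def test_points_def using objective_zopt by simp
  moreover have "0 \<le> \<epsilon> * norm_q opt" using \<epsilon> by (simp add: pn_nonneg)
  ultimately show ?thesis by (simp add: distrib_right)
next
  case False
  define N where "N = real (Suc l)"
  define f0 where "f0 = norm_q c"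
  have N: "1 \<le> N" "real l \<le> N" by (auto simp: N_def)
  have f0: "0 \<le> f0" "f0 \<le> N * norm_q opt"
    using norm_c_le mult_right_mono[OF N(2), of "norm_q opt"] by (auto simp: f0_def pn_nonneg)
  have \<eta>: "0 \<le> shrink \<epsilon>" "shrink \<epsilon> \<le> 1" "shrink \<epsilon> * (11 * N ^ 3) = \<epsilon>"
  proof -
    have N3: "1 \<le> N ^ 3" using N by (simp add: one_le_power)
    show "0 \<le> shrink \<epsilon>" using \<epsilon> by (simp add: shrink_def)
    show "shrink \<epsilon> * (11 * N ^ 3) = \<epsilon>" using N3 by (simp add: shrink_def N_def)
    have "\<epsilon> \<le> 11 * N ^ 3" using \<epsilon> N3 by linarith
    then show "shrink \<epsilon> \<le> 1" using N3 unfolding shrink_def N_def[symmetric]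
      by (subst divide_le_eq_1_pos) linarith+
  qed
  have "(\<Sum>r<l. \<bar>start j r\<bar>) \<le> (\<Sum>r<l. 2 * f0 + (if j = Suc r then 4 * real l * (2 * f0) else 0))"
  proof (rule sum_mono)
    fix r
    have "0 \<le> real l * f0" using f0 by simp
    then show "\<bar>start j r\<bar> \<le> 2 * f0 + (if j = Suc r then 4 * real l * (2 * f0) else 0)"
      using f0 by (auto simp: start_def initial_simplex_def f0_def[symmetric] abs_le_iff)
  qed
  also have "\<dots> \<le> real l * (2 * f0) + 4 * real l * (2 * f0)"
  proof -
    have "(\<Sum>r<l. if j = Suc r then 4 * real l * (2 * f0) else 0) =
        (\<Sum>r<l. if r = j - 1 then 4 * real l * (2 * f0) else 0)"
      using False by (intro sum.cong) auto
    also have "\<dots> \<le> 4 * real l * (2 * f0)" using f0 by simp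
    finally show ?thesis by (simp add: sum.distrib mult_ac)
  qed
  also have "\<dots> \<le> 10 * N * f0" using mult_right_mono[OF N(2) f0(1)] by (simp add: mult.commute[of f0])
  finally have "real l * (\<Sum>r<l. \<bar>start j r\<bar>) \<le> N * (10 * N * f0)"
    using N f0 by (intro mult_mono) (auto intro: sum_nonneg)
  then have "objective (start j) \<le> f0 + 10 * N\<^sup>2 * f0"
    using objective_le[of "start j"] by (simp add: f0_def power2_eq_square mult_ac)
  also have "\<dots> \<le> 11 * N\<^sup>2 * f0"
    using mult_right_mono[OF one_le_power[OF N(1), of 2] f0(1)] by (simp add: mult.commute[of f0])
  also have "\<dots> \<le> 11 * N\<^sup>2 * (N * norm_q opt)" using f0 N by (intro mult_left_mono) auto
  finally have st: "objective (start j) \<le> 11 * N ^ 3 * norm_q opt"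
    by (simp add: power2_eq_square power3_eq_cube mult_ac)
  have "objective (targets \<epsilon> j) = objective (\<lambda>r. (1 - shrink \<epsilon>) * zopt r + shrink \<epsilon> * start j r)"
  proof -
    have "targets \<epsilon> j = (\<lambda>r. (1 - shrink \<epsilon>) * zopt r + shrink \<epsilon> * start j r)"
      using False by (simp add: fun_eq_iff targets_def test_points_def)
    then show ?thesis by simp
  qed
  also have "\<dots> \<le> (1 - shrink \<epsilon>) * norm_q opt + shrink \<epsilon> * objective (start j)"
    using objective_convex[OF \<eta>(1,2), of zopt "start j"] unfolding objective_zopt .
  also have "\<dots> \<le> norm_q opt + shrink \<epsilon> * (11 * N ^ 3 * norm_q opt)"
  proof (intro add_mono mult_left_mono st \<eta>(1))
    show "(1 - shrink \<epsilon>) * norm_q opt \<le> norm_q opt"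
      using \<eta> by (intro mult_left_le_one_le) (auto simp: pn_nonneg)
  qed
  also have "\<dots> = norm_q opt + (shrink \<epsilon> * (11 * N ^ 3)) * norm_q opt" by (simp add: mult_ac)
  also have "\<dots> = (1 + \<epsilon>) * norm_q opt" unfolding \<eta>(3) by (simp add: distrib_right)
  finally show ?thesis .
qed

text \<open>After a value within the accuracy has been found, nothing has to be known about the simplex.
Otherwise no test point has been cut off, and \<open>y\<close> records the guaranteed growth.\<close>

definition cut_invariant :: "real \<Rightarrow> (nat \<Rightarrow> nat \<Rightarrow> real) \<Rightarrow> real \<Rightarrow> real \<Rightarrow> bool" where
  "cut_invariant \<epsilon> V best y \<longleftrightarrow> norm_q opt \<le> best \<and>
     (best \<le> (1 + \<epsilon>) * norm_q opt \<or>
      (\<exists>L. barycentric (Suc l) l V (targets \<epsilon>) L \<and>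
         y * (shrink \<epsilon> ^ l / 2) \<le> volume_ratio (Suc l) L))"

lemma shrink_bounds: assumes "0 < \<epsilon>" "\<epsilon> < 1" shows "0 < shrink \<epsilon>" "shrink \<epsilon> \<le> 1"
proof -
  have "1 \<le> real (Suc l) ^ 3" by (rule one_le_power) simp
  then have "\<epsilon> \<le> 11 * real (Suc l) ^ 3" using assms by linarith
  then show "shrink \<epsilon> \<le> 1" unfolding shrink_def by (subst divide_le_eq_1_pos) simp_all
  show "0 < shrink \<epsilon>" using assms by (simp add: shrink_def)
qed

text \<open>If the norm of \<open>c\<close> is \<open>0\<close>, the initial simplex degenerates to a point, but then \<open>c\<close> is optimal.\<close>

lemma cut_invariant_start:
  assumes \<epsilon>: "0 < \<epsilon>" "\<epsilon> < 1" and V: "\<And>k r. k < Suc l \<Longrightarrow> r < l \<Longrightarrow> V k r = start k r"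
  shows "cut_invariant \<epsilon> V (norm_q c) 1"
proof (cases "norm_q c = 0")
  case True
  then show ?thesis using opt_le[OF c] pn_nonneg[of "ereal q" l opt] \<epsilon>
    by (simp add: cut_invariant_def)
next
  case False
  then have "0 < 2 * norm_q c" using pn_nonneg[of "ereal q" l c] by simp
  then have "\<exists>L. barycentric (Suc l) l start (targets \<epsilon>) L \<and>
      shrink \<epsilon> ^ l / 2 \<le> volume_ratio (Suc l) L"
    unfolding targets_def start_def using abs_zopt_le shrink_bounds[OF \<epsilon>]
    by (intro initial_barycentric) auto
  then
  obtain L where L: "barycentric (Suc l) l start (targets \<epsilon>) L"
    "shrink \<epsilon> ^ l / 2 \<le> volume_ratio (Suc l) L"
    by blast
  have "barycentric (Suc l) l V (targets \<epsilon>) L"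
    using L(1) V unfolding barycentric_def by simp
  then show ?thesis using L(2) opt_le[OF c] unfolding cut_invariant_def by auto
qed

text \<open>Unless the value at the centroid is already within the accuracy, it is larger than the values at
all test points. So these lie strictly on the side of the subgradient that is kept.\<close>

lemma cut_invariant_step:
  assumes \<epsilon>: "0 < \<epsilon>" "\<epsilon> < 1" and inv: "cut_invariant \<epsilon> V best y" and y: "0 \<le> y"
    and v: "\<And>r. r < l \<Longrightarrow> v r = (\<Sum>k<Suc l. V k r) / real (Suc l)"
    and h: "\<And>k. k < Suc l \<Longrightarrow> h k = inner_prod l (subgradient v) (\<lambda>r. V k r - v r)"
    and k0: "k0 < Suc l" "\<And>k. k < Suc l \<Longrightarrow> h k0 \<le> h k"
    and V': "\<And>k r. k < Suc l \<Longrightarrow> r < l \<Longrightarrow>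
      V' k r = V k0 r + (V k r - V k0 r) / (1 + 1 / (4 * (real (Suc l))\<^sup>2) * (h k / - h k0))"
  shows "cut_invariant \<epsilon> V' (min best (objective v)) (y * (1 + 1 / (8 * (real (Suc l))\<^sup>2)))"
proof -
  let ?b = "min best (objective v)"
  have low: "norm_q opt \<le> ?b" using inv opt_le_objective[of v] by (simp add: cut_invariant_def)
  show ?thesis
  proof (cases "?b \<le> (1 + \<epsilon>) * norm_q opt")
    case False
    then obtain L where L: "barycentric (Suc l) l V (targets \<epsilon>) L"
      "y * (shrink \<epsilon> ^ l / 2) \<le> volume_ratio (Suc l) L"
      using inv by (auto simp: cut_invariant_def)
    have cut: "inner_prod l (subgradient v) (\<lambda>r. targets \<epsilon> j r - v r) < 0" if "j < Suc l" for j
      using objective_targets[OF \<epsilon> that] False by (intro subgradient_separates) simp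
    obtain L' where L': "barycentric (Suc l) l V' (targets \<epsilon>) L'"
      "(1 + 1 / (8 * (real (Suc l))\<^sup>2)) * volume_ratio (Suc l) L
        \<le> volume_ratio (Suc l) L'"
      using simplex_step[of "Suc l" l V "targets \<epsilon>" L v h "subgradient v" k0 V', OF L(1) _ v h cut k0 V']
      by auto
    have "y * (1 + 1 / (8 * (real (Suc l))\<^sup>2)) * (shrink \<epsilon> ^ l / 2) =
        (1 + 1 / (8 * (real (Suc l))\<^sup>2)) * (y * (shrink \<epsilon> ^ l / 2))" by (simp add: mult_ac)
    also have "\<dots> \<le> (1 + 1 / (8 * (real (Suc l))\<^sup>2)) * volume_ratio (Suc l) L"
      using L(2) by (intro mult_left_mono) auto
    also note L'(2)
    finally show ?thesis using L'(1) low unfolding cut_invariant_def by blast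
  qed (use low in \<open>simp add: cut_invariant_def\<close>)
qed

lemma cut_invariant_end:
  assumes \<epsilon>: "0 < \<epsilon>" "\<epsilon> < 1" and inv: "cut_invariant \<epsilon> V best y"
    and y: "4 * (real (Suc l) / shrink \<epsilon>) ^ Suc l \<le> y"
  shows "norm_q opt \<le> best" "best \<le> (1 + \<epsilon>) * norm_q opt"
proof -
  show "norm_q opt \<le> best" using inv by (simp add: cut_invariant_def)
  show "best \<le> (1 + \<epsilon>) * norm_q opt"
  proof (rule ccontr)
    assume "\<not> ?thesis"
    then obtain L where L: "barycentric (Suc l) l V (targets \<epsilon>) L"
      "y * (shrink \<epsilon> ^ l / 2) \<le> volume_ratio (Suc l) L"
      using inv by (auto simp: cut_invariant_def)
    note \<eta> = shrink_bounds[OF \<epsilon>]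
    have "2 * real (Suc l) ^ Suc l \<le> 2 * real (Suc l) ^ Suc l / shrink \<epsilon>"
      using \<eta> by (simp add: le_divide_eq mult_left_le)
    also have "\<dots> = 4 * (real (Suc l) / shrink \<epsilon>) ^ Suc l * (shrink \<epsilon> ^ l / 2)"
      using \<eta> by (simp add: power_divide field_simps del: of_nat_Suc)
    also have "\<dots> \<le> y * (shrink \<epsilon> ^ l / 2)" using y \<eta> by (intro mult_right_mono) auto
    also have "\<dots> \<le> real (Suc l) ^ Suc l" using L(2) volume_ratio_le[OF L(1)] by linarith
    finally have "real (Suc l) ^ Suc l \<le> 0" by linarith
    moreover have "0 < real (Suc l) ^ Suc l" by (rule zero_less_power) simp
    ultimately show False by linarith
  qed
qed

end

section \<open>Total correctness with running time\<close>

text \<open>The running time of a program is at most \<open>coef c * D ^ depth c\<close> if each of its loops has at most \<open>D\<close>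
iterations. Both numbers depend only on the text of the program.\<close>

fun coef :: "com \<Rightarrow> nat" where
  "coef Skip = 1"
| "coef (NAssign r e) = Suc (ncost e)"
| "coef (RAssign a i j e) = Suc (ncost i + ncost j + rcost e)"
| "coef (Seq c d) = coef c + coef d"
| "coef (Cond b c d) = tcost b + coef c + coef d"
| "coef (While b c) = 2 * tcost b + coef c"

fun depth :: "com \<Rightarrow> nat" where
  "depth (Seq c d) = max (depth c) (depth d)"
| "depth (Cond b c d) = max (depth c) (depth d)"
| "depth (While b c) = Suc (depth c)"
| "depth _ = 0"

text \<open>Total correctness with a time bound. The single loop whose number of iterations depends on the
accuracy contributes the factor \<open>W\<close>. It is kept apart from \<open>D\<close>, as the time has to be linear in the
number of accuracy digits and not just polynomial.\<close>

definition tot :: "nat \<Rightarrow> nat \<Rightarrow> com \<Rightarrow> state \<Rightarrow> (state \<Rightarrow> bool) \<Rightarrow> bool" where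
  "tot D W c s P \<longleftrightarrow> 1 \<le> D \<and> 1 \<le> W \<and>
     (\<exists>t s'. exec c s t s' \<and> t \<le> coef c * D ^ depth c * W \<and> P s')"

definition set_reg :: "nat \<Rightarrow> nat \<Rightarrow> state \<Rightarrow> state" where
  "set_reg r v s = s\<lparr>reg := (reg s)(r := v)\<rparr>"

definition set_arr :: "nat \<Rightarrow> (nat \<Rightarrow> nat \<Rightarrow> real) \<Rightarrow> state \<Rightarrow> state" where
  "set_arr a f s = s\<lparr>arr := (arr s)(a := f)\<rparr>"

definition set_cell :: "nat \<Rightarrow> nat \<Rightarrow> nat \<Rightarrow> real \<Rightarrow> state \<Rightarrow> state" where
  "set_cell a i j x s = set_arr a ((arr s a)(i := (arr s a i)(j := x))) s"

lemma state_access [simp]: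
  "reg (set_reg r v s) = (reg s)(r := v)" "arr (set_reg r v s) = arr s"
  "reg (set_arr a f s) = reg s" "arr (set_arr a f s) = (arr s)(a := f)"
  by (simp_all add: set_reg_def set_arr_def)

lemma state_update [simp]:
  "set_arr a f (set_reg r v s) = set_reg r v (set_arr a f s)"
  "set_arr a f (set_arr a g s) = set_arr a f s"
  "set_reg r v (set_reg r w s) = set_reg r v s"
  "set_arr a (arr s a) s = s" "set_reg r (reg s r) s = s"
  by (simp_all add: set_reg_def set_arr_def)

lemma set_reg_same: "reg s r = v \<Longrightarrow> set_reg r v s = s"
  by (auto simp: set_reg_def)

lemma set_reg_commute: "r \<noteq> r' \<Longrightarrow> set_reg r v (set_reg r' w s) = set_reg r' w (set_reg r v s)"
  by (simp add: set_reg_def fun_upd_twist)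

lemma tot_weaken: "tot D W c s P \<Longrightarrow> (\<And>s'. P s' \<Longrightarrow> R s') \<Longrightarrow> tot D W c s R"
  unfolding tot_def by blast

lemma time_mono:
  assumes "1 \<le> D" "c \<le> c'" "k \<le> k'" "w \<le> w'"
  shows "c * D ^ k * w \<le> c' * D ^ k' * (w' :: nat)"
  using assms by (intro mult_mono power_increasing) auto

lemma time_depth:
  assumes "1 \<le> D" "t \<le> a * D ^ k * w" "k \<le> k'"
  shows "t \<le> a * D ^ k' * (w :: nat)"
  using assms(2) time_mono[OF assms(1) order.refl assms(3) order.refl] by (rule order.trans)

lemma tot_Skip: "1 \<le> D \<Longrightarrow> 1 \<le> W \<Longrightarrow> P s \<Longrightarrow> tot D W Skip s P"
  unfolding tot_def using exec.Skip by fastforce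

lemma tot_NAssign:
  assumes "1 \<le> D" "1 \<le> W" "P (set_reg r (nval e s) s)" shows "tot D W (NAssign r e) s P"
  unfolding tot_def
proof (intro conjI exI)
  show "exec (NAssign r e) s (Suc (ncost e)) (set_reg r (nval e s) s)"
    unfolding set_reg_def by (rule exec.NAssign)
  show "Suc (ncost e) \<le> coef (NAssign r e) * D ^ depth (NAssign r e) * W"
    using mult_le_mono2[OF assms(2), of "Suc (ncost e)"] by simp
qed (use assms in auto)

lemma tot_RAssign:
  assumes "1 \<le> D" "1 \<le> W" "P (set_cell a (nval i s) (nval j s) (rval e s) s)"
  shows "tot D W (RAssign a i j e) s P"
  unfolding tot_def
proof (intro conjI exI)
  show "exec (RAssign a i j e) s (Suc (ncost i + ncost j + rcost e))
      (set_cell a (nval i s) (nval j s) (rval e s) s)"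
    unfolding set_cell_def set_arr_def by (rule exec.RAssign)
  show "Suc (ncost i + ncost j + rcost e) \<le> coef (RAssign a i j e) * D ^ depth (RAssign a i j e) * W"
    using mult_le_mono2[OF assms(2), of "Suc (ncost i + ncost j + rcost e)"] by simp
qed (use assms in auto)

lemma tot_Seq:
  assumes "tot D W c s (\<lambda>s'. tot D W d s' P)"
  shows "tot D W (Seq c d) s P"
proof -
  obtain t s' u s'' where *: "1 \<le> D" "1 \<le> W" "exec c s t s'" "t \<le> coef c * D ^ depth c * W"
    "exec d s' u s''" "u \<le> coef d * D ^ depth d * W" "P s''"
    using assms unfolding tot_def by blast
  have "t \<le> coef c * D ^ max (depth c) (depth d) * W"
    by (rule time_depth[OF *(1,4)]) simp
  moreover have "u \<le> coef d * D ^ max (depth c) (depth d) * W"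
    by (rule time_depth[OF *(1,6)]) simp
  ultimately have "t + u \<le> coef (Seq c d) * D ^ depth (Seq c d) * W"
    by (simp add: add_mult_distrib)
  then show ?thesis using * exec.Seq[OF *(3,5)] unfolding tot_def by blast
qed

lemma tot_Cond:
  assumes D: "1 \<le> D" "1 \<le> W" and c: "tval b s \<Longrightarrow> tot D W c s P" and d: "\<not> tval b s \<Longrightarrow> tot D W d s P"
  shows "tot D W (Cond b c d) s P"
proof -
  let ?m = "max (depth c) (depth d)"
  have tb: "tcost b \<le> tcost b * D ^ ?m * W"
    using time_mono[OF D(1), of "tcost b" "tcost b" 0 ?m 1 W] D by simp
  show ?thesis
  proof (cases "tval b s")
    case True
    then obtain t s' where *: "exec c s t s'" "t \<le> coef c * D ^ depth c * W" "P s'"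
      using c unfolding tot_def by blast
    have "t \<le> coef c * D ^ ?m * W"
      by (rule time_depth[OF D(1) *(2)]) simp
    with tb have "tcost b + t \<le> tcost b * D ^ ?m * W + coef c * D ^ ?m * W"
      by (rule add_mono)
    also have "\<dots> \<le> coef (Cond b c d) * D ^ depth (Cond b c d) * W"
      by (simp add: add_mult_distrib)
    finally have "tcost b + t \<le> coef (Cond b c d) * D ^ depth (Cond b c d) * W" .
    then show ?thesis using D * exec.CondTrue[OF True *(1)] unfolding tot_def by blast
  next
    case False
    then obtain t s' where *: "exec d s t s'" "t \<le> coef d * D ^ depth d * W" "P s'"
      using d unfolding tot_def by blast
    have "t \<le> coef d * D ^ ?m * W"
      by (rule time_depth[OF D(1) *(2)]) simp
    with tb have "tcost b + t \<le> tcost b * D ^ ?m * W + coef d * D ^ ?m * W"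
      by (rule add_mono)
    also have "\<dots> \<le> coef (Cond b c d) * D ^ depth (Cond b c d) * W"
      by (simp add: add_mult_distrib)
    finally have "tcost b + t \<le> coef (Cond b c d) * D ^ depth (Cond b c d) * W" .
    then show ?thesis using D * exec.CondFalse[OF False *(1)] unfolding tot_def by blast
  qed
qed

lemma exec_While:
  assumes body: "\<And>k s. k < N \<Longrightarrow> I k s \<Longrightarrow> tval b s \<and> (\<exists>t s'. exec c s t s' \<and> t \<le> T \<and> I (Suc k) s')"
    and exit: "\<And>s. I N s \<Longrightarrow> \<not> tval b s"
    and k: "k \<le> N" and I: "I k s"
  shows "\<exists>t s'. exec (While b c) s t s' \<and> t \<le> (N - k) * (tcost b + T) + tcost b \<and> I N s'"
  using k I
proof (induction "N - k" arbitrary: k s)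
  case 0
  then have "I N s" by simp
  then show ?case using exec.WhileFalse[of b s c] exit 0 by (intro exI[of _ "tcost b"] exI[of _ s]) auto
next
  case (Suc d)
  then have k: "k < N" by simp
  from body[OF k Suc.prems(2)] obtain t s' where *: "tval b s" "exec c s t s'" "t \<le> T" "I (Suc k) s'"
    by blast
  have d: "d = N - Suc k" using Suc.hyps(2) by arith
  obtain u s'' where **: "exec (While b c) s' u s''" "u \<le> (N - Suc k) * (tcost b + T) + tcost b" "I N s''"
    using Suc.hyps(1)[OF d _ *(4)] k by auto
  have "N - k = Suc (N - Suc k)" using k by simp
  then have "tcost b + t + u \<le> (N - k) * (tcost b + T) + tcost b" using *(3) **(2) by simp
  then show ?case using exec.WhileTrue[OF *(1,2) **(1)] **(3) by blast
qed

lemma tot_While_bounded: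
  assumes D: "1 \<le> D" "1 \<le> W" and N: "N \<le> D"
    and I: "I 0 s"
    and body: "\<And>k s. k < N \<Longrightarrow> I k s \<Longrightarrow> tval b s \<and> tot D W c s (I (Suc k))"
    and exit: "\<And>s. I N s \<Longrightarrow> \<not> tval b s" and P: "\<And>s. I N s \<Longrightarrow> P s"
  shows "tot D W (While b c) s P"
proof -
  let ?T = "coef c * D ^ depth c * W"
  have "\<exists>t s'. exec (While b c) s t s' \<and> t \<le> (N - 0) * (tcost b + ?T) + tcost b \<and> I N s'"
    using body exit I unfolding tot_def by (intro exec_While) blast+
  then obtain t s' where *: "exec (While b c) s t s'" "t \<le> N * (tcost b + ?T) + tcost b" "I N s'" by auto
  have "N * (tcost b + ?T) + tcost b \<le> D * (tcost b + ?T) + tcost b" using N by simp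
  also have "\<dots> = tcost b * D ^ 1 * 1 + coef c * D ^ Suc (depth c) * W + tcost b * D ^ 0 * 1"
    by (simp add: algebra_simps)
  also have "\<dots> \<le> tcost b * D ^ Suc (depth c) * W + coef c * D ^ Suc (depth c) * W
      + tcost b * D ^ Suc (depth c) * W"
    using D by (intro add_mono time_mono) auto
  also have "\<dots> = coef (While b c) * D ^ depth (While b c) * W" by (simp add: algebra_simps)
  finally show ?thesis using * D P unfolding tot_def by (meson order.trans)
qed

text \<open>The loop whose number of iterations depends on the accuracy: it is bounded by \<open>W\<close>, and the
  body contains no such loop.\<close>

lemma tot_While_iterated:
  assumes D: "1 \<le> D" "1 \<le> W" and N: "N \<le> W"
    and I: "I 0 s"
    and body: "\<And>k s. k < N \<Longrightarrow> I k s \<Longrightarrow> tval b s \<and> tot D 1 c s (I (Suc k))"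
    and exit: "\<And>s. I N s \<Longrightarrow> \<not> tval b s" and P: "\<And>s. I N s \<Longrightarrow> P s"
  shows "tot D W (While b c) s P"
proof -
  let ?T = "coef c * D ^ depth c"
  have "\<exists>t s'. exec (While b c) s t s' \<and> t \<le> (N - 0) * (tcost b + ?T) + tcost b \<and> I N s'"
    using body exit I unfolding tot_def mult_1_right by (intro exec_While) blast+
  then obtain t s' where *: "exec (While b c) s t s'" "t \<le> N * (tcost b + ?T) + tcost b" "I N s'" by auto
  have "N * (tcost b + ?T) + tcost b \<le> W * (tcost b + ?T) + tcost b" using N by simp
  also have "\<dots> = tcost b * D ^ 0 * W + coef c * D ^ depth c * W + tcost b * D ^ 0 * 1"
    by (simp add: algebra_simps)
  also have "\<dots> \<le> tcost b * D ^ Suc (depth c) * W + coef c * D ^ Suc (depth c) * W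
      + tcost b * D ^ Suc (depth c) * W"
    using D by (intro add_mono time_mono) auto
  also have "\<dots> = coef (While b c) * D ^ depth (While b c) * W" by (simp add: algebra_simps)
  finally show ?thesis using * D P unfolding tot_def by (meson order.trans)
qed

text \<open>The counter is reset to \<open>0\<close> in the end. So a loop does not change the registers, and the state after
it is known exactly.\<close>

definition For :: "nat \<Rightarrow> nexp \<Rightarrow> com \<Rightarrow> com" where
  "For r b c = Seq (NAssign r NZero)
     (Seq (While (NLess (NReg r) b) (Seq c (NAssign r (NSuc (NReg r))))) (NAssign r NZero))"

lemma tot_For:
  assumes D: "1 \<le> D" "1 \<le> W" "N \<le> D" and r: "reg s r = 0" and I: "I 0 s"
    and b: "\<And>k s. k \<le> N \<Longrightarrow> I k s \<Longrightarrow> reg s r = 0 \<Longrightarrow> nval b (set_reg r k s) = N"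
    and body: "\<And>k s. k < N \<Longrightarrow> I k s \<Longrightarrow> reg s r = 0 \<Longrightarrow>
       tot D W c (set_reg r k s) (\<lambda>s'. reg s' r = k \<and> I (Suc k) (set_reg r 0 s'))"
    and P: "\<And>s. I N s \<Longrightarrow> reg s r = 0 \<Longrightarrow> P s"
  shows "tot D W (For r b c) s P"
proof -
  let ?J = "\<lambda>k s. reg s r = k \<and> I k (set_reg r 0 s)"
  have J: "nval b s = N" if "?J k s" "k \<le> N" for k s
    using b[OF that(2), of "set_reg r 0 s"] that set_reg_same[of s r k] by simp
  have loop: "tot D W (While (NLess (NReg r) b) (Seq c (NAssign r (NSuc (NReg r))))) s (?J N)"
  proof (rule tot_While_bounded[where I = ?J, OF D])
    show "?J 0 s" using r I by (simp add: set_reg_same)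
  next
    fix k s assume k: "k < N" and Jk: "?J k s"
    have "tot D W c s (\<lambda>s'. reg s' r = k \<and> I (Suc k) (set_reg r 0 s'))"
      using body[OF k, of "set_reg r 0 s"] Jk set_reg_same[of s r k] by simp
    then have "tot D W (Seq c (NAssign r (NSuc (NReg r)))) s (?J (Suc k))"
      using D by (intro tot_Seq) (auto intro!: tot_NAssign elim!: tot_weaken)
    then show "tval (NLess (NReg r) b) s \<and> tot D W (Seq c (NAssign r (NSuc (NReg r)))) s (?J (Suc k))"
      using J[OF Jk] Jk k by simp
  next
    fix s assume "?J N s" then show "\<not> tval (NLess (NReg r) b) s" using J[where k = N] by simp
  qed
  show ?thesis unfolding For_def
  proof (intro tot_Seq tot_NAssign D)
    have s: "set_reg r (nval NZero s) s = s" using r by (simp add: set_reg_same)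
    show "tot D W (While (NLess (NReg r) b) (Seq c (NAssign r (NSuc (NReg r)))))
       (set_reg r (nval NZero s) s) (\<lambda>s'. tot D W (NAssign r NZero) s' P)"
      unfolding s using loop
    proof (rule tot_weaken)
      fix s' assume "reg s' r = N \<and> I N (set_reg r 0 s')"
      then show "tot D W (NAssign r NZero) s' P"
        using P[of "set_reg r 0 s'"] D by (intro tot_NAssign) auto
    qed
  qed
qed

text \<open>If the effect of every iteration is known exactly, the invariant is an equation, and no frame
  condition is needed.\<close>

lemma tot_For_exact:
  assumes D: "1 \<le> D" "1 \<le> W" "N \<le> D" and F0: "F 0 = s"
    and r: "\<And>k. k \<le> N \<Longrightarrow> reg (F k) r = 0"
    and b: "\<And>k. k \<le> N \<Longrightarrow> nval b (set_reg r k (F k)) = N"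
    and body: "\<And>k. k < N \<Longrightarrow> tot D W c (set_reg r k (F k)) (\<lambda>s'. s' = set_reg r k (F (Suc k)))"
    and P: "P (F N)"
  shows "tot D W (For r b c) s P"
proof (rule tot_For[where I = "\<lambda>k s. s = F k", OF D])
  show "reg s r = 0" using r[of 0] F0 by simp
  fix k s assume k: "k < N" "s = F k"
  have "reg (F (Suc k)) r = 0" using r[of "Suc k"] k by simp
  then show "tot D W c (set_reg r k s) (\<lambda>s'. reg s' r = k \<and> set_reg r 0 s' = F (Suc k))"
    unfolding k(2) using body[OF k(1)]
    by (elim tot_weaken) (auto simp: set_reg_same)
qed (use assms in auto)

definition SumTo :: "nat \<Rightarrow> nexp \<Rightarrow> nexp \<Rightarrow> nat \<Rightarrow> nexp \<Rightarrow> rexp \<Rightarrow> com" where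
  "SumTo a i j r b e = Seq (RAssign a i j RZero)
     (For r b (RAssign a i j (RAdd (RCell a i j) e)))"

lemma tot_SumTo:
  assumes D: "1 \<le> D" "1 \<le> W" "N \<le> D" and r: "reg s r = 0"
    and i: "\<And>k x. nval i (set_reg r k (set_arr a x s)) = ii" "nval i s = ii"
    and j: "\<And>k x. nval j (set_reg r k (set_arr a x s)) = jj" "nval j s = jj"
    and b: "\<And>k x. nval b (set_reg r k (set_arr a x s)) = N"
    and e: "\<And>k x. k < N \<Longrightarrow> rval e (set_reg r k (set_arr a x s)) = f k"
    and P: "P (set_cell a ii jj (\<Sum>k<N. f k) s)"
  shows "tot D W (SumTo a i j r b e) s P"
  unfolding SumTo_def
proof (intro tot_Seq tot_RAssign D, rule tot_For_exact[where F = "\<lambda>k. set_cell a ii jj (\<Sum>k'<k. f k') s", OF D])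
  fix k assume "k < N"
  then show "tot D W (RAssign a i j (RAdd (RCell a i j) e)) (set_reg r k (set_cell a ii jj (sum f {..<k}) s))
     (\<lambda>s'. s' = set_reg r k (set_cell a ii jj (sum f {..<Suc k}) s))"
    using i j e D by (intro tot_RAssign) (auto simp: set_cell_def)
qed (use r i j b P in \<open>auto simp: set_cell_def\<close>)

definition fill_vec :: "nat \<Rightarrow> (nat \<Rightarrow> real) \<Rightarrow> (nat \<Rightarrow> nat \<Rightarrow> real) \<Rightarrow> nat \<Rightarrow> nat \<Rightarrow> real" where
  "fill_vec N v f = f(0 := (\<lambda>j. if j < N then v j else f 0 j))"

lemma fill_vec_0 [simp]: "j < N \<Longrightarrow> fill_vec N v f 0 j = v j"
  by (simp add: fill_vec_def)

lemma tot_vec: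
  assumes D: "1 \<le> D" "1 \<le> W" "N \<le> D" and r: "reg s r = 0"
    and b: "\<And>k x. nval b (set_reg r k (set_arr a x s)) = N"
    and body: "\<And>k x. k < N \<Longrightarrow> x 0 k = arr s a 0 k \<Longrightarrow> tot D W c (set_reg r k (set_arr a x s))
      (\<lambda>s'. s' = set_reg r k (set_arr a (x(0 := (x 0)(k := v k))) s))"
    and P: "P (set_arr a (fill_vec N v (arr s a)) s)"
  shows "tot D W (For r b c) s P"
proof (rule tot_For_exact[where F = "\<lambda>k. set_arr a (fill_vec k v (arr s a)) s", OF D])
  show "set_arr a (fill_vec 0 v (arr s a)) s = s" by (simp add: fill_vec_def)
  fix k assume k: "k < N"
  have "(fill_vec k v (arr s a))(0 := (fill_vec k v (arr s a) 0)(k := v k)) = fill_vec (Suc k) v (arr s a)"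
    by (auto simp: fill_vec_def fun_eq_iff)
  then show "tot D W c (set_reg r k (set_arr a (fill_vec k v (arr s a)) s))
      (\<lambda>s'. s' = set_reg r k (set_arr a (fill_vec (Suc k) v (arr s a)) s))"
    using body[OF k, of "fill_vec k v (arr s a)"] by (simp add: fill_vec_def)
qed (use r b P in auto)

lemma tot_vec_assign:
  assumes D: "1 \<le> D" "1 \<le> W" "N \<le> D" and r: "reg s r = 0"
    and b: "\<And>k x. nval b (set_reg r k (set_arr a x s)) = N"
    and e: "\<And>k x. k < N \<Longrightarrow> x 0 k = arr s a 0 k \<Longrightarrow> rval e (set_reg r k (set_arr a x s)) = v k"
    and P: "P (set_arr a (fill_vec N v (arr s a)) s)"
  shows "tot D W (For r b (RAssign a NZero (NReg r) e)) s P"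
  using b P by (intro tot_vec[where v = v, OF D r] tot_RAssign D) (auto simp: set_cell_def e)

lemma tot_vec_sum:
  assumes D: "1 \<le> D" "1 \<le> W" "N \<le> D" "M \<le> D" and r: "reg s r = 0" "reg s r' = 0" "r \<noteq> r'"
    and b: "\<And>k x. nval b (set_reg r k (set_arr a x s)) = N"
    and b': "\<And>k k' x. nval b' (set_reg r' k' (set_reg r k (set_arr a x s))) = M"
    and e: "\<And>k k' x. k < N \<Longrightarrow> k' < M \<Longrightarrow>
       rval e (set_reg r' k' (set_reg r k (set_arr a x s))) = f k k'"
    and P: "P (set_arr a (fill_vec N (\<lambda>k. \<Sum>k'<M. f k k') (arr s a)) s)"
  shows "tot D W (For r b (SumTo a NZero (NReg r) r' b' e)) s P"
proof (rule tot_vec[where v = "\<lambda>k. \<Sum>k'<M. f k k'", OF D(1-3) r(1)])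
  fix k x assume k: "k < N"
  show "tot D W (SumTo a NZero (NReg r) r' b' e) (set_reg r k (set_arr a x s))
     (\<lambda>s'. s' = set_reg r k (set_arr a (x(0 := (x 0)(k := \<Sum>k'<M. f k k'))) s))"
    by (rule tot_SumTo[where f = "f k" and ii = 0 and jj = k, OF D(1,2,4)])
      (use r b' e k in \<open>auto simp: set_cell_def\<close>)
qed (use b P in auto)

definition fill_mat :: "nat \<Rightarrow> nat \<Rightarrow> (nat \<Rightarrow> nat \<Rightarrow> real) \<Rightarrow> (nat \<Rightarrow> nat \<Rightarrow> real) \<Rightarrow> nat \<Rightarrow> nat \<Rightarrow> real" where
  "fill_mat N M v f = (\<lambda>i j. if i < N \<and> j < M then v i j else f i j)"

lemma fill_mat_apply [simp]: "i < N \<Longrightarrow> j < M \<Longrightarrow> fill_mat N M v f i j = v i j"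
  by (simp add: fill_mat_def)

text \<open>While a matrix is overwritten in place, every entry has its old or its new value. This is all
  that is needed to read entries that the loop does not change, such as those of the row \<open>k0\<close> when
  the vertices of the simplex are moved.\<close>

lemma tot_mat_assign:
  assumes D: "1 \<le> D" "1 \<le> W" "N \<le> D" "M \<le> D" and r: "reg s r = 0" "reg s r' = 0" "r \<noteq> r'"
    and b: "\<And>k x. nval b (set_reg r k (set_arr a x s)) = N"
    and b': "\<And>k k' x. nval b' (set_reg r' k' (set_reg r k (set_arr a x s))) = M"
    and e: "\<And>k k' x. k < N \<Longrightarrow> k' < M \<Longrightarrow> x k k' = arr s a k k' \<Longrightarrow>
       (\<And>i j. x i j = arr s a i j \<or> i < N \<and> j < M \<and> x i j = v i j) \<Longrightarrow>
       rval e (set_reg r' k' (set_reg r k (set_arr a x s))) = v k k'"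
    and P: "P (set_arr a (fill_mat N M v (arr s a)) s)"
  shows "tot D W (For r b (For r' b' (RAssign a (NReg r) (NReg r') e))) s P"
proof (rule tot_For_exact[where F = "\<lambda>k. set_arr a (fill_mat k M v (arr s a)) s", OF D(1-3)])
  show "set_arr a (fill_mat 0 M v (arr s a)) s = s" by (simp add: fill_mat_def)
  fix k assume k: "k < N"
  define G where "G k' = (fill_mat k M v (arr s a))(k := (\<lambda>j. if j < k' then v k j else arr s a k j))" for k'
  show "tot D W (For r' b' (RAssign a (NReg r) (NReg r') e))
     (set_reg r k (set_arr a (fill_mat k M v (arr s a)) s))
     (\<lambda>s'. s' = set_reg r k (set_arr a (fill_mat (Suc k) M v (arr s a)) s))"
  proof (rule tot_For_exact[where F = "\<lambda>k'. set_reg r k (set_arr a (G k') s)", OF D(1,2,4)])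
    have "G 0 = fill_mat k M v (arr s a)" by (auto simp: G_def fill_mat_def fun_eq_iff)
    then show "set_reg r k (set_arr a (G 0) s) = set_reg r k (set_arr a (fill_mat k M v (arr s a)) s)" by simp
    have "G M = fill_mat (Suc k) M v (arr s a)" by (auto simp: G_def fill_mat_def fun_eq_iff less_Suc_eq)
    then show "set_reg r k (set_arr a (G M) s) = set_reg r k (set_arr a (fill_mat (Suc k) M v (arr s a)) s)" by simp
  next
    fix k' assume k': "k' < M"
    have "rval e (set_reg r' k' (set_reg r k (set_arr a (G k') s))) = v k k'"
      using k k' by (intro e) (auto simp: G_def fill_mat_def)
    moreover have "(G k')(k := (G k' k)(k' := v k k')) = G (Suc k')"
      by (auto simp: G_def fun_eq_iff)
    ultimately show "tot D W (RAssign a (NReg r) (NReg r') e) (set_reg r' k' (set_reg r k (set_arr a (G k') s)))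
        (\<lambda>s'. s' = set_reg r' k' (set_reg r k (set_arr a (G (Suc k')) s)))"
      using D r(3) by (intro tot_RAssign) (auto simp: set_cell_def)
  qed (use r b' in auto)
qed (use r b P in auto)

lemma tot_scalar_assign:
  assumes D: "1 \<le> D" "1 \<le> W" and P: "P (set_cell a 0 0 (rval e s) s)"
  shows "tot D W (RAssign a NZero NZero e) s P"
  using P by (intro tot_RAssign D) simp

lemma tot_scalar_sum:
  assumes D: "1 \<le> D" "1 \<le> W" "N \<le> D" and r: "reg s r = 0"
    and b: "\<And>k x. nval b (set_reg r k (set_arr a x s)) = N"
    and e: "\<And>k x. k < N \<Longrightarrow> rval e (set_reg r k (set_arr a x s)) = f k"
    and P: "P (set_cell a 0 0 (\<Sum>k<N. f k) s)"
  shows "tot D W (SumTo a NZero NZero r b e) s P"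
  by (rule tot_SumTo[where f = f and ii = 0 and jj = 0, OF D r]) (use b e P in auto)

lemma tot_argmin:
  assumes D: "1 \<le> D" "1 \<le> W" "N \<le> D" and N: "0 < N" and r: "reg s r = 0" "r \<noteq> r'"
    and b: "\<And>k k'. nval b (set_reg r k (set_reg r' k' s)) = N"
    and P: "\<And>k0. k0 < N \<Longrightarrow> (\<And>k. k < N \<Longrightarrow> arr s a 0 k0 \<le> arr s a 0 k) \<Longrightarrow> P (set_reg r' k0 s)"
  shows "tot D W (Seq (NAssign r' NZero) (For r b (Cond
      (RLess (RCell a NZero (NReg r)) (RCell a NZero (NReg r'))) (NAssign r' (NReg r)) Skip))) s P"
proof (intro tot_Seq tot_NAssign D, rule tot_For[where I = "\<lambda>k s'. \<exists>k0. s' = set_reg r' k0 s \<and> k0 < N \<and>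
    (\<forall>i<k. arr s a 0 k0 \<le> arr s a 0 i)", OF D])
  fix k s'
  assume k: "k < N" and "\<exists>k0. s' = set_reg r' k0 s \<and> k0 < N \<and> (\<forall>i<k. arr s a 0 k0 \<le> arr s a 0 i)"
  then obtain k0 where k0: "s' = set_reg r' k0 s" "k0 < N" "\<And>i. i < k \<Longrightarrow> arr s a 0 k0 \<le> arr s a 0 i" by blast
  have commute: "set_reg r 0 (set_reg r' j (set_reg r k (set_reg r' k0 s))) = set_reg r' j s" for j
    using r by (metis set_reg_commute set_reg_same state_update(3))
  have keep: "set_reg r 0 (set_reg r k (set_reg r' k0 s)) = set_reg r' k0 s"
    using r by (metis set_reg_commute set_reg_same state_update(3))
  show "tot D W (Cond (RLess (RCell a NZero (NReg r)) (RCell a NZero (NReg r'))) (NAssign r' (NReg r)) Skip)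
      (set_reg r k s') (\<lambda>s'. reg s' r = k \<and> (\<exists>k0. set_reg r 0 s' = set_reg r' k0 s \<and> k0 < N \<and>
        (\<forall>i<Suc k. arr s a 0 k0 \<le> arr s a 0 i)))"
  proof (intro tot_Cond tot_NAssign tot_Skip D conjI)
    assume "tval (RLess (RCell a NZero (NReg r)) (RCell a NZero (NReg r'))) (set_reg r k s')"
    then have "arr s a 0 k < arr s a 0 k0" using r by (simp add: k0(1))
    then have "\<forall>i<Suc k. arr s a 0 k \<le> arr s a 0 i"
      using k0(3) by (fastforce simp: less_Suc_eq)
    moreover have "nval (NReg r) (set_reg r k s') = k" by simp
    ultimately show "\<exists>k0. set_reg r 0 (set_reg r' (nval (NReg r) (set_reg r k s')) (set_reg r k s')) =
        set_reg r' k0 s \<and> k0 < N \<and> (\<forall>i<Suc k. arr s a 0 k0 \<le> arr s a 0 i)"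
      using k commute[of k] unfolding k0(1) by auto
  next
    assume "\<not> tval (RLess (RCell a NZero (NReg r)) (RCell a NZero (NReg r'))) (set_reg r k s')"
    then have "arr s a 0 k0 \<le> arr s a 0 k" using r by (simp add: k0(1))
    then have "\<forall>i<Suc k. arr s a 0 k0 \<le> arr s a 0 i" using k0(3) by (auto simp: less_Suc_eq)
    then show "\<exists>k0. set_reg r 0 (set_reg r k s') = set_reg r' k0 s \<and> k0 < N \<and>
        (\<forall>i<Suc k. arr s a 0 k0 \<le> arr s a 0 i)"
      using k0(2) keep unfolding k0(1) by blast
  qed (use r in \<open>auto simp: k0(1)\<close>)
qed (use r b N P in \<open>auto\<close>)

fun rnum :: "nat \<Rightarrow> rexp" where
  "rnum 0 = RZero"
| "rnum (Suc k) = RAdd ROne (rnum k)"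

lemma rval_rnum [simp]: "rval (rnum k) s = real k"
  by (induction k) auto

section \<open>The program\<close>

text \<open>The arrays of the program. The arrays \<open>aA\<close>, \<open>aB\<close>, \<open>aIn\<close> are the input, \<open>aRes\<close> is the output; \<open>aQ\<close> and \<open>aC\<close>
hold the projection and the special solution, \<open>aV\<close> the vertices of the simplex. Vectors occupy the
row \<open>0\<close> of an array: the centroid in \<open>aZ\<close>, the feasible point that belongs to it in \<open>aX\<close>, the
subgradient before and after projection in \<open>aG\<close> and \<open>aW\<close>, its values at the vertices in \<open>aH\<close>, the
projected column in \<open>aU\<close>. The others hold a single number: \<open>aN\<close> the number of vertices \<open>l + 1\<close>, \<open>aq\<close> the
exponent, \<open>aY\<close> the guaranteed growth, \<open>aTarget\<close> the growth at which the search ends.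

The register \<open>4\<close> runs through the rows of \<open>A\<close>, \<open>5\<close> through the columns of \<open>B\<close>; \<open>6\<close> and \<open>7\<close> are inner
counters, and \<open>8\<close> holds the index of the vertex \<open>k0\<close>.\<close>

abbreviation (input) aA :: nat where "aA \<equiv> 0"
abbreviation (input) aB :: nat where "aB \<equiv> 1"
abbreviation (input) aIn :: nat where "aIn \<equiv> 2"
abbreviation (input) aRes :: nat where "aRes \<equiv> 3"
abbreviation (input) aQ :: nat where "aQ \<equiv> 4"
abbreviation (input) aC :: nat where "aC \<equiv> 5"
abbreviation (input) aV :: nat where "aV \<equiv> 6"
abbreviation (input) aZ :: nat where "aZ \<equiv> 7"
abbreviation (input) aX :: nat where "aX \<equiv> 8"
abbreviation (input) aG :: nat where "aG \<equiv> 9"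
abbreviation (input) aW :: nat where "aW \<equiv> 10"
abbreviation (input) aH :: nat where "aH \<equiv> 11"
abbreviation (input) aU :: nat where "aU \<equiv> 12"
abbreviation (input) aUU :: nat where "aUU \<equiv> 13"
abbreviation (input) aCB :: nat where "aCB \<equiv> 14"
abbreviation (input) aN :: nat where "aN \<equiv> 15"
abbreviation (input) aq :: nat where "aq \<equiv> 16"
abbreviation (input) aF :: nat where "aF \<equiv> 17"
abbreviation (input) aBest :: nat where "aBest \<equiv> 18"
abbreviation (input) aY :: nat where "aY \<equiv> 19"
abbreviation (input) aTarget :: nat where "aTarget \<equiv> 20"

abbreviation (input) Sc :: "nat \<Rightarrow> rexp" where "Sc a \<equiv> RCell a NZero NZero"
abbreviation (input) Vc :: "nat \<Rightarrow> nat \<Rightarrow> rexp" where "Vc a r \<equiv> RCell a NZero (NReg r)"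
abbreviation (input) Mt :: "nat \<Rightarrow> nat \<Rightarrow> nat \<Rightarrow> rexp" where "Mt a r r' \<equiv> RCell a (NReg r) (NReg r')"
abbreviation (input) rl :: nexp where "rl \<equiv> NReg 0"
abbreviation (input) rl1 :: nexp where "rl1 \<equiv> NSuc (NReg 0)"

abbreviation Seq_infix :: "com \<Rightarrow> com \<Rightarrow> com" (infixr ";;" 60) where "c ;; d \<equiv> Seq c d"

definition norm_com :: "nat \<Rightarrow> com" where
  "norm_com a =
     SumTo aF NZero NZero 6 rl (RPow (Vc a 6) (Sc aq)) ;;
     RAssign aF NZero NZero (RPow (Sc aF) (RDiv ROne (Sc aq)))"

definition select_com :: com where
  "select_com = NAssign 8 NZero ;; For 6 rl1 (Cond (RLess (Vc aH 6) (Vc aH 8)) (NAssign 8 (NReg 6)) Skip)"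

definition move_com :: com where
  "move_com =
     For 6 rl1 (For 7 rl (RAssign aV (NReg 6) (NReg 7)
       (RAdd (Mt aV 8 7) (RDiv (RSub (Mt aV 6 7) (Mt aV 8 7))
         (RAdd ROne (RMul (RDiv ROne (RMul (rnum 4) (RMul (Sc aN) (Sc aN))))
           (RDiv (Vc aH 6) (RSub RZero (Vc aH 8)))))))))"

definition grow_com :: com where
  "grow_com = RAssign aY NZero NZero (RMul (Sc aY)
       (RAdd ROne (RDiv ROne (RMul (rnum 8) (RMul (Sc aN) (Sc aN))))))"

definition iterate_com :: com where
  "iterate_com =
     For 6 rl (SumTo aZ NZero (NReg 6) 7 rl1 (RDiv (Mt aV 7 6) (Sc aN))) ;;
     For 6 rl (SumTo aX NZero (NReg 6) 7 rl (RMul (Mt aQ 6 7) (Vc aZ 7))) ;;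
     For 6 rl (RAssign aX NZero (NReg 6) (RAdd (Vc aC 6) (Vc aX 6))) ;;
     norm_com aX ;;
     Cond (RLess (Sc aF) (Sc aBest)) (RAssign aBest NZero NZero (Sc aF)) Skip ;;
     For 6 rl (RAssign aG NZero (NReg 6) (RMul (Vc aX 6) (RPow (Vc aX 6) (RSub (Sc aq) (rnum 2))))) ;;
     For 6 rl (SumTo aW NZero (NReg 6) 7 rl (RMul (Mt aQ 6 7) (Vc aG 7))) ;;
     For 6 rl1 (SumTo aH NZero (NReg 6) 7 rl (RMul (Vc aW 7) (RSub (Mt aV 6 7) (Vc aZ 7)))) ;;
     select_com ;;
     move_com ;;
     NAssign 8 NZero ;;
     grow_com"

definition column_com :: com where
  "column_com =
       For 6 rl (SumTo aU NZero (NReg 6) 7 rl (RMul (Mt aQ 6 7) (Mt aB 7 5))) ;;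
       SumTo aUU NZero NZero 6 rl (RMul (Vc aU 6) (Vc aU 6)) ;;
       SumTo aCB NZero NZero 6 rl (RMul (Vc aC 6) (Mt aB 6 5)) ;;
       For 6 rl (RAssign aC NZero (NReg 6) (RAdd (Vc aC 6)
         (RMul (RDiv (RSub (Mt aA 4 5) (Sc aCB)) (Sc aUU)) (Vc aU 6)))) ;;
       For 6 rl (For 7 rl (RAssign aQ (NReg 6) (NReg 7)
         (RSub (Mt aQ 6 7) (RDiv (RMul (Vc aU 6) (Vc aU 7)) (Sc aUU)))))"

definition project_com :: com where
  "project_com =
     For 6 rl (For 7 rl (RAssign aQ (NReg 6) (NReg 7) RZero)) ;;
     For 6 rl (RAssign aQ (NReg 6) (NReg 6) ROne) ;;
     For 6 rl (RAssign aC NZero (NReg 6) RZero) ;;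
     For 5 (NReg 2) column_com"

definition check_com :: com where
  "check_com =
     For 5 (NReg 2) (
       SumTo aCB NZero NZero 6 rl (RMul (Vc aC 6) (Mt aB 6 5)) ;;
       Cond (RLess (Sc aCB) (Mt aA 4 5)) (NAssign 3 (NSuc NZero))
         (Cond (RLess (Mt aA 4 5) (Sc aCB)) (NAssign 3 (NSuc NZero)) Skip))"

definition start_com :: com where
  "start_com =
     norm_com aC ;;
     RAssign aBest NZero NZero (Sc aF) ;;
     For 6 rl1 (For 7 rl (RAssign aV (NReg 6) (NReg 7) (RSub RZero (RMul (rnum 2) (Sc aBest))))) ;;
     For 6 rl (RAssign aV (NSuc (NReg 6)) (NReg 6)
       (RSub (RMul (RMul (rnum 4) (RSub (Sc aN) ROne)) (RMul (rnum 2) (Sc aBest))) (RMul (rnum 2) (Sc aBest)))) ;;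
     RAssign aY NZero NZero ROne"

definition search_com :: com where
  "search_com = While (RLess (Sc aY) (Sc aTarget)) iterate_com"

definition record_com :: com where
  "record_com = Cond (RLess (Sc aRes) (Sc aBest)) (RAssign aRes NZero NZero (Sc aBest)) Skip"

definition row_com :: com where
  "row_com =
     project_com ;; check_com ;; start_com ;;
     search_com ;;
     record_com"

definition main_com :: "rexp \<Rightarrow> com" where
  "main_com e =
     SumTo aN NZero NZero 6 rl1 ROne ;;
     RAssign aq NZero NZero e ;;
     RAssign aTarget NZero NZero
       (RMul (rnum 4) (RPow (RDiv (Sc aN) (RDiv (RDiv (RCell aIn NZero (NSuc NZero)) (rnum 4))
          (RMul (rnum 11) (RMul (Sc aN) (RMul (Sc aN) (Sc aN)))))) (Sc aN))) ;;
     For 4 (NReg 1) row_com"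

section \<open>Correctness of the program\<close>

text \<open>The arrays that may have changed are listed; registers are described by equations.\<close>

definition frame :: "nat set \<Rightarrow> state \<Rightarrow> state \<Rightarrow> bool" where
  "frame S s s' \<longleftrightarrow> (\<forall>a. a \<notin> S \<longrightarrow> arr s' a = arr s a)"

lemma tot_Seq_exact:
  assumes "tot D W c s (\<lambda>s'. s' = s1)" "tot D W d s1 P"
  shows "tot D W (c ;; d) s P"
  using assms by (intro tot_Seq) (auto elim: tot_weaken)

lemma set_cell_access [simp]:
  "reg (set_cell a i j x s) = reg s"
  "arr (set_cell a i j x s) = (arr s)(a := (arr s a)(i := (arr s a i)(j := x)))"
  by (simp_all add: set_cell_def)

text \<open>The program may apply \<open>powr\<close> to negative entries, because \<open>ln\<close> is an even function.\<close>

lemma powr_abs: "\<bar>x\<bar> powr y = x powr y" for x y :: real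
  by (cases "0 \<le> x") (auto simp: powr_def abs_if ln_minus)

lemma tot_norm:
  assumes D: "1 \<le> D" "1 \<le> W" "l \<le> D" and s: "reg s 0 = l" "reg s 6 = 0" "a \<noteq> aF"
    and P: "P (set_cell aF 0 0 (pn (ereal (arr s aq 0 0)) l (arr s a 0)) s)"
  shows "tot D W (norm_com a) s P"
  unfolding norm_com_def
proof (intro tot_Seq)
  let ?S = "\<Sum>r<l. arr s a 0 r powr arr s aq 0 0"
  show "tot D W (SumTo aF NZero NZero 6 rl (RPow (Vc a 6) (Sc aq))) s
     (\<lambda>s'. tot D W (RAssign aF NZero NZero (RPow (Sc aF) (RDiv ROne (Sc aq)))) s' P)"
  proof (rule tot_scalar_sum[where f = "\<lambda>r. arr s a 0 r powr arr s aq 0 0", OF D s(2)])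
    show "tot D W (RAssign aF NZero NZero (RPow (Sc aF) (RDiv ROne (Sc aq)))) (set_cell aF 0 0 ?S s) P"
      using P by (intro tot_scalar_assign D) (simp add: pn_real powr_abs set_cell_def)
  qed (use s in auto)
qed

text \<open>One step of the search, in the form of the assumptions of \<open>cut_invariant_step\<close>.\<close>

lemma tot_iterate:
  fixes s :: state and l :: nat and q :: real
  assumes D: "1 \<le> D" "Suc l \<le> D"
    and s: "reg s 0 = l" "reg s 6 = 0" "reg s 7 = 0" "reg s 8 = 0"
      "arr s aN 0 0 = real (Suc l)" "arr s aq 0 0 = q"
  defines "V \<equiv> arr s aV" and "Q \<equiv> arr s aQ"
  defines "v \<equiv> \<lambda>r. \<Sum>k<Suc l. V k r / real (Suc l)"
  defines "x \<equiv> \<lambda>r. arr s aC 0 r + app l Q v r"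
  defines "w \<equiv> app l Q (\<lambda>r. x r * \<bar>x r\<bar> powr (q - 2))"
  defines "h \<equiv> \<lambda>k. inner_prod l w (\<lambda>r. V k r - v r)"
  assumes P: "\<And>s' k0. reg s' = reg s \<Longrightarrow> frame {aV, aZ, aX, aG, aW, aH, aF, aBest, aY} s s' \<Longrightarrow>
      k0 < Suc l \<Longrightarrow> (\<And>k. k < Suc l \<Longrightarrow> h k0 \<le> h k) \<Longrightarrow>
      (\<And>k r. k < Suc l \<Longrightarrow> r < l \<Longrightarrow> arr s' aV k r =
         V k0 r + (V k r - V k0 r) / (1 + 1 / (4 * (real (Suc l))\<^sup>2) * (h k / - h k0))) \<Longrightarrow>
      arr s' aBest 0 0 = min (arr s aBest 0 0) (pn (ereal q) l x) \<Longrightarrow>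
      arr s' aY 0 0 = arr s aY 0 0 * (1 + 1 / (8 * (real (Suc l))\<^sup>2)) \<Longrightarrow> P s'"
  shows "tot D 1 iterate_com s P"
proof -
  have D': "1 \<le> D" "1 \<le> (1::nat)" "l \<le> D" using D by auto
  define s1 where "s1 = set_arr aZ (fill_vec l v (arr s aZ)) s"
  define s2 where "s2 = set_arr aX (fill_vec l (app l Q v) (arr s aX)) s1"
  define s3 where "s3 = set_arr aX (fill_vec l x (arr s2 aX)) s2"
  define s4 where "s4 = set_cell aF 0 0 (pn (ereal q) l x) s3"
  define s5 where "s5 = set_cell aBest 0 0 (min (arr s aBest 0 0) (pn (ereal q) l x)) s4"
  define s6 where "s6 = set_arr aG (fill_vec l (\<lambda>r. x r * \<bar>x r\<bar> powr (q - 2)) (arr s5 aG)) s5"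
  define s7 where "s7 = set_arr aW (fill_vec l w (arr s6 aW)) s6"
  define s8 where "s8 = set_arr aH (fill_vec (Suc l) h (arr s7 aH)) s7"
  note defs = s1_def s2_def s3_def s4_def s5_def s6_def s7_def s8_def
  have 1: "tot D 1 (For 6 rl (SumTo aZ NZero (NReg 6) 7 rl1 (RDiv (Mt aV 7 6) (Sc aN)))) s (\<lambda>s'. s' = s1)"
    by (rule tot_vec_sum[where N = l and M = "Suc l" and f = "\<lambda>r k. V k r / real (Suc l)"])
      (use D' D(2) s in \<open>simp_all add: s1_def v_def V_def del: sum.lessThan_Suc\<close>)
  have 2: "tot D 1 (For 6 rl (SumTo aX NZero (NReg 6) 7 rl (RMul (Mt aQ 6 7) (Vc aZ 7)))) s1 (\<lambda>s'. s' = s2)"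
    by (rule tot_vec_sum[where N = l and M = l and f = "\<lambda>r k. Q r k * v k"])
      (use D' s in \<open>simp_all add: s1_def s2_def app_def[abs_def] Q_def\<close>)
  have 3: "tot D 1 (For 6 rl (RAssign aX NZero (NReg 6) (RAdd (Vc aC 6) (Vc aX 6)))) s2 (\<lambda>s'. s' = s3)"
    by (rule tot_vec_assign[where N = l and v = x])
      (use D' s in \<open>simp_all add: s1_def s2_def s3_def x_def\<close>)
  have x3: "pn (ereal q) l (arr s3 aX 0) = pn (ereal q) l x"
    by (rule pn_cong) (simp add: s3_def)
  have 4: "tot D 1 (norm_com aX) s3 (\<lambda>s'. s' = s4)"
    by (rule tot_norm[where l = l]) (use D' s x3 in \<open>simp_all add: s4_def\<close>, simp_all add: s1_def s2_def s3_def)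
  have 5: "tot D 1 (Cond (RLess (Sc aF) (Sc aBest)) (RAssign aBest NZero NZero (Sc aF)) Skip) s4 (\<lambda>s'. s' = s5)"
  proof (intro tot_Cond tot_RAssign tot_Skip D'(1,2))
    assume "tval (RLess (Sc aF) (Sc aBest)) s4"
    then show "set_cell aBest (nval NZero s4) (nval NZero s4) (rval (Sc aF) s4) s4 = s5"
      by (simp add: s1_def s2_def s3_def s4_def s5_def)
  next
    assume "\<not> tval (RLess (Sc aF) (Sc aBest)) s4"
    then have "min (arr s aBest 0 0) (pn (ereal q) l x) = arr s4 aBest 0 0"
      by (simp add: s1_def s2_def s3_def s4_def)
    then show "s4 = s5" unfolding s5_def by (simp add: set_cell_def)
  qed
  have 6: "tot D 1 (For 6 rl (RAssign aG NZero (NReg 6)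
      (RMul (Vc aX 6) (RPow (Vc aX 6) (RSub (Sc aq) (rnum 2)))))) s5 (\<lambda>s'. s' = s6)"
    by (rule tot_vec_assign[where N = l and v = "\<lambda>r. x r * \<bar>x r\<bar> powr (q - 2)"])
      (use D' s in \<open>simp_all add: s1_def s2_def s3_def s4_def s5_def s6_def powr_abs\<close>)
  have 7: "tot D 1 (For 6 rl (SumTo aW NZero (NReg 6) 7 rl (RMul (Mt aQ 6 7) (Vc aG 7)))) s6 (\<lambda>s'. s' = s7)"
    by (rule tot_vec_sum[where N = l and M = l and f = "\<lambda>r k. Q r k * (x k * \<bar>x k\<bar> powr (q - 2))"])
      (use D' s in \<open>simp_all add: s1_def s2_def s3_def s4_def s5_def s6_def s7_def w_def app_def[abs_def] Q_def\<close>)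
  have 8: "tot D 1 (For 6 rl1 (SumTo aH NZero (NReg 6) 7 rl (RMul (Vc aW 7) (RSub (Mt aV 6 7) (Vc aZ 7)))))
      s7 (\<lambda>s'. s' = s8)"
    by (rule tot_vec_sum[where N = "Suc l" and M = l and f = "\<lambda>k r. w r * (V k r - v r)"])
      (use D' D(2) s in \<open>simp_all add: s1_def s2_def s3_def s4_def s5_def s6_def s7_def s8_def h_def inner_prod_def V_def\<close>)
  have reg8: "reg s8 = reg s" by (simp add: defs)
  have arr8: "arr s8 aV = V" "arr s8 aN 0 0 = real (Suc l)" "arr s8 aY = arr s aY"
    "\<And>k. k < Suc l \<Longrightarrow> arr s8 aH 0 k = h k"
    "arr s8 aBest 0 0 = min (arr s aBest 0 0) (pn (ereal q) l x)"
    using s by (simp_all add: defs V_def)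
  have frame8: "frame {aV, aZ, aX, aG, aW, aH, aF, aBest, aY} s s8"
    by (simp add: frame_def defs)
  show ?thesis
    unfolding iterate_com_def
  proof (rule tot_Seq_exact[OF 1] tot_Seq_exact[OF 2] tot_Seq_exact[OF 3] tot_Seq_exact[OF 4]
      tot_Seq_exact[OF 5] tot_Seq_exact[OF 6] tot_Seq_exact[OF 7] tot_Seq_exact[OF 8])+
    show "tot D 1 (select_com ;;
     move_com ;;
     NAssign 8 NZero ;; grow_com) s8 P"
    proof (rule tot_Seq, unfold select_com_def, rule tot_argmin[where N = "Suc l"])
      fix k0 assume k0: "k0 < Suc l" "\<And>k. k < Suc l \<Longrightarrow> arr s8 aH 0 k0 \<le> arr s8 aH 0 k"
      define V' where "V' k r = V k0 r + (V k r - V k0 r) / (1 + 1 / (4 * (real (Suc l))\<^sup>2) * (h k / - h k0))" for k r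
      define s9 where "s9 = set_reg 8 k0 s8"
      define s10 where "s10 = set_arr aV (fill_mat (Suc l) l V' V) s9"
      have V'k0: "V' k0 r = V k0 r" for r by (simp add: V'_def)
      have 9: "tot D 1 move_com s9 (\<lambda>s'. s' = s10)"
        unfolding move_com_def
      proof (rule tot_mat_assign[where N = "Suc l" and M = l and v = V'])
        fix k r y
        assume kr: "k < Suc l" "r < l" and ykr: "y k r = arr s9 aV k r"
          and y: "\<And>i j. y i j = arr s9 aV i j \<or> i < Suc l \<and> j < l \<and> y i j = V' i j"
        have "y k0 r = V k0 r" using y[of k0 r] by (auto simp: V'k0 s9_def arr8)
        then show "rval (RAdd (Mt aV 8 7) (RDiv (RSub (Mt aV 6 7) (Mt aV 8 7))
         (RAdd ROne (RMul (RDiv ROne (RMul (rnum 4) (RMul (Sc aN) (Sc aN))))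
           (RDiv (Vc aH 6) (RSub RZero (Vc aH 8)))))))
           (set_reg 7 r (set_reg 6 k (set_arr aV y s9))) = V' k r"
          using kr k0 ykr by (simp add: s9_def arr8 V'_def power2_eq_square del: of_nat_Suc)
      qed (use D' D(2) s in \<open>simp_all add: s9_def s10_def reg8 arr8\<close>)
      show "tot D 1 (move_com ;;
         NAssign 8 NZero ;; grow_com) (set_reg 8 k0 s8) P"
        unfolding s9_def[symmetric]
      proof (rule tot_Seq_exact[OF 9], unfold grow_com_def, intro tot_Seq tot_NAssign tot_RAssign D'(1,2), rule P[of _ k0])
        let ?s = "set_reg 8 (nval NZero s10) s10"
        let ?t = "set_cell aY (nval NZero ?s) (nval NZero ?s) (rval (RMul (Sc aY)
         (RAdd ROne (RDiv ROne (RMul (rnum 8) (RMul (Sc aN) (Sc aN)))))) ?s) ?s"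
        show "reg ?t = reg s" using s by (auto simp: s10_def s9_def reg8)
        show "frame {aV, aZ, aX, aG, aW, aH, aF, aBest, aY} s ?t"
          using frame8 by (auto simp: frame_def s10_def s9_def)
        show "k0 < Suc l" by (rule k0)
        show "h k0 \<le> h k" if "k < Suc l" for k using k0 that by (simp add: arr8)
        show "arr ?t aV k r = V k0 r + (V k r - V k0 r) / (1 + 1 / (4 * (real (Suc l))\<^sup>2) * (h k / - h k0))"
          if "k < Suc l" "r < l" for k r
          using that by (simp add: s10_def s9_def V'_def)
        show "arr ?t aBest 0 0 = min (arr s aBest 0 0) (pn (ereal q) l x)"
          by (simp add: s10_def s9_def arr8)
        show "arr ?t aY 0 0 = arr s aY 0 0 * (1 + 1 / (8 * (real (Suc l))\<^sup>2))"
          by (simp add: s10_def s9_def arr8 power2_eq_square)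
      qed
    qed (use D' D(2) s in \<open>simp_all add: reg8\<close>)
  qed
qed

lemma tot_column:
  fixes s :: state and l j :: nat
  assumes D: "1 \<le> D" "1 \<le> W" "l \<le> D"
    and s: "reg s 0 = l" "reg s 5 = j" "reg s 6 = 0" "reg s 7 = 0"
  defines "B \<equiv> arr s aB" and "a \<equiv> arr s aA (reg s 4)"
  assumes proj: "projects l j B (arr s aQ)" and sol: "solves l j B a (arr s aQ) (arr s aC 0)"
    and P: "\<And>s'. reg s' = reg s \<Longrightarrow> frame {aQ, aC, aU, aUU, aCB} s s' \<Longrightarrow>
      projects l (Suc j) B (arr s' aQ) \<Longrightarrow> solves l (Suc j) B a (arr s' aQ) (arr s' aC 0) \<Longrightarrow> P s'"
  shows "tot D W column_com s P"
proof -
  define Q where "Q = arr s aQ"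
  define c where "c = arr s aC 0"
  define b where "b = (\<lambda>r. B r j)"
  define u where "u = app l Q b"
  define c' where "c' = (\<lambda>r. c r + (a j - inner_prod l c b) / inner_prod l u u * u r)"
  define Q' where "Q' = (\<lambda>r k. Q r k - u r * u k / inner_prod l u u)"
  define s1 where "s1 = set_arr aU (fill_vec l u (arr s aU)) s"
  define s2 where "s2 = set_cell aUU 0 0 (inner_prod l u u) s1"
  define s3 where "s3 = set_cell aCB 0 0 (inner_prod l c b) s2"
  define s4 where "s4 = set_arr aC (fill_vec l c' (arr s3 aC)) s3"
  define s5 where "s5 = set_arr aQ (fill_mat l l Q' (arr s4 aQ)) s4"
  have 1: "tot D W (For 6 rl (SumTo aU NZero (NReg 6) 7 rl (RMul (Mt aQ 6 7) (Mt aB 7 5)))) s (\<lambda>s'. s' = s1)"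
    by (rule tot_vec_sum[where N = l and M = l and f = "\<lambda>r k. Q r k * b k"])
      (use D s in \<open>simp_all add: s1_def app_def[abs_def] u_def Q_def b_def B_def\<close>)
  have 2: "tot D W (SumTo aUU NZero NZero 6 rl (RMul (Vc aU 6) (Vc aU 6))) s1 (\<lambda>s'. s' = s2)"
    by (rule tot_scalar_sum[where N = l and f = "\<lambda>r. u r * u r"])
      (use D s in \<open>simp_all add: s1_def s2_def inner_prod_def\<close>)
  have 3: "tot D W (SumTo aCB NZero NZero 6 rl (RMul (Vc aC 6) (Mt aB 6 5))) s2 (\<lambda>s'. s' = s3)"
    by (rule tot_scalar_sum[where N = l and f = "\<lambda>r. c r * b r"])
      (use D s in \<open>simp_all add: s1_def s2_def s3_def inner_prod_def c_def b_def B_def\<close>)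
  have 4: "tot D W (For 6 rl (RAssign aC NZero (NReg 6) (RAdd (Vc aC 6)
         (RMul (RDiv (RSub (Mt aA 4 5) (Sc aCB)) (Sc aUU)) (Vc aU 6))))) s3 (\<lambda>s'. s' = s4)"
    by (rule tot_vec_assign[where N = l and v = c'])
      (use D s in \<open>simp_all add: s1_def s2_def s3_def s4_def c'_def c_def a_def\<close>)
  have 5: "tot D W (For 6 rl (For 7 rl (RAssign aQ (NReg 6) (NReg 7)
         (RSub (Mt aQ 6 7) (RDiv (RMul (Vc aU 6) (Vc aU 7)) (Sc aUU)))))) s4 (\<lambda>s'. s' = s5)"
    by (rule tot_mat_assign[where N = l and M = l and v = Q'])
      (use D s in \<open>simp_all add: s1_def s2_def s3_def s4_def s5_def Q'_def Q_def\<close>)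
  note defs = s1_def s2_def s3_def s4_def s5_def
  have Q5: "arr s5 aQ r k = Q r k - u r * u k / inner_prod l u u" if "r < l" "k < l" for r k
    using that by (simp add: s5_def Q'_def)
  have c5: "arr s5 aC 0 r = c r + (a j - inner_prod l c b) / inner_prod l u u * u r" if "r < l" for r
    using that by (simp add: s5_def s4_def c'_def)
  have u: "u r = app l Q (\<lambda>s. B s j) r" for r by (simp add: u_def b_def)
  show ?thesis
    unfolding column_com_def
  proof (rule tot_Seq_exact[OF 1], rule tot_Seq_exact[OF 2], rule tot_Seq_exact[OF 3],
      rule tot_Seq_exact[OF 4], rule tot_weaken[OF 5])
    fix s' assume s': "s' = s5"
    show "P s'" unfolding s'
    proof (rule P)
      show "reg s5 = reg s" by (simp add: defs)
      show "frame {aQ, aC, aU, aUU, aCB} s s5" by (simp add: frame_def defs)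
      show "projects l (Suc j) B (arr s5 aQ)"
        by (rule projects_step[OF proj[folded Q_def] u Q5])
      show "solves l (Suc j) B a (arr s5 aQ) (arr s5 aC 0)"
        by (rule solves_step[OF proj[folded Q_def] sol[folded Q_def c_def] u Q5 c5[unfolded b_def]])
    qed
  qed
qed

lemma tot_project:
  fixes s :: state and l n :: nat
  assumes D: "1 \<le> D" "1 \<le> W" "l \<le> D" "n \<le> D"
    and s: "reg s 0 = l" "reg s 2 = n" "reg s 5 = 0" "reg s 6 = 0" "reg s 7 = 0"
  defines "B \<equiv> arr s aB" and "a \<equiv> arr s aA (reg s 4)"
  assumes P: "\<And>s'. reg s' = reg s \<Longrightarrow> frame {aQ, aC, aU, aUU, aCB} s s' \<Longrightarrow>
      projects l n B (arr s' aQ) \<Longrightarrow> solves l n B a (arr s' aQ) (arr s' aC 0) \<Longrightarrow> P s'"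
  shows "tot D W project_com s P"
proof -
  define s1 where "s1 = set_arr aQ (fill_mat l l (\<lambda>_ _. 0) (arr s aQ)) s"
  define F where "F k = set_arr aQ (\<lambda>i j. if i = j \<and> i < k then 1 else arr s1 aQ i j) s1" for k
  define s3 where "s3 = set_arr aC (fill_vec l (\<lambda>_. 0) (arr (F l) aC)) (F l)"
  have 1: "tot D W (For 6 rl (For 7 rl (RAssign aQ (NReg 6) (NReg 7) RZero))) s (\<lambda>s'. s' = s1)"
    by (rule tot_mat_assign[where N = l and M = l and v = "\<lambda>_ _. 0"])
      (use D s in \<open>simp_all add: s1_def\<close>)
  have 2: "tot D W (For 6 rl (RAssign aQ (NReg 6) (NReg 6) ROne)) s1 (\<lambda>s'. s' = F l)"
  proof (rule tot_For_exact[where F = F, OF D(1-3)])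
    fix k assume "k < l"
    show "tot D W (RAssign aQ (NReg 6) (NReg 6) ROne) (set_reg 6 k (F k)) (\<lambda>s'. s' = set_reg 6 k (F (Suc k)))"
    proof (intro tot_RAssign D(1,2))
      have "(arr (F k) aQ)(k := (arr (F k) aQ k)(k := 1)) = arr (F (Suc k)) aQ"
        by (auto simp: F_def fun_eq_iff less_Suc_eq)
      then show "set_cell aQ (nval (NReg 6) (set_reg 6 k (F k))) (nval (NReg 6) (set_reg 6 k (F k)))
          (rval ROne (set_reg 6 k (F k))) (set_reg 6 k (F k)) = set_reg 6 k (F (Suc k))"
        by (simp add: set_cell_def) (simp add: F_def)
    qed
  qed (use s in \<open>simp_all add: F_def s1_def\<close>)
  have 3: "tot D W (For 6 rl (RAssign aC NZero (NReg 6) RZero)) (F l) (\<lambda>s'. s' = s3)"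
    by (rule tot_vec_assign[where N = l and v = "\<lambda>_. 0"])
      (use D s in \<open>simp_all add: s1_def F_def s3_def\<close>)
  have Q3: "arr s3 aQ r k = (if r = k then 1 else 0)" if "r < l" "k < l" for r k
    using that by (simp add: s3_def F_def s1_def)
  have P0: "projects l 0 B (arr s3 aQ)" by (rule projects_0[OF Q3])
  have S0: "solves l 0 B a (arr s3 aQ) (arr s3 aC 0)"
    unfolding solves_def feasible_def by (simp add: app_def s3_def)
  have fr3: "frame {aQ, aC, aU, aUU, aCB} s s3" "reg s3 = reg s"
    by (simp_all add: frame_def s3_def F_def s1_def)
  show ?thesis unfolding project_com_def
  proof (rule tot_Seq_exact[OF 1], rule tot_Seq_exact[OF 2], rule tot_Seq_exact[OF 3],
      rule tot_For[where I = "\<lambda>j s'. reg s' = reg s \<and> frame {aQ, aC, aU, aUU, aCB} s s' \<and>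
        projects l j B (arr s' aQ) \<and> solves l j B a (arr s' aQ) (arr s' aC 0)", OF D(1,2,4)])
    fix j s' assume j: "j < n" and I: "reg s' = reg s \<and> frame {aQ, aC, aU, aUU, aCB} s s' \<and>
        projects l j B (arr s' aQ) \<and> solves l j B a (arr s' aQ) (arr s' aC 0)"
    have AB: "arr s' aB = B" "arr s' aA = arr s aA" using I by (simp_all add: frame_def B_def)
    let ?s = "set_reg 5 j s'"
    show "tot D W column_com ?s
       (\<lambda>s''. reg s'' 5 = j \<and> reg (set_reg 5 0 s'') = reg s \<and> frame {aQ, aC, aU, aUU, aCB} s (set_reg 5 0 s'') \<and>
        projects l (Suc j) B (arr (set_reg 5 0 s'') aQ) \<and>
        solves l (Suc j) B a (arr (set_reg 5 0 s'') aQ) (arr (set_reg 5 0 s'') aC 0))"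
    proof (rule tot_column[where l = l and j = j, OF D(1-3)])
      show "projects l j (arr ?s aB) (arr ?s aQ)" using I AB by simp
      show "solves l j (arr ?s aB) (arr ?s aA (reg ?s 4)) (arr ?s aQ) (arr ?s aC 0)"
        using I AB by (simp add: a_def)
      fix s'' assume "reg s'' = reg ?s" "frame {aQ, aC, aU, aUU, aCB} ?s s''"
        "projects l (Suc j) (arr ?s aB) (arr s'' aQ)"
        "solves l (Suc j) (arr ?s aB) (arr ?s aA (reg ?s 4)) (arr s'' aQ) (arr s'' aC 0)"
      then show "reg s'' 5 = j \<and> reg (set_reg 5 0 s'') = reg s \<and> frame {aQ, aC, aU, aUU, aCB} s (set_reg 5 0 s'') \<and>
        projects l (Suc j) B (arr (set_reg 5 0 s'') aQ) \<and>
        solves l (Suc j) B a (arr (set_reg 5 0 s'') aQ) (arr (set_reg 5 0 s'') aC 0)"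
        using I AB s by (auto simp: frame_def a_def)
    qed (use I s in auto)
  qed (use P P0 S0 fr3 s in auto)
qed

lemma tot_check:
  fixes s :: state and l n :: nat
  assumes D: "1 \<le> D" "1 \<le> W" "l \<le> D" "n \<le> D"
    and s: "reg s 0 = l" "reg s 2 = n" "reg s 5 = 0" "reg s 6 = 0"
  defines "B \<equiv> arr s aB" and "a \<equiv> arr s aA (reg s 4)" and "c \<equiv> arr s aC 0"
  assumes P: "\<And>s'. reg s' = (reg s)(3 := if c \<in> feasible l n B a then reg s 3 else 1) \<Longrightarrow>
      frame {aCB} s s' \<Longrightarrow> P s'"
  shows "tot D W check_com s P"
  unfolding check_com_def
proof (rule tot_For[where I = "\<lambda>j s'. reg s' = (reg s)(3 := if c \<in> feasible l j B a then reg s 3 else 1) \<and>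
      frame {aCB} s s'", OF D(1,2,4)])
  fix j s'
  assume I: "reg s' = (reg s)(3 := if c \<in> feasible l j B a then reg s 3 else 1) \<and> frame {aCB} s s'"
  have arrs: "arr s' aB = B" "arr s' aA = arr s aA" "arr s' aC 0 = c"
    using I by (simp_all add: frame_def B_def c_def)
  let ?b = "inner_prod l c (\<lambda>r. B r j)"
  let ?s = "set_cell aCB 0 0 ?b (set_reg 5 j s')"
  have Suc: "c \<in> feasible l (Suc j) B a \<longleftrightarrow> c \<in> feasible l j B a \<and> ?b = a j"
    by (auto simp: feasible_iff less_Suc_eq)
  have 1: "tot D W (SumTo aCB NZero NZero 6 rl (RMul (Vc aC 6) (Mt aB 6 5))) (set_reg 5 j s') (\<lambda>s''. s'' = ?s)"
    by (rule tot_scalar_sum[where N = l and f = "\<lambda>r. c r * B r j"])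
      (use D s I in \<open>simp_all add: inner_prod_def arrs del: One_nat_def\<close>)
  let ?R = "\<lambda>s''. reg s'' 5 = j \<and> reg (set_reg 5 0 s'') =
        (reg s)(3 := if c \<in> feasible l (Suc j) B a then reg s 3 else 1) \<and> frame {aCB} s (set_reg 5 0 s'')"
  have cell: "rval (Sc aCB) ?s = ?b" "rval (Mt aA 4 5) ?s = a j"
    using I by (simp_all add: arrs a_def)
  have differ: "?R (set_reg 3 1 ?s)" if "?b \<noteq> a j"
    using that I s by (auto simp: Suc frame_def)
  have agree: "?R ?s" if "?b = a j"
    using that I s by (auto simp: Suc frame_def)
  show "tot D W (SumTo aCB NZero NZero 6 rl (RMul (Vc aC 6) (Mt aB 6 5)) ;;
       Cond (RLess (Sc aCB) (Mt aA 4 5)) (NAssign 3 (NSuc NZero))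
         (Cond (RLess (Mt aA 4 5) (Sc aCB)) (NAssign 3 (NSuc NZero)) Skip)) (set_reg 5 j s') ?R"
  proof (rule tot_Seq_exact[OF 1], rule tot_Cond[OF D(1,2)])
    assume "tval (RLess (Sc aCB) (Mt aA 4 5)) ?s"
    then have "?b \<noteq> a j" unfolding tval.simps cell by simp
    from differ[OF this] show "tot D W (NAssign 3 (NSuc NZero)) ?s ?R"
      by (intro tot_NAssign D(1,2)) simp
  next
    assume 2: "\<not> tval (RLess (Sc aCB) (Mt aA 4 5)) ?s"
    show "tot D W (Cond (RLess (Mt aA 4 5) (Sc aCB)) (NAssign 3 (NSuc NZero)) Skip) ?s ?R"
    proof (rule tot_Cond[OF D(1,2)])
      assume "tval (RLess (Mt aA 4 5) (Sc aCB)) ?s"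
      then have "?b \<noteq> a j" unfolding tval.simps cell by simp
      from differ[OF this] show "tot D W (NAssign 3 (NSuc NZero)) ?s ?R"
        by (intro tot_NAssign D(1,2)) simp
    next
      assume "\<not> tval (RLess (Mt aA 4 5) (Sc aCB)) ?s"
      with 2 have "?b = a j" unfolding tval.simps cell by simp
      from agree[OF this] show "tot D W Skip ?s ?R" by (intro tot_Skip D(1,2))
    qed
  qed
qed (use P s in \<open>auto simp: feasible_def frame_def\<close>)

lemma tot_start:
  fixes s :: state and l :: nat and q :: real
  assumes D: "1 \<le> D" "1 \<le> W" "Suc l \<le> D"
    and s: "reg s 0 = l" "reg s 6 = 0" "reg s 7 = 0" "arr s aN 0 0 = real (Suc l)" "arr s aq 0 0 = q"
  defines "f \<equiv> pn (ereal q) l (arr s aC 0)"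
  assumes P: "\<And>s'. reg s' = reg s \<Longrightarrow> frame {aF, aBest, aV, aY} s s' \<Longrightarrow>
     arr s' aBest 0 0 = f \<Longrightarrow> arr s' aY 0 0 = 1 \<Longrightarrow>
     (\<And>k r. k < Suc l \<Longrightarrow> r < l \<Longrightarrow> arr s' aV k r = initial_simplex l (2 * f) k r) \<Longrightarrow> P s'"
  shows "tot D W start_com s P"
proof -
  have D': "1 \<le> D" "1 \<le> W" "l \<le> D" using D by auto
  define s1 where "s1 = set_cell aF 0 0 f s"
  define s2 where "s2 = set_cell aBest 0 0 f s1"
  define s3 where "s3 = set_arr aV (fill_mat (Suc l) l (\<lambda>_ _. - (2 * f)) (arr s2 aV)) s2"
  define F where "F k = set_arr aV (\<lambda>i j. if i = Suc j \<and> j < k then 4 * real l * (2 * f) - 2 * f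
     else arr s3 aV i j) s3" for k
  define s5 where "s5 = set_cell aY 0 0 1 (F l)"
  have 1: "tot D W (norm_com aC) s (\<lambda>s'. s' = s1)"
    by (rule tot_norm[where l = l]) (use D' s in \<open>simp_all add: s1_def f_def\<close>)
  have 2: "tot D W (RAssign aBest NZero NZero (Sc aF)) s1 (\<lambda>s'. s' = s2)"
    by (rule tot_scalar_assign) (use D' in \<open>simp_all add: s1_def s2_def\<close>)
  have 3: "tot D W (For 6 rl1 (For 7 rl (RAssign aV (NReg 6) (NReg 7)
      (RSub RZero (RMul (rnum 2) (Sc aBest)))))) s2 (\<lambda>s'. s' = s3)"
    by (rule tot_mat_assign[where N = "Suc l" and M = l and v = "\<lambda>_ _. - (2 * f)"])
      (use D D' s in \<open>simp_all add: s1_def s2_def s3_def\<close>)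
  have 4: "tot D W (For 6 rl (RAssign aV (NSuc (NReg 6)) (NReg 6)
       (RSub (RMul (RMul (rnum 4) (RSub (Sc aN) ROne)) (RMul (rnum 2) (Sc aBest)))
         (RMul (rnum 2) (Sc aBest))))) s3 (\<lambda>s'. s' = F l)" (is "tot D W (For 6 rl (RAssign _ _ _ ?e)) _ _")
  proof (rule tot_For_exact[where F = F, OF D'])
    fix k assume "k < l"
    show "tot D W (RAssign aV (NSuc (NReg 6)) (NReg 6) ?e) (set_reg 6 k (F k)) (\<lambda>s'. s' = set_reg 6 k (F (Suc k)))"
    proof (intro tot_RAssign D')
      let ?x = "4 * real l * (2 * f) - 2 * f"
      have "(arr (F k) aV)(Suc k := (arr (F k) aV (Suc k))(k := ?x)) = arr (F (Suc k)) aV"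
        by (auto simp: F_def fun_eq_iff less_Suc_eq)
      moreover have "rval ?e (set_reg 6 k (F k)) = ?x"
        using s by (simp add: F_def s3_def s2_def s1_def)
      ultimately show "set_cell aV (nval (NSuc (NReg 6)) (set_reg 6 k (F k))) (nval (NReg 6) (set_reg 6 k (F k)))
          (rval ?e (set_reg 6 k (F k))) (set_reg 6 k (F k)) = set_reg 6 k (F (Suc k))"
        by (simp add: set_cell_def del: rval.simps) (simp add: F_def)
    qed
  qed (use s in \<open>simp_all add: F_def s1_def s2_def s3_def\<close>)
  have 5: "tot D W (RAssign aY NZero NZero ROne) (F l) (\<lambda>s'. s' = s5)"
    by (rule tot_scalar_assign) (use D' in \<open>simp_all add: s5_def\<close>)
  show ?thesis unfolding start_com_def
  proof (rule tot_Seq_exact[OF 1], rule tot_Seq_exact[OF 2], rule tot_Seq_exact[OF 3],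
      rule tot_Seq_exact[OF 4], rule tot_weaken[OF 5])
    fix s' assume s': "s' = s5"
    show "P s'" unfolding s'
    proof (rule P)
      show "reg s5 = reg s" by (simp add: s5_def F_def s1_def s2_def s3_def)
      show "frame {aF, aBest, aV, aY} s s5" by (simp add: frame_def s5_def F_def s1_def s2_def s3_def)
      show "arr s5 aBest 0 0 = f" by (simp add: s5_def F_def s1_def s2_def s3_def)
      show "arr s5 aY 0 0 = 1" by (simp add: s5_def)
      fix k r assume "k < Suc l" "r < l"
      then show "arr s5 aV k r = initial_simplex l (2 * f) k r"
        by (auto simp: s5_def F_def s3_def initial_simplex_def)
    qed
  qed
qed

definition is_min_norm :: "real \<Rightarrow> nat \<Rightarrow> nat \<Rightarrow> (nat \<Rightarrow> nat \<Rightarrow> real) \<Rightarrow> (nat \<Rightarrow> real) \<Rightarrow> real \<Rightarrow> bool" where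
  "is_min_norm q l n B a d \<longleftrightarrow> (\<exists>opt\<in>feasible l n B a. d = pn (ereal q) l opt \<and>
     (\<forall>\<gamma>\<in>feasible l n B a. d \<le> pn (ereal q) l \<gamma>))"

definition target :: "nat \<Rightarrow> real \<Rightarrow> real" where
  "target l \<epsilon> = 4 * (real (Suc l) / (\<epsilon> / (11 * real (Suc l) ^ 3))) ^ Suc l"

text \<open>Growth per step as guaranteed by \<open>simplex_step\<close>. The product of the growth factors is compared
with the target by the program itself, which therefore has no need of a logarithm.\<close>

definition growth :: "nat \<Rightarrow> real" where
  "growth l = 1 + 1 / (8 * (real (Suc l))\<^sup>2)"

definition scratch :: "nat set" where
  "scratch = {aQ, aC, aV, aZ, aX, aG, aW, aH, aU, aUU, aCB, aF, aBest, aY}"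

text \<open>\<open>T\<close> is the number of steps of the search. If the row is infeasible, the search runs on meaningless
data for the same number of steps; this is harmless, as the flag in the register \<open>3\<close> is set.\<close>

lemma tot_row:
  fixes s :: state and l n T :: nat and q \<epsilon> :: real
  assumes D: "1 \<le> D" "1 \<le> W" "Suc l \<le> D" "n \<le> D"
    and T: "T \<le> W" "target l \<epsilon> \<le> growth l ^ T" "\<And>k. k < T \<Longrightarrow> growth l ^ k < target l \<epsilon>"
    and q: "1 \<le> q" and \<epsilon>: "0 < \<epsilon>" "\<epsilon> < 1"
    and s: "reg s 0 = l" "reg s 2 = n" "\<And>r. 4 < r \<Longrightarrow> reg s r = 0"
      "arr s aN 0 0 = real (Suc l)" "arr s aq 0 0 = q" "arr s aTarget 0 0 = target l \<epsilon>"
  defines "B \<equiv> arr s aB" and "a \<equiv> arr s aA (reg s 4)"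
  assumes P: "\<And>s' b. reg s' = (reg s)(3 := if feasible l n B a = {} then 1 else reg s 3) \<Longrightarrow>
     frame (insert aRes scratch) s s' \<Longrightarrow> arr s' aRes 0 0 = max (arr s aRes 0 0) b \<Longrightarrow>
     (\<And>d. is_min_norm q l n B a d \<Longrightarrow> d \<le> b \<and> b \<le> (1 + \<epsilon>) * d) \<Longrightarrow> P s'"
  shows "tot D W row_com s P"
  unfolding row_com_def
proof (rule tot_Seq, rule tot_project[where l = l and n = n])
  fix s1 assume r1: "reg s1 = reg s" and f1: "frame {aQ, aC, aU, aUU, aCB} s s1"
    and "projects l n (arr s aB) (arr s1 aQ)"
    and "solves l n (arr s aB) (arr s aA (reg s 4)) (arr s1 aQ) (arr s1 aC 0)"
  then have proj: "projects l n B (arr s1 aQ)" and sol: "solves l n B a (arr s1 aQ) (arr s1 aC 0)"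
    by (simp_all add: B_def a_def)
  define Q where "Q = arr s1 aQ"
  define c where "c = arr s1 aC 0"
  have c_feasible: "c \<in> feasible l n B a \<longleftrightarrow> feasible l n B a \<noteq> {}"
    using sol by (auto simp: solves_def c_def)
  have AB1: "arr s1 aB = B" "arr s1 aA = arr s aA" using f1 by (simp_all add: frame_def B_def)
  show "tot D W (check_com ;; start_com ;; search_com ;; record_com) s1 P"
  proof (rule tot_Seq, rule tot_check[where l = l and n = n])
    fix s2 assume "reg s2 = (reg s1)(3 := if arr s1 aC 0 \<in> feasible l n (arr s1 aB) (arr s1 aA (reg s1 4))
        then reg s1 3 else 1)" and f2: "frame {aCB} s1 s2"
    then have r2: "reg s2 = (reg s)(3 := if feasible l n B a = {} then 1 else reg s 3)"
      using c_feasible unfolding AB1 r1 a_def[symmetric] c_def[symmetric]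
      by (cases "feasible l n B a = {}") simp_all
    have arr2: "arr s2 aN 0 0 = real (Suc l)" "arr s2 aq 0 0 = q" "arr s2 aC 0 = c" "arr s2 aQ = Q"
      "arr s2 aTarget 0 0 = target l \<epsilon>"
      using f1 f2 s by (simp_all add: frame_def c_def Q_def)
    show "tot D W (start_com ;; search_com ;; record_com) s2 P"
    proof (rule tot_Seq, rule tot_start[where l = l and q = q])
      fix s3 assume r3: "reg s3 = reg s2" and f3: "frame {aF, aBest, aV, aY} s2 s3"
        and "arr s3 aBest 0 0 = pn (ereal q) l (arr s2 aC 0)" and y3: "arr s3 aY 0 0 = 1"
        and "\<And>k r. k < Suc l \<Longrightarrow> r < l \<Longrightarrow>
          arr s3 aV k r = initial_simplex l (2 * pn (ereal q) l (arr s2 aC 0)) k r"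
      then have best3: "arr s3 aBest 0 0 = pn (ereal q) l c"
        and V3: "\<And>k r. k < Suc l \<Longrightarrow> r < l \<Longrightarrow> arr s3 aV k r = initial_simplex l (2 * pn (ereal q) l c) k r"
        by (simp_all add: arr2)
      have arr3: "arr s3 aN 0 0 = real (Suc l)" "arr s3 aq 0 0 = q" "arr s3 aC 0 = c" "arr s3 aQ = Q"
        "arr s3 aTarget 0 0 = target l \<epsilon>"
        using f3 by (simp_all add: frame_def arr2)
      let ?S = "{aV, aZ, aX, aG, aW, aH, aF, aBest, aY}"
      define G where "G V best y \<longleftrightarrow> (\<forall>opt. affine_norm_problem l n B a Q c q opt \<longrightarrow>
        affine_norm_problem.cut_invariant l c q opt \<epsilon> V best y)" for V best y
      define I where "I k s' \<longleftrightarrow> reg s' = reg s3 \<and> frame ?S s3 s' \<and> arr s' aY 0 0 = growth l ^ k \<and>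
        G (arr s' aV) (arr s' aBest 0 0) (growth l ^ k)" for k s'
      have growth_pos: "0 \<le> growth l ^ k" for k by (simp add: growth_def)
      show "tot D W (search_com ;; record_com) s3 P"
      proof (rule tot_Seq, unfold search_com_def, rule tot_While_iterated[where I = I, OF D(1,2) T(1)])
        have "G (arr s3 aV) (arr s3 aBest 0 0) 1"
          unfolding G_def best3
          using affine_norm_problem.cut_invariant_start[OF _ \<epsilon>] V3
          by (auto simp: affine_norm_problem.start_def)
        then show "I 0 s3" by (simp add: I_def frame_def y3)
      next
        fix k s4 assume k: "k < T" and I4: "I k s4"
        have arr4: "arr s4 aN 0 0 = real (Suc l)" "arr s4 aq 0 0 = q" "arr s4 aC 0 = c" "arr s4 aQ = Q"
          "arr s4 aTarget 0 0 = target l \<epsilon>"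
          using I4 by (simp_all add: I_def frame_def arr3)
        have y4: "arr s4 aY 0 0 = growth l ^ k" using I4 by (simp add: I_def)
        have r4: "reg s4 = reg s2" using I4 by (simp add: I_def r3)
        have "tot D 1 iterate_com s4 (I (Suc k))"
        proof (rule tot_iterate[where l = l and q = q])
          let ?V = "arr s4 aV"
          let ?v = "\<lambda>r. \<Sum>k<Suc l. ?V k r / real (Suc l)"
          let ?x = "\<lambda>r. arr s4 aC 0 r + app l (arr s4 aQ) ?v r"
          let ?w = "app l (arr s4 aQ) (\<lambda>r. ?x r * \<bar>?x r\<bar> powr (q - 2))"
          let ?h = "\<lambda>k. inner_prod l ?w (\<lambda>r. ?V k r - ?v r)"
          fix s5 k0
          assume r5: "reg s5 = reg s4" and f5: "frame ?S s4 s5"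
            and k0: "k0 < Suc l" and h: "\<And>k. k < Suc l \<Longrightarrow> ?h k0 \<le> ?h k"
            and V5: "\<And>k r. k < Suc l \<Longrightarrow> r < l \<Longrightarrow> arr s5 aV k r =
              ?V k0 r + (?V k r - ?V k0 r) / (1 + 1 / (4 * (real (Suc l))\<^sup>2) * (?h k / - ?h k0))"
            and best5: "arr s5 aBest 0 0 = min (arr s4 aBest 0 0) (pn (ereal q) l ?x)"
            and y5: "arr s5 aY 0 0 = arr s4 aY 0 0 * (1 + 1 / (8 * (real (Suc l))\<^sup>2))"
          have "G (arr s5 aV) (arr s5 aBest 0 0) (growth l ^ Suc k)"
            unfolding G_def
          proof (intro allI impI)
            fix opt assume loc: "affine_norm_problem l n B a Q c q opt"
            interpret affine_norm_problem l n B a Q c q opt by (rule loc)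
            have x: "?x = point ?v" by (simp add: fun_eq_iff point_def arr4)
            have w: "?w = subgradient ?v" unfolding subgradient_def x[symmetric] by (simp add: arr4)
            have "cut_invariant \<epsilon> (arr s5 aV) (min (arr s4 aBest 0 0) (objective ?v))
                (growth l ^ k * (1 + 1 / (8 * (real (Suc l))\<^sup>2)))"
            proof (rule cut_invariant_step[where V = ?V and v = ?v and h = ?h and ?k0.0 = k0,
                  OF \<epsilon> _ growth_pos _ _ k0])
              show "?h k0 \<le> ?h k" if "k < Suc l" for k by (rule h[OF that])
              show "arr s5 aV k r =
                  ?V k0 r + (?V k r - ?V k0 r) / (1 + 1 / (4 * (real (Suc l))\<^sup>2) * (?h k / - ?h k0))"
                if "k < Suc l" "r < l" for k r by (rule V5[OF that])
              show "cut_invariant \<epsilon> (arr s4 aV) (arr s4 aBest 0 0) (growth l ^ k)"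
                using I4 loc by (simp add: I_def G_def)
              show "?v r = (\<Sum>k<Suc l. ?V k r) / real (Suc l)" for r by (rule sum_divide_distrib[symmetric])
              show "?h k = inner_prod l (subgradient ?v) (\<lambda>r. ?V k r - ?v r)" for k unfolding w ..
            qed
            moreover have "objective ?v = pn (ereal q) l ?x" unfolding objective_def x ..
            ultimately show "cut_invariant \<epsilon> (arr s5 aV) (arr s5 aBest 0 0) (growth l ^ Suc k)"
              unfolding best5 by (simp add: growth_def mult.commute)
          qed
          moreover have "frame ?S s3 s5" using I4 f5 by (simp add: I_def frame_def)
          ultimately show "I (Suc k) s5"
            using I4 r5 y5 by (simp add: I_def growth_def mult.commute)
        qed (use D arr4 r4 r2 s in simp_all)
        moreover have "tval (RLess (Sc aY) (Sc aTarget)) s4"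
          using T(3)[OF k] by (simp add: y4 arr4)
        ultimately show "tval (RLess (Sc aY) (Sc aTarget)) s4 \<and> tot D 1 iterate_com s4 (I (Suc k))" by blast
      next
        fix s4 assume I4: "I T s4"
        then have "arr s4 aTarget 0 0 = target l \<epsilon>" "arr s4 aY 0 0 = growth l ^ T"
          by (simp_all add: I_def frame_def arr3)
        then show "\<not> tval (RLess (Sc aY) (Sc aTarget)) s4" using T(2) by simp
      next
        fix s4 assume I4: "I T s4"
        have bound: "d \<le> arr s4 aBest 0 0 \<and> arr s4 aBest 0 0 \<le> (1 + \<epsilon>) * d"
          if min: "is_min_norm q l n B a d" for d
        proof -
          from min obtain opt where min_opt: "opt \<in> feasible l n B a" "d = pn (ereal q) l opt"
            "\<And>\<gamma>. \<gamma> \<in> feasible l n B a \<Longrightarrow> d \<le> pn (ereal q) l \<gamma>" by (auto simp: is_min_norm_def)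
          have loc: "affine_norm_problem l n B a Q c q opt"
            using q proj sol min_opt c_feasible by unfold_locales (auto simp: solves_def Q_def c_def)
          interpret affine_norm_problem l n B a Q c q opt by (rule loc)
          have "cut_invariant \<epsilon> (arr s4 aV) (arr s4 aBest 0 0) (growth l ^ T)"
            using I4 loc by (simp add: I_def G_def)
          from cut_invariant_end[OF \<epsilon> this] T(2) show ?thesis
            by (simp add: min_opt(2) target_def shrink_def)
        qed
        have fr: "frame scratch s s4"
          using I4 f1 f2 f3 by (simp add: I_def frame_def scratch_def)
        have r4: "reg s4 = (reg s)(3 := if feasible l n B a = {} then 1 else reg s 3)"
          using I4 by (simp add: I_def r3 r2)
        have res: "arr s4 aRes = arr s aRes" using fr by (simp add: frame_def scratch_def)
        show "tot D W record_com s4 P"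
          unfolding record_com_def
        proof (intro tot_Cond tot_RAssign tot_Skip D(1,2))
          assume "tval (RLess (Sc aRes) (Sc aBest)) s4"
          then show "P (set_cell aRes (nval NZero s4) (nval NZero s4) (rval (Sc aBest) s4) s4)"
            using r4 fr res bound by (intro P[of _ "arr s4 aBest 0 0"]) (auto simp: frame_def)
        next
          assume "\<not> tval (RLess (Sc aRes) (Sc aBest)) s4"
          then show "P s4"
            using r4 fr res bound by (intro P[of _ "arr s4 aBest 0 0"]) (auto simp: frame_def)
        qed
      qed
    qed (use D arr2 r2 s in simp_all)
  qed (use D r1 s in simp_all)
qed (use D s in simp_all)

section \<open>The number of iterations\<close>

lemma growth_gt_1: "1 < growth l"
  by (simp add: growth_def)

lemma ln_growth_ge: "1 / (16 * (real (Suc l))\<^sup>2) \<le> ln (growth l)"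
proof -
  define x where "x = 1 / (8 * (real (Suc l))\<^sup>2)"
  have "1 \<le> (real (Suc l))\<^sup>2" by (rule one_le_power) simp
  then have "2 \<le> 8 * (real (Suc l))\<^sup>2" by linarith
  from frac_le[OF _ order.refl _ this, of 1] have x: "0 \<le> x" "x \<le> 1/2" by (simp_all add: x_def)
  have "x\<^sup>2 \<le> x * (1/2)" unfolding power2_eq_square using x by (intro mult_left_mono) auto
  moreover have "x - x\<^sup>2 \<le> ln (1 + x)" using x by (intro ln_one_plus_pos_lower_bound) auto
  ultimately have "x / 2 \<le> ln (1 + x)" by simp
  then show ?thesis by (simp add: x_def growth_def)
qed

lemma ln_target_le:
  assumes \<epsilon>: "0 < \<epsilon>" "\<epsilon> < 1"
  shows "ln (target l (\<epsilon> / 4)) \<le> 50 * (real (Suc l))\<^sup>2 * (1 + ln (1 / \<epsilon>))"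
proof -
  define N where "N = real (Suc l)"
  define L where "L = ln (1 / \<epsilon>)"
  have N: "1 \<le> N" by (simp add: N_def)
  have L: "0 \<le> L" using \<epsilon> by (simp add: L_def)
  have t: "target l (\<epsilon> / 4) = 4 * (44 * N ^ 4 * (1 / \<epsilon>)) ^ Suc l"
    using N \<epsilon> unfolding target_def N_def[symmetric] by (simp add: field_simps numeral_eq_Suc)
  have "ln (44 * N ^ 4 * (1 / \<epsilon>)) = ln 44 + 4 * ln N + L"
    using N \<epsilon> by (simp add: ln_mult ln_realpow L_def ln_div)
  also have "\<dots> \<le> 43 + 4 * (N - 1) + L"
    using ln_le_minus_one[of 44] ln_le_minus_one[of N] N by simp
  finally have le: "ln (44 * N ^ 4 * (1 / \<epsilon>)) \<le> 39 + 4 * N + L" by simp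
  have "ln (target l (\<epsilon> / 4)) = ln 4 + N * ln (44 * N ^ 4 * (1 / \<epsilon>))"
    unfolding t using N \<epsilon> by (subst ln_mult) (simp_all add: ln_realpow N_def del: power_Suc)
  also have "\<dots> \<le> 3 + N * (39 + 4 * N + L)"
    using ln_le_minus_one[of 4] le N by (intro add_mono mult_left_mono) auto
  also have "\<dots> \<le> 50 * N\<^sup>2 * (1 + L)"
  proof -
    have N2: "N \<le> N\<^sup>2" "1 \<le> N\<^sup>2" using self_le_power[OF N, of 2] one_le_power[OF N, of 2] by simp_all
    have "N * L \<le> N\<^sup>2 * L" using N2 L by (intro mult_right_mono) auto
    moreover have "0 \<le> N\<^sup>2 * L" using L by simp
    moreover have "3 + N * (39 + 4 * N + L) = 3 + 39 * N + 4 * N\<^sup>2 + N * L"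
      by (simp add: algebra_simps power2_eq_square)
    moreover have "50 * N\<^sup>2 * (1 + L) = 50 * N\<^sup>2 + 50 * (N\<^sup>2 * L)" by (simp add: algebra_simps)
    ultimately show ?thesis using N2 by linarith
  qed
  finally show ?thesis by (simp add: N_def L_def)
qed

text \<open>The search ends after about \<open>ln (target l (\<epsilon> / 4)) / ln (growth l)\<close> steps.\<close>

lemma iterations_exist:
  assumes \<epsilon>: "0 < \<epsilon>" "\<epsilon> < 1"
  shows "\<exists>T. target l (\<epsilon> / 4) \<le> growth l ^ T \<and> (\<forall>k<T. growth l ^ k < target l (\<epsilon> / 4)) \<and>
    real T \<le> 801 * real (Suc l) ^ 4 * (1 + ln (1 / \<epsilon>))"
proof -
  define N where "N = real (Suc l)"
  define L where "L = ln (1 / \<epsilon>)"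
  define T where "T = (LEAST k. target l (\<epsilon> / 4) \<le> growth l ^ k)"
  have N4: "1 \<le> N ^ 4" by (rule one_le_power) (simp add: N_def)
  have L: "0 \<le> L" using \<epsilon> by (simp add: L_def)
  obtain k where "target l (\<epsilon> / 4) < growth l ^ k"
    using real_arch_pow[OF growth_gt_1] by blast
  then have T: "target l (\<epsilon> / 4) \<le> growth l ^ T"
    unfolding T_def by (intro LeastI[of "\<lambda>k. target l (\<epsilon> / 4) \<le> growth l ^ k" k] less_imp_le)
  have min: "growth l ^ k < target l (\<epsilon> / 4)" if "k < T" for k
    using not_less_Least[of k "\<lambda>k. target l (\<epsilon> / 4) \<le> growth l ^ k"] that by (simp add: T_def not_le)
  have "real T \<le> 1 + 800 * N ^ 4 * (1 + L)"
  proof (cases T)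
    case (Suc k)
    have pos: "0 < growth l ^ k" using growth_gt_1[of l] by (intro zero_less_power) simp
    have "real k * (1 / (16 * N\<^sup>2)) \<le> real k * ln (growth l)"
      using ln_growth_ge[of l] by (intro mult_left_mono) (auto simp: N_def)
    also have "\<dots> = ln (growth l ^ k)" using growth_gt_1[of l] by (simp add: ln_realpow)
    also have "\<dots> \<le> ln (target l (\<epsilon> / 4))"
      using min[of k] Suc pos by (subst ln_le_cancel_iff) auto
    also have "\<dots> \<le> 50 * N\<^sup>2 * (1 + L)" using ln_target_le[OF \<epsilon>] by (simp add: N_def L_def)
    finally have "real k / (16 * N\<^sup>2) \<le> 50 * N\<^sup>2 * (1 + L)" by simp
    moreover have "0 < 16 * N\<^sup>2" by (simp add: N_def)
    ultimately have "real k \<le> 50 * N\<^sup>2 * (1 + L) * (16 * N\<^sup>2)" by (simp only: pos_divide_le_eq)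
    also have "\<dots> = 800 * N ^ 4 * (1 + L)" by (simp add: numeral_eq_Suc)
    finally show ?thesis using Suc by simp
  qed (use L N4 in simp)
  also have "\<dots> \<le> 801 * N ^ 4 * (1 + L)"
  proof -
    have "1 * 1 \<le> N ^ 4 * (1 + L)" using N4 L by (intro mult_mono) auto
    then show ?thesis by linarith
  qed
  finally show ?thesis using T min by (auto simp: N_def L_def)
qed

section \<open>A finite exponent for the maximum norm\<close>

text \<open>For \<open>p = 1\<close> the conjugate exponent \<open>\<infinity>\<close> is replaced by \<open>4 (l + 1) / \<epsilon>\<close>.\<close>

definition exponent_rexp :: "ereal \<Rightarrow> rexp" where
  "exponent_rexp p =
     (if p = 1 then RDiv (Sc aN) (RDiv (RCell aIn NZero (NSuc NZero)) (rnum 4))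
      else if p = \<infinity> then ROne
      else RDiv (Sc aIn) (RSub (Sc aIn) ROne))"

definition exponent :: "ereal \<Rightarrow> nat \<Rightarrow> real \<Rightarrow> real" where
  "exponent p l \<epsilon> = (if p = 1 then real (Suc l) / (\<epsilon> / 4) else if p = \<infinity> then 1
     else real_of_ereal p / (real_of_ereal p - 1))"

lemma exponent_ge_1:
  assumes "1 \<le> p" "0 < \<epsilon>" "\<epsilon> < 1"
  shows "1 \<le> exponent p l \<epsilon>"
  using assms(1)
proof (cases rule: ereal_ge_1_cases)
  case (2 r)
  then show ?thesis using assms by (auto simp: exponent_def one_ereal_def field_simps)
qed (simp add: exponent_def)

text \<open>For a finite exponent \<open>e\<close> the norm exceeds the maximum norm by a factor of at most
\<open>l powr (1 / e)\<close>.\<close>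

lemma exponent_norm:
  assumes p: "1 \<le> p" and \<epsilon>: "0 < \<epsilon>" "\<epsilon> < 1"
  shows "pn (hoelder_conj p) l x \<le> pn (ereal (exponent p l \<epsilon>)) l x"
    "pn (ereal (exponent p l \<epsilon>)) l x \<le> (1 + \<epsilon> / 2) * pn (hoelder_conj p) l x"
proof -
  let ?e = "exponent p l \<epsilon>"
  have "pn (hoelder_conj p) l x \<le> pn (ereal ?e) l x \<and>
    pn (ereal ?e) l x \<le> (1 + \<epsilon> / 2) * pn (hoelder_conj p) l x"
  proof (cases "p = 1")
    case False
    from p have "ereal ?e = hoelder_conj p"
    proof (cases rule: ereal_ge_1_cases)
      case 1 then show ?thesis by (simp add: exponent_def hoelder_conj_def one_ereal_def)
    next
      case (2 r) then show ?thesis using False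
        by (auto simp: exponent_def hoelder_conj_def one_ereal_def)
    qed
    moreover have "0 \<le> \<epsilon> / 2 * pn (hoelder_conj p) l x" using \<epsilon> by (simp add: pn_nonneg)
    ultimately show ?thesis by (simp add: distrib_right)
  next
    case True
    define M where "M = pn \<infinity> l x"
    have M: "0 \<le> M" by (simp add: M_def pn_nonneg)
    have e: "1 \<le> ?e" by (rule exponent_ge_1[OF p \<epsilon>])
    have "M \<le> pn (ereal ?e) l x"
      unfolding M_def pn_infinity using e by (auto intro: abs_le_pn pn_nonneg)
    moreover have "pn (ereal ?e) l x \<le> (1 + \<epsilon> / 2) * M"
    proof (cases "l = 0")
      case True
      then show ?thesis using M \<epsilon> by (simp add: pn_real)
    next
      case l: False
      have "(\<Sum>i<l. \<bar>x i\<bar> powr ?e) \<le> (\<Sum>i<l. M powr ?e)"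
        using e unfolding M_def by (intro sum_mono powr_mono2 abs_le_pn) auto
      then have "pn (ereal ?e) l x \<le> (real l * M powr ?e) powr (1 / ?e)"
        unfolding pn_real using e by (intro powr_mono2) (auto intro: sum_nonneg)
      also have "\<dots> = real l powr (1 / ?e) * M" using M e by (simp add: powr_mult powr_powr)
      also have "real l powr (1 / ?e) \<le> 1 + \<epsilon> / 2"
      proof -
        have "1 / ?e = \<epsilon> / 4 / real (Suc l)" using True by (simp add: exponent_def)
        then have "1 / ?e * ln (real l) = \<epsilon> / 4 * (ln (real l) / real (Suc l))" by simp
        also have "\<dots> \<le> \<epsilon> / 4 * 1"
          using l \<epsilon> ln_le_minus_one[of "real l"] by (intro mult_left_mono) (auto simp: divide_le_eq_1)
        finally have le: "1 / ?e * ln (real l) \<le> \<epsilon> / 4" by simp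
        have "exp (\<epsilon> / 4) \<le> 1 + \<epsilon> / 4 + (\<epsilon> / 4)\<^sup>2" using \<epsilon> by (intro exp_bound) auto
        also have "(\<epsilon> / 4)\<^sup>2 \<le> (\<epsilon> / 4) * 1" unfolding power2_eq_square using \<epsilon> by (intro mult_left_mono) auto
        finally have "exp (\<epsilon> / 4) \<le> 1 + \<epsilon> / 2" by simp
        moreover have "real l powr (1 / ?e) = exp (1 / ?e * ln (real l))" using l by (simp add: powr_def)
        moreover have "exp (1 / ?e * ln (real l)) \<le> exp (\<epsilon> / 4)" using le by (simp only: exp_le_cancel_iff)
        ultimately show ?thesis by linarith
      qed
      then have "real l powr (1 / ?e) * M \<le> (1 + \<epsilon> / 2) * M" using M by (intro mult_right_mono)
      finally show ?thesis .
    qed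
    moreover have "hoelder_conj p = \<infinity>" using True by (simp add: hoelder_conj_def)
    ultimately show ?thesis by (simp add: M_def)
  qed
  then show "pn (hoelder_conj p) l x \<le> pn (ereal ?e) l x"
    "pn (ereal ?e) l x \<le> (1 + \<epsilon> / 2) * pn (hoelder_conj p) l x" by auto
qed

section \<open>The whole program\<close>

text \<open>The program runs each row with the accuracy \<open>\<epsilon> / 4\<close>, which leaves room for the error of the modified
exponent. The maximum over the rows keeps the relative accuracy because all values are
nonnegative; \<open>d\<close> stands for the optimal values of the rows that are feasible.\<close>

lemma tot_main:
  fixes s :: state and l m n T :: nat and q \<epsilon> :: real
  assumes D: "1 \<le> D" "1 \<le> W" "Suc l \<le> D" "m \<le> D" "n \<le> D"
    and T: "T \<le> W" "target l (\<epsilon> / 4) \<le> growth l ^ T" "\<And>k. k < T \<Longrightarrow> growth l ^ k < target l (\<epsilon> / 4)"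
    and q: "1 \<le> q" and \<epsilon>: "0 < \<epsilon>" "\<epsilon> < 1"
    and s: "reg s 0 = l" "reg s 1 = m" "reg s 2 = n" "\<And>r. 2 < r \<Longrightarrow> reg s r = 0"
      "arr s aIn 0 1 = \<epsilon>" "arr s aRes 0 0 = 0"
    and e: "rval e (set_cell aN 0 0 (real (Suc l)) s) = q"
  defines "B \<equiv> arr s aB" and "A \<equiv> arr s aA"
  assumes d: "\<And>i. i < m \<Longrightarrow> feasible l n B (A i) \<noteq> {} \<Longrightarrow> is_min_norm q l n B (A i) (d i)"
    and P: "\<And>s'. reg s' 3 = (if \<exists>i<m. feasible l n B (A i) = {} then 1 else 0) \<Longrightarrow>
      (\<forall>i<m. feasible l n B (A i) \<noteq> {} ) \<longrightarrow> (\<forall>i<m. d i \<le> arr s' aRes 0 0) \<and>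
        (arr s' aRes 0 0 = 0 \<or> (\<exists>i<m. arr s' aRes 0 0 \<le> (1 + \<epsilon> / 4) * d i)) \<Longrightarrow> P s'"
  shows "tot D W (main_com e) s P"
proof -
  have \<epsilon>4: "0 < \<epsilon> / 4" "\<epsilon> / 4 < 1" using \<epsilon> by auto
  define s1 where "s1 = set_cell aN 0 0 (real (Suc l)) s"
  define s2 where "s2 = set_cell aq 0 0 q s1"
  define s3 where "s3 = set_cell aTarget 0 0 (target l (\<epsilon> / 4)) s2"
  have 1: "tot D W (SumTo aN NZero NZero 6 rl1 ROne) s (\<lambda>s'. s' = s1)"
    by (rule tot_scalar_sum[where N = "Suc l" and f = "\<lambda>_. 1"]) (use D s in \<open>simp_all add: s1_def\<close>)
  have 2: "tot D W (RAssign aq NZero NZero e) s1 (\<lambda>s'. s' = s2)"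
    by (rule tot_scalar_assign[OF D(1,2)]) (simp only: s2_def e[folded s1_def])
  have 3: "tot D W (RAssign aTarget NZero NZero
       (RMul (rnum 4) (RPow (RDiv (Sc aN) (RDiv (RDiv (RCell aIn NZero (NSuc NZero)) (rnum 4))
          (RMul (rnum 11) (RMul (Sc aN) (RMul (Sc aN) (Sc aN)))))) (Sc aN)))) s2 (\<lambda>s'. s' = s3)"
    (is "tot _ _ (RAssign _ _ _ ?e) _ _")
  proof (rule tot_scalar_assign[OF D(1,2)])
    let ?x = "real (Suc l) / (\<epsilon> / 4 / (11 * real (Suc l) ^ 3))"
    have "0 < ?x" using \<epsilon> by (simp del: of_nat_Suc)
    then have "?x powr real (Suc l) = ?x ^ Suc l" by (rule powr_realpow)
    moreover have "rval ?e s2 = 4 * ?x powr real (Suc l)"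
      using s by (simp add: s1_def s2_def power3_eq_cube mult.assoc del: of_nat_Suc)
    ultimately show "set_cell aTarget 0 0 (rval ?e s2) s2 = s3" by (simp only: s3_def target_def)
  qed
  have arr3: "arr s3 aB = B" "arr s3 aA = A" "arr s3 aRes = arr s aRes" "arr s3 aN 0 0 = real (Suc l)"
    "arr s3 aq 0 0 = q" "arr s3 aTarget 0 0 = target l (\<epsilon> / 4)" "reg s3 = reg s"
    by (simp_all add: s1_def s2_def s3_def A_def B_def)
  define flag where "flag i = (if \<exists>k<i. feasible l n B (A k) = {} then 1 else 0 :: nat)" for i
  define good where "good i z \<longleftrightarrow> ((\<forall>k<i. feasible l n B (A k) \<noteq> {}) \<longrightarrow> (\<forall>k<i. d k \<le> z) \<and>
     (z = 0 \<or> (\<exists>k<i. z \<le> (1 + \<epsilon> / 4) * d k)))" for i and z :: real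
  define I where "I i s' \<longleftrightarrow> reg s' = (reg s)(3 := flag i) \<and> frame (insert aRes scratch) s3 s' \<and>
    good i (arr s' aRes 0 0)" for i s'
  have "tot D W (For 4 (NReg 1) row_com) s3 P"
  proof (rule tot_For[where I = I, OF D(1,2,4)])
    fix i s' assume i: "i < m" and I: "I i s'" and r4: "reg s' 4 = 0"
    have arr': "arr s' aB = B" "arr s' aA = A" "arr s' aN 0 0 = real (Suc l)"
      "arr s' aq 0 0 = q" "arr s' aTarget 0 0 = target l (\<epsilon> / 4)"
      using I by (simp_all add: I_def frame_def scratch_def arr3 del: One_nat_def)
    show "tot D W row_com (set_reg 4 i s') (\<lambda>s''. reg s'' 4 = i \<and> I (Suc i) (set_reg 4 0 s''))"
    proof (rule tot_row[where l = l and n = n and q = q and \<epsilon> = "\<epsilon> / 4" and T = T])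
      fix s'' b
      assume r'': "reg s'' = (reg (set_reg 4 i s'))(3 := if feasible l n (arr (set_reg 4 i s') aB)
          (arr (set_reg 4 i s') aA (reg (set_reg 4 i s') 4)) = {} then 1 else reg (set_reg 4 i s') 3)"
        and f'': "frame (insert aRes scratch) (set_reg 4 i s') s''"
        and res: "arr s'' aRes 0 0 = max (arr (set_reg 4 i s') aRes 0 0) b"
        and b: "\<And>d. is_min_norm q l n (arr (set_reg 4 i s') aB)
          (arr (set_reg 4 i s') aA (reg (set_reg 4 i s') 4)) d \<Longrightarrow> d \<le> b \<and> b \<le> (1 + \<epsilon> / 4) * d"
      have row: "arr (set_reg 4 i s') aA (reg (set_reg 4 i s') 4) = A i" "arr (set_reg 4 i s') aB = B"
        by (simp_all add: arr' del: One_nat_def)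
      have "reg s'' 4 = i" unfolding r'' by simp
      moreover have "reg (set_reg 4 0 s'') = (reg s)(3 := flag (Suc i))"
      proof -
        have "flag (Suc i) = (if feasible l n B (A i) = {} then 1 else flag i)"
          by (auto simp: flag_def less_Suc_eq)
        moreover note r''[unfolded row]
        ultimately show ?thesis using I r4 s(4)[of 4] by (auto simp: I_def fun_eq_iff)
      qed
      moreover have "frame (insert aRes scratch) s3 (set_reg 4 0 s'')"
        using I f'' by (simp add: I_def frame_def)
      moreover have "good (Suc i) (arr (set_reg 4 0 s'') aRes 0 0)"
        unfolding good_def
      proof (rule impI)
        assume ne: "\<forall>k<Suc i. feasible l n B (A k) \<noteq> {}"
        then have "feasible l n B (A i) \<noteq> {}" by simp
        from b[unfolded row, OF d[OF i this]] have bi: "d i \<le> b" "b \<le> (1 + \<epsilon> / 4) * d i" by auto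
        have "(\<forall>k<i. d k \<le> arr s' aRes 0 0) \<and>
          (arr s' aRes 0 0 = 0 \<or> (\<exists>k<i. arr s' aRes 0 0 \<le> (1 + \<epsilon> / 4) * d k))"
          using I ne by (simp add: I_def good_def)
        then show "(\<forall>k<Suc i. d k \<le> arr (set_reg 4 0 s'') aRes 0 0) \<and>
          (arr (set_reg 4 0 s'') aRes 0 0 = 0 \<or>
            (\<exists>k<Suc i. arr (set_reg 4 0 s'') aRes 0 0 \<le> (1 + \<epsilon> / 4) * d k))"
          using bi res by (auto simp: less_Suc_eq max_def)
      qed
      ultimately show "reg s'' 4 = i \<and> I (Suc i) (set_reg 4 0 s'')" unfolding I_def by blast
    qed (use D T q \<epsilon>4 s I arr' in \<open>simp_all add: I_def\<close>)
  next
    fix s' assume I: "I m s'"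
    show "P s'"
      using I by (intro P) (auto simp: I_def good_def flag_def)
  next
    have "flag 0 = reg s 3" by (simp add: flag_def s)
    then have "reg s3 = (reg s)(3 := flag 0)" by (simp add: arr3)
    then show "I 0 s3" using s by (simp add: I_def arr3(3) frame_def good_def)
  qed (use s in \<open>auto simp: arr3 I_def\<close>)
  then show ?thesis unfolding main_com_def
    by (intro tot_Seq_exact[OF 1] tot_Seq_exact[OF 2] tot_Seq_exact[OF 3])
qed

section \<open>Vectors and matrices\<close>

lemma index_mult_mat_vec_entries:
  assumes "M \<in> carrier_mat r n" "v \<in> carrier_vec n" "i < r"
  shows "(M *\<^sub>v v) $ i = (\<Sum>k<n. mat_entries M i k * v $ k)"
  using assms by (auto simp: scalar_prod_def mat_entries_def lessThan_atLeast0 intro!: sum.cong)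

lemma pnorm_mult_mat_vec:
  assumes "M \<in> carrier_mat r n" "v \<in> carrier_vec n"
  shows "pnorm p (M *\<^sub>v v) = pn p r (\<lambda>i. \<Sum>k<n. mat_entries M i k * v $ k)"
proof -
  have "M *\<^sub>v v \<in> carrier_vec r" using assms by auto
  then have "pnorm p (M *\<^sub>v v) = pn p r (\<lambda>i. (M *\<^sub>v v) $ i)" by (rule pn_vec)
  also have "\<dots> = pn p r (\<lambda>i. \<Sum>k<n. mat_entries M i k * v $ k)"
    by (rule pn_cong) (rule index_mult_mat_vec_entries[OF assms])
  finally show ?thesis .
qed

lemma dual_feasible_iff:
  assumes A: "A \<in> carrier_mat m n" and B: "B \<in> carrier_mat l n" and i: "i < m"
  shows "\<beta> \<in> dual_feasible A B i \<longleftrightarrow>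
    \<beta> \<in> carrier_vec l \<and> (\<lambda>r. \<beta> $ r) \<in> feasible l n (mat_entries B) (mat_entries A i)"
proof -
  have "transpose_mat B *\<^sub>v \<beta> = transpose_mat A *\<^sub>v unit_vec m i \<longleftrightarrow>
      (\<forall>k<n. (\<Sum>r<l. mat_entries B r k * \<beta> $ r) = mat_entries A i k)" if \<beta>: "\<beta> \<in> carrier_vec l"
  proof -
    have "(transpose_mat B *\<^sub>v \<beta>) $ k = (\<Sum>r<l. mat_entries B r k * \<beta> $ r)" if "k < n" for k
      using that B \<beta> by (auto simp: scalar_prod_def mat_entries_def lessThan_atLeast0 intro!: sum.cong)
    moreover have "(transpose_mat A *\<^sub>v unit_vec m i) $ k = mat_entries A i k" if "k < n" for k
      using that A i by (simp add: mat_entries_def)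
    moreover have "dim_vec (transpose_mat B *\<^sub>v \<beta>) = n" "dim_vec (transpose_mat A *\<^sub>v unit_vec m i) = n"
      using A B by auto
    ultimately show ?thesis by (auto simp: vec_eq_iff)
  qed
  then show ?thesis using A B unfolding dual_feasible_def feasible_def by auto
qed

lemma feasible_vec:
  assumes A: "A \<in> carrier_mat m n" and B: "B \<in> carrier_mat l n" and i: "i < m"
    and \<beta>: "\<beta> \<in> feasible l n (mat_entries B) (mat_entries A i)"
  shows "vec l \<beta> \<in> dual_feasible A B i"
  using \<beta> unfolding dual_feasible_iff[OF A B i] by (simp add: feasible_def)

lemma dual_value_le:
  assumes "A \<in> carrier_mat m n" "B \<in> carrier_mat l n" "i < m"
    "\<beta> \<in> feasible l n (mat_entries B) (mat_entries A i)"
  shows "dual_value p A B i \<le> ereal (pn (hoelder_conj p) l \<beta>)"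
  unfolding dual_value_def pn_def by (rule INF_lower[OF feasible_vec[OF assms]])

lemma dual_value_ge:
  assumes "A \<in> carrier_mat m n" "B \<in> carrier_mat l n" "i < m"
    "\<And>\<beta>. \<beta> \<in> feasible l n (mat_entries B) (mat_entries A i) \<Longrightarrow> x \<le> ereal (pn (hoelder_conj p) l \<beta>)"
  shows "x \<le> dual_value p A B i"
  unfolding dual_value_def
proof (rule INF_greatest)
  fix \<beta> assume "\<beta> \<in> dual_feasible A B i"
  then have "\<beta> \<in> carrier_vec l" "(\<lambda>r. \<beta> $ r) \<in> feasible l n (mat_entries B) (mat_entries A i)"
    unfolding dual_feasible_iff[OF assms(1-3)] by auto
  then show "x \<le> ereal (pnorm (hoelder_conj p) \<beta>)"
    using assms(4) by (simp add: pn_vec)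
qed

lemma dual_value_infeasible:
  assumes "A \<in> carrier_mat m n" "B \<in> carrier_mat l n" "i < m"
    "feasible l n (mat_entries B) (mat_entries A i) = {}"
  shows "dual_value p A B i = \<infinity>"
proof -
  have "\<infinity> \<le> dual_value p A B i" by (rule dual_value_ge[OF assms(1-3)]) (use assms(4) in simp)
  then show ?thesis by simp
qed

lemma dual_value_attained:
  assumes A: "A \<in> carrier_mat m n" and B: "B \<in> carrier_mat l n" and i: "i < m" and p: "1 \<le> p"
    and ne: "feasible l n (mat_entries B) (mat_entries A i) \<noteq> {}"
  obtains \<beta> where "\<beta> \<in> feasible l n (mat_entries B) (mat_entries A i)"
    "dual_value p A B i = ereal (pn (hoelder_conj p) l \<beta>)"
    "\<And>\<gamma>. \<gamma> \<in> feasible l n (mat_entries B) (mat_entries A i) \<Longrightarrow>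
       pn (hoelder_conj p) l \<beta> \<le> pn (hoelder_conj p) l \<gamma>"
proof -
  have q: "1 \<le> hoelder_conj p" by (rule conjugate_ge_1[OF conjugate_hoelder_conj[OF p]])
  from dual_attained[OF q ne] obtain \<beta> where \<beta>: "\<beta> \<in> feasible l n (mat_entries B) (mat_entries A i)"
    "\<And>\<gamma>. \<gamma> \<in> feasible l n (mat_entries B) (mat_entries A i) \<Longrightarrow>
       pn (hoelder_conj p) l \<beta> \<le> pn (hoelder_conj p) l \<gamma>" by blast
  have "dual_value p A B i = ereal (pn (hoelder_conj p) l \<beta>)"
    by (intro antisym dual_value_le[OF A B i] dual_value_ge[OF A B i]) (use \<beta> in auto)
  then show ?thesis using that \<beta> by blast
qed

section \<open>Polynomial time\<close>

text \<open>The errors add up to \<open>(1 + \<epsilon> / 4) (1 + \<epsilon> / 2) \<le> 1 + \<epsilon>\<close>. For the time, \<open>D\<close> bounds the iterations of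
the counting loops and \<open>W\<close> those of the search; \<open>D \<le> 2 (l + m + n)\<close> as \<open>m > 0\<close>.\<close>

lemma poly_time:
  fixes p :: ereal
  assumes p: "1 \<le> p"
  shows "poly_time_evaluable p (\<lambda>A B. MAX i\<in>{..<dim_row A}. dual_value p A B i)"
proof -
  let ?c = "main_com (exponent_rexp p)"
  define k where "k = depth ?c + 4"
  define C where "C = real (coef ?c) * 801 * 2 ^ k"
  show ?thesis unfolding poly_time_evaluable_def
  proof (rule exI[of _ ?c], rule exI[of _ C], rule exI[of _ k], intro allI impI)
    fix l m n :: nat and A B :: "real mat" and \<epsilon> :: real
    assume m: "0 < m" and A: "A \<in> carrier_mat m n" and B: "B \<in> carrier_mat l n"
      and \<epsilon>: "0 < \<epsilon>" "\<epsilon> < 1"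
    define L where "L = ln (1 / \<epsilon>)"
    have L: "0 \<le> L" using \<epsilon> by (simp add: L_def)
    define D where "D = l + m + n + 1"
    obtain T where T: "target l (\<epsilon> / 4) \<le> growth l ^ T" "\<And>k. k < T \<Longrightarrow> growth l ^ k < target l (\<epsilon> / 4)"
      "real T \<le> 801 * real (Suc l) ^ 4 * (1 + L)"
      using iterations_exist[OF \<epsilon>, of l] unfolding L_def by blast
    define W where "W = max 1 T"
    have W: "real W \<le> 801 * real D ^ 4 * (1 + L)"
    proof -
      have "1 * 1 \<le> real D ^ 4 * (1 + L)" using L by (intro mult_mono one_le_power) (auto simp: D_def)
      moreover have "801 * real (Suc l) ^ 4 * (1 + L) \<le> 801 * real D ^ 4 * (1 + L)"
        using L by (intro mult_right_mono mult_left_mono power_mono) (auto simp: D_def)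
      ultimately show ?thesis using T(3) by (auto simp: W_def max_def)
    qed
    define q where "q = exponent p l \<epsilon>"
    have q: "1 \<le> q" unfolding q_def by (rule exponent_ge_1[OF p \<epsilon>])
    then have q': "1 \<le> ereal q" by simp
    let ?F = "\<lambda>i. feasible l n (mat_entries B) (mat_entries A i)"
    have "\<exists>d. ?F i \<noteq> {} \<longrightarrow> is_min_norm q l n (mat_entries B) (mat_entries A i) d" for i
      using dual_attained[OF q', of l n "mat_entries B" "mat_entries A i"] unfolding is_min_norm_def by blast
    then obtain d where d: "\<And>i. ?F i \<noteq> {} \<Longrightarrow> is_min_norm q l n (mat_entries B) (mat_entries A i) (d i)"
      by metis
    let ?y = "MAX i\<in>{..<dim_row A}. dual_value p A B i"
    have y: "?y = Max ((\<lambda>i. dual_value p A B i) ` {..<m})" using A by simp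
    let ?s = "input_state p A B \<epsilon>"
    have tot: "tot D W ?c ?s (output_approximates \<epsilon> ?y)"
    proof (rule tot_main[where l = l and m = m and n = n and T = T and q = q and \<epsilon> = \<epsilon> and d = d])
      show "rval (exponent_rexp p) (set_cell aN 0 0 (real (Suc l)) ?s) = q"
        by (simp add: exponent_rexp_def q_def exponent_def input_state_def one_ereal_def)
      have arrs: "arr ?s aA = mat_entries A" "arr ?s aB = mat_entries B" by (simp_all add: input_state_def)
      show "is_min_norm q l n (arr ?s aB) (arr ?s aA i) (d i)"
        if "i < m" "feasible l n (arr ?s aB) (arr ?s aA i) \<noteq> {}" for i
        using d that unfolding arrs by blast
      fix s' :: state assume flag: "reg s' 3 = (if \<exists>i<m. feasible l n (arr ?s aB) (arr ?s aA i) = {} then 1 else 0)"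
        and res: "(\<forall>i<m. feasible l n (arr ?s aB) (arr ?s aA i) \<noteq> {} ) \<longrightarrow> (\<forall>i<m. d i \<le> arr s' aRes 0 0) \<and>
        (arr s' aRes 0 0 = 0 \<or> (\<exists>i<m. arr s' aRes 0 0 \<le> (1 + \<epsilon> / 4) * d i))"
      show "output_approximates \<epsilon> ?y s'"
      proof (cases "\<exists>i<m. ?F i = {}")
        case True
        then obtain i where i: "i < m" "?F i = {}" by blast
        then have "\<infinity> = dual_value p A B i" using dual_value_infeasible[OF A B] by simp
        also have "\<dots> \<le> ?y" unfolding y using i by (intro Max_ge) auto
        finally have "?y = \<infinity>" by simp
        then show ?thesis using flag True unfolding arrs output_approximates_def by simp
      next
        case False
        define z where "z = arr s' aRes 0 0"
        have z: "\<And>i. i < m \<Longrightarrow> d i \<le> z" "z = 0 \<or> (\<exists>i<m. z \<le> (1 + \<epsilon> / 4) * d i)"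
          using res False unfolding arrs z_def by auto
        have ex: "\<exists>v. dual_value p A B i = ereal v \<and> 0 \<le> v \<and> v \<le> d i \<and> d i \<le> (1 + \<epsilon> / 2) * v" if i: "i < m" for i
        proof -
          have ne: "?F i \<noteq> {}" using False i by blast
          obtain \<beta> where \<beta>: "\<beta> \<in> ?F i" "dual_value p A B i = ereal (pn (hoelder_conj p) l \<beta>)"
            "\<And>\<gamma>. \<gamma> \<in> ?F i \<Longrightarrow> pn (hoelder_conj p) l \<beta> \<le> pn (hoelder_conj p) l \<gamma>"
            by (rule dual_value_attained[OF A B i p ne]) (rule that)
          obtain opt where opt: "opt \<in> ?F i" "d i = pn (ereal q) l opt"
            "\<And>\<gamma>. \<gamma> \<in> ?F i \<Longrightarrow> d i \<le> pn (ereal q) l \<gamma>"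
            using d[OF ne] unfolding is_min_norm_def by blast
          have "pn (hoelder_conj p) l \<beta> \<le> d i"
            using \<beta>(3)[OF opt(1)] exponent_norm(1)[OF p \<epsilon>, of l opt] opt(2) by (simp add: q_def)
          moreover have "d i \<le> (1 + \<epsilon> / 2) * pn (hoelder_conj p) l \<beta>"
            using opt(3)[OF \<beta>(1)] exponent_norm(2)[OF p \<epsilon>, of l \<beta>] by (simp add: q_def)
          ultimately show ?thesis using \<beta>(2) pn_nonneg by blast
        qed
        have "?y \<in> (\<lambda>i. dual_value p A B i) ` {..<m}" unfolding y using m by (intro Max_in) auto
        then obtain j where j: "j < m" "?y = dual_value p A B j" by auto
        obtain v where v: "?y = ereal v" "0 \<le> v" "v \<le> d j" "d j \<le> (1 + \<epsilon> / 2) * v"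
          using ex[OF j(1)] j(2) by auto
        have "v \<le> z" using v(3) z(1)[OF j(1)] by linarith
        moreover have "z \<le> (1 + \<epsilon>) * v"
          using z(2)
        proof
          assume "z = 0"
          then show ?thesis using v(2) \<epsilon> by simp
        next
          assume "\<exists>i<m. z \<le> (1 + \<epsilon> / 4) * d i"
          then obtain i where i: "i < m" "z \<le> (1 + \<epsilon> / 4) * d i" by blast
          obtain u where u: "dual_value p A B i = ereal u" "0 \<le> u" "d i \<le> (1 + \<epsilon> / 2) * u"
            using ex[OF i(1)] by auto
          have "dual_value p A B i \<le> ?y" unfolding y using i by (intro Max_ge) auto
          then have "u \<le> v" using u(1) v(1) by simp
          have "z \<le> (1 + \<epsilon> / 4) * ((1 + \<epsilon> / 2) * u)"
            by (rule order.trans[OF i(2) mult_left_mono[OF u(3)]]) (use \<epsilon> in simp)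
          also have "\<dots> = (1 + 3 / 4 * \<epsilon> + \<epsilon> * \<epsilon> / 8) * u" by (simp add: algebra_simps)
          also have "\<dots> \<le> (1 + \<epsilon>) * u"
          proof (rule mult_right_mono[OF _ u(2)])
            have "\<epsilon> * \<epsilon> \<le> \<epsilon> * 1" using \<epsilon> by (intro mult_left_mono) auto
            then show "1 + 3 / 4 * \<epsilon> + \<epsilon> * \<epsilon> / 8 \<le> 1 + \<epsilon>" using \<epsilon> by linarith
          qed
          also have "\<dots> \<le> (1 + \<epsilon>) * v" using \<open>u \<le> v\<close> \<epsilon> by (intro mult_left_mono) auto
          finally show ?thesis .
        qed
        ultimately have "\<bar>z - v\<bar> \<le> \<epsilon> * \<bar>v\<bar>" using v(2) by (simp add: distrib_right)
        then show ?thesis using v(1) flag False unfolding arrs output_approximates_def z_def by auto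
      qed
    qed (use T \<epsilon> q A B in \<open>auto simp: D_def W_def input_state_def\<close>)
    then obtain t s' where ts: "exec ?c ?s t s'" "t \<le> coef ?c * D ^ depth ?c * W"
      "output_approximates \<epsilon> ?y s'" unfolding tot_def by blast
    have "real t \<le> real (coef ?c * D ^ depth ?c * W)" using ts(2) by (simp only: of_nat_le_iff)
    also have "\<dots> = real (coef ?c) * real D ^ depth ?c * real W" by simp
    also have "\<dots> \<le> real (coef ?c) * real D ^ depth ?c * (801 * real D ^ 4 * (1 + L))"
      using W by (intro mult_left_mono) auto
    also have "\<dots> = real (coef ?c) * 801 * real D ^ k * (1 + L)"
      by (simp add: k_def power_add mult_ac)
    also have "\<dots> \<le> real (coef ?c) * 801 * (2 * real (l + m + n)) ^ k * (1 + L)"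
      using m L by (intro mult_right_mono mult_left_mono power_mono) (auto simp: D_def)
    also have "\<dots> = C * real (l + m + n) ^ k * (1 + L)"
      unfolding C_def power_mult_distrib by simp
    finally show "\<exists>t s'. exec ?c ?s t s' \<and> real t \<le> C * real (l + m + n) ^ k * (1 + ln (1 / \<epsilon>)) \<and>
        output_approximates \<epsilon> ?y s'"
      using ts(1,3) unfolding L_def by blast
  qed
qed

section \<open>Duality\<close>

lemma primal_feasible_iff:
  assumes B: "B \<in> carrier_mat l n"
  shows "v \<in> primal_feasible p B \<longleftrightarrow> v \<in> carrier_vec n \<and>
    pn p l (\<lambda>i. \<Sum>k<n. mat_entries B i k * v $ k) \<le> 1"
  using B pnorm_mult_mat_vec[OF B] unfolding primal_feasible_def by auto

lemma weak_duality:
  assumes A: "A \<in> carrier_mat m n" and B: "B \<in> carrier_mat l n" and m: "0 < m" and p: "1 \<le> p"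
  shows "primal_value p A B \<le> (MAX i\<in>{..<m}. dual_value p A B i)"
  unfolding primal_value_def
proof (rule SUP_least)
  fix v assume "v \<in> primal_feasible p B"
  then have v: "v \<in> carrier_vec n" "pn p l (\<lambda>i. \<Sum>k<n. mat_entries B i k * v $ k) \<le> 1"
    unfolding primal_feasible_iff[OF B] by auto
  let ?M = "MAX i\<in>{..<m}. dual_value p A B i"
  let ?av = "\<lambda>i. \<Sum>k<n. mat_entries A i k * v $ k"
  have le: "ereal \<bar>?av i\<bar> \<le> ?M" if i: "i < m" for i
  proof -
    have "ereal \<bar>?av i\<bar> \<le> dual_value p A B i"
    proof (rule dual_value_ge[OF A B i])
      fix \<beta> assume \<beta>: "\<beta> \<in> feasible l n (mat_entries B) (mat_entries A i)"
      have "\<bar>?av i\<bar> \<le> pn (hoelder_conj p) l \<beta> * pn p l (\<lambda>i. \<Sum>k<n. mat_entries B i k * v $ k)"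
        unfolding feasible_inner[OF \<beta>, symmetric]
        by (rule hoelder[OF conjugate_sym[OF conjugate_hoelder_conj[OF p]]])
      also have "\<dots> \<le> pn (hoelder_conj p) l \<beta>" using v by (intro mult_left_le) (auto simp: pn_nonneg)
      finally show "ereal \<bar>?av i\<bar> \<le> ereal (pn (hoelder_conj p) l \<beta>)" by simp
    qed
    also have "\<dots> \<le> ?M" using i by (intro Max_ge) auto
    finally show ?thesis .
  qed
  have "pn \<infinity> m ?av \<in> insert 0 ((\<lambda>i. \<bar>?av i\<bar>) ` {..<m})"
    unfolding pn_infinity by (intro Max_in) auto
  moreover have "0 \<le> ?M"
  proof -
    have "(0::ereal) \<le> ereal \<bar>?av 0\<bar>" by simp
    then show ?thesis using le[OF m] by (rule order.trans)
  qed
  ultimately have "ereal (pn \<infinity> m ?av) \<le> ?M" using le by (auto simp: zero_ereal_def)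
  then show "ereal (pnorm \<infinity> (A *\<^sub>v v)) \<le> ?M" unfolding pnorm_mult_mat_vec[OF A v(1)] .
qed

text \<open>A finite primal value bounds the functional of every row, and bounded functionals are represented by
dual feasible vectors of the same norm.\<close>

lemma strong_duality:
  assumes A: "A \<in> carrier_mat m n" and B: "B \<in> carrier_mat l n" and m: "0 < m" and p: "1 \<le> p"
  shows "(MAX i\<in>{..<m}. dual_value p A B i) \<le> primal_value p A B"
proof (cases "primal_value p A B = \<infinity>")
  case False
  let ?B = "\<lambda>y i. \<Sum>k<n. mat_entries B i k * y k"
  let ?a = "\<lambda>i y. \<Sum>k<n. mat_entries A i k * y k"
  have bound: "ereal \<bar>?a i y\<bar> \<le> primal_value p A B" if i: "i < m" and y: "pn p l (?B y) \<le> 1" for i y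
  proof -
    have "vec n y \<in> primal_feasible p B" using y by (simp add: primal_feasible_iff[OF B])
    then have "ereal (pnorm \<infinity> (A *\<^sub>v vec n y)) \<le> primal_value p A B"
      unfolding primal_value_def by (rule SUP_upper)
    moreover have "ereal \<bar>?a i y\<bar> \<le> ereal (pnorm \<infinity> (A *\<^sub>v vec n y))"
    proof -
      have "pnorm \<infinity> (A *\<^sub>v vec n y) = pn \<infinity> m (\<lambda>i. ?a i y)"
        by (simp add: pnorm_mult_mat_vec[OF A])
      moreover have "\<bar>?a i y\<bar> \<le> pn \<infinity> m (\<lambda>i. ?a i y)"
        using abs_le_pn[of \<infinity> i m "\<lambda>i. ?a i y"] i by simp
      ultimately show ?thesis by simp
    qed
    ultimately show ?thesis by (rule order.trans[rotated])
  qed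
  have B0: "pn p l (?B (\<lambda>_. 0)) \<le> 1" using pn_zero[OF p, of l "?B (\<lambda>_. 0)"] by simp
  have "0 \<le> primal_value p A B" using bound[OF m B0] by (simp add: zero_ereal_def)
  then obtain M where M: "primal_value p A B = ereal M" "0 \<le> M" using False
    by (cases "primal_value p A B") auto
  have "dual_value p A B i \<le> ereal M" if i: "i < m" for i
  proof -
    have "?a i y \<le> M * pn p l (?B y)" for y
    proof -
      define t where "t = pn p l (?B y)"
      have scale: "pn p l (?B (\<lambda>k. u * y k)) = \<bar>u\<bar> * t" for u
      proof -
        have "?B (\<lambda>k. u * y k) = (\<lambda>i. u * ?B y i)" by (simp add: sum_distrib_left mult_ac)
        then show ?thesis by (simp add: pn_scale[OF p] t_def)
      qed
      have a_scale: "?a i (\<lambda>k. u * y k) = u * ?a i y" for u by (simp add: sum_distrib_left mult_ac)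
      show ?thesis
      proof (cases "t = 0")
        case True
        \<comment> \<open>a direction in the kernel of \<open>B\<close> may be scaled at will\<close>
        have "\<bar>u * ?a i y\<bar> \<le> M" for u
          using bound[OF i, of "\<lambda>k. u * y k"] scale[of u] True M by (simp add: a_scale)
        from this[of "(M + 1) / ?a i y"] M(2) have "?a i y = 0" by (cases "?a i y = 0") auto
        then show ?thesis using True by (simp add: t_def)
      next
        case False
        then have t: "0 < t" using pn_nonneg[of p l "?B y"] unfolding t_def by linarith
        have "\<bar>1 / t * ?a i y\<bar> \<le> M"
          using bound[OF i, of "\<lambda>k. 1 / t * y k"] scale[of "1 / t"] t M by (simp only: a_scale) simp
        moreover have "1 / t * ?a i y \<le> \<bar>1 / t * ?a i y\<bar>" by (rule abs_ge_self)
        ultimately have "?a i y / t \<le> M" by simp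
        then show ?thesis using t by (simp add: pos_divide_le_eq t_def)
      qed
    qed
    from bounded_functional_representable[OF conjugate_hoelder_conj[OF p] M(2) this]
    obtain \<beta> where \<beta>: "\<beta> \<in> feasible l n (mat_entries B) (mat_entries A i)"
      "pn (hoelder_conj p) l \<beta> \<le> M" by blast
    have "dual_value p A B i \<le> ereal (pn (hoelder_conj p) l \<beta>)" by (rule dual_value_le[OF A B i \<beta>(1)])
    also have "\<dots> \<le> ereal M" using \<beta>(2) by simp
    finally show ?thesis .
  qed
  then show ?thesis unfolding M(1) using m by (intro Max.boundedI) auto
qed simp

lemma duality:
  assumes "A \<in> carrier_mat m n" "B \<in> carrier_mat l n" "0 < m" "1 \<le> p"
  shows "primal_value p A B = (MAX i\<in>{..<m}. dual_value p A B i)"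
  by (intro antisym weak_duality[OF assms] strong_duality[OF assms])

text \<open>At the row that attains the maximum of the dual values, the single-row problem has a maximizer.\<close>

lemma primal_value_attained:
  assumes A: "A \<in> carrier_mat m n" and B: "B \<in> carrier_mat l n" and m: "0 < m" and p: "1 \<le> p"
    and finite: "primal_value p A B \<noteq> \<infinity>"
  shows "\<exists>v\<in>primal_feasible p B. ereal (pnorm \<infinity> (A *\<^sub>v v)) = primal_value p A B"
proof -
  have "(MAX i\<in>{..<m}. dual_value p A B i) \<in> (\<lambda>i. dual_value p A B i) ` {..<m}"
    using m by (intro Max_in) auto
  then obtain i where i: "i < m" "primal_value p A B = dual_value p A B i"
    unfolding duality[OF A B m p] by auto
  have ne: "feasible l n (mat_entries B) (mat_entries A i) \<noteq> {}"
    using finite i dual_value_infeasible[OF A B i(1)] by auto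
  obtain \<beta> where \<beta>: "\<beta> \<in> feasible l n (mat_entries B) (mat_entries A i)"
    "dual_value p A B i = ereal (pn (hoelder_conj p) l \<beta>)"
    "\<And>\<gamma>. \<gamma> \<in> feasible l n (mat_entries B) (mat_entries A i) \<Longrightarrow>
       pn (hoelder_conj p) l \<beta> \<le> pn (hoelder_conj p) l \<gamma>"
    by (rule dual_value_attained[OF A B i(1) p ne]) (rule that)
  obtain v where v: "pn p l (\<lambda>i. \<Sum>k<n. mat_entries B i k * v k) \<le> 1"
    "(\<Sum>k<n. mat_entries A i k * v k) = pn (hoelder_conj p) l \<beta>"
    using primal_attained[OF conjugate_hoelder_conj[OF p] \<beta>(1,3)] by blast
  have feas: "vec n v \<in> primal_feasible p B" using v(1) by (simp add: primal_feasible_iff[OF B])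
  have "pn (hoelder_conj p) l \<beta> \<le> pn \<infinity> m (\<lambda>i. \<Sum>k<n. mat_entries A i k * v k)"
    using abs_le_pn[of \<infinity> i m "\<lambda>i. \<Sum>k<n. mat_entries A i k * v k"] i(1) v(2) by simp
  also have "\<dots> = pnorm \<infinity> (A *\<^sub>v vec n v)" by (simp add: pnorm_mult_mat_vec[OF A])
  finally have "primal_value p A B \<le> ereal (pnorm \<infinity> (A *\<^sub>v vec n v))"
    using i(2) \<beta>(2) by simp
  moreover have "ereal (pnorm \<infinity> (A *\<^sub>v vec n v)) \<le> primal_value p A B"
    unfolding primal_value_def by (rule SUP_upper[OF feas])
  ultimately show ?thesis using feas by (intro bexI[of _ "vec n v"]) auto
qed

lemma convex_dual_problem:
  assumes A: "A \<in> carrier_mat m n" and B: "B \<in> carrier_mat l n" and i: "i < m" and p: "1 \<le> p"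
  shows "convex_problem (dual_feasible A B i) (pnorm (hoelder_conj p))"
  unfolding convex_problem_def
proof (intro ballI allI impI conjI)
  have q: "1 \<le> hoelder_conj p" by (rule conjugate_ge_1[OF conjugate_hoelder_conj[OF p]])
  fix x y and t :: real
  assume "x \<in> dual_feasible A B i" "y \<in> dual_feasible A B i" and t: "0 \<le> t \<and> t \<le> 1"
  then have x: "x \<in> carrier_vec l" "(\<lambda>r. x $ r) \<in> feasible l n (mat_entries B) (mat_entries A i)"
    and y: "y \<in> carrier_vec l" "(\<lambda>r. y $ r) \<in> feasible l n (mat_entries B) (mat_entries A i)"
    unfolding dual_feasible_iff[OF A B i] by auto
  let ?z = "t \<cdot>\<^sub>v x + (1 - t) \<cdot>\<^sub>v y"
  have z: "?z \<in> carrier_vec l" using x y by auto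
  have index: "?z $ r = t * x $ r + (1 - t) * y $ r" if "r < l" for r using that x y by simp
  have "(\<Sum>r<l. mat_entries B r k * ?z $ r) = mat_entries A i k" if k: "k < n" for k
  proof -
    have "(\<Sum>r<l. mat_entries B r k * ?z $ r) =
        t * (\<Sum>r<l. mat_entries B r k * x $ r) + (1 - t) * (\<Sum>r<l. mat_entries B r k * y $ r)"
      by (simp add: index sum_distrib_left sum.distrib[symmetric] algebra_simps)
    also have "\<dots> = t * mat_entries A i k + (1 - t) * mat_entries A i k"
      using x(2) y(2) k by (simp add: feasible_def)
    finally show ?thesis by (simp add: algebra_simps)
  qed
  then show "?z \<in> dual_feasible A B i"
    using z unfolding dual_feasible_iff[OF A B i] feasible_def by simp
  have "pnorm (hoelder_conj p) ?z = pn (hoelder_conj p) l (\<lambda>r. t * x $ r + (1 - t) * y $ r)"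
    unfolding pn_vec[OF z] by (rule pn_cong) (rule index)
  also have "\<dots> \<le> t * pn (hoelder_conj p) l (\<lambda>r. x $ r) + (1 - t) * pn (hoelder_conj p) l (\<lambda>r. y $ r)"
    using t by (intro pn_convex[OF q]) auto
  finally show "pnorm (hoelder_conj p) ?z \<le> t * pnorm (hoelder_conj p) x + (1 - t) * pnorm (hoelder_conj p) y"
    by (simp add: pn_vec[OF x(1)] pn_vec[OF y(1)])
qed

theorem theorem4p1:
  fixes A B :: "real mat" and p :: ereal and l m n :: nat
  assumes "A \<in> carrier_mat m n" and "B \<in> carrier_mat l n" and "0 < m" and "1 \<le> p"
  shows
    "primal_value p A B = (MAX i\<in>{..<m}. dual_value p A B i)
     \<and> (primal_value p A B \<noteq> \<infinity> \<longrightarrow>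
          (\<exists>v\<in>primal_feasible p B. ereal (pnorm \<infinity> (A *\<^sub>v v)) = primal_value p A B))
     \<and> (\<forall>i<m. dual_feasible A B i \<noteq> {} \<longrightarrow>
          (\<exists>\<beta>\<in>dual_feasible A B i. ereal (pnorm (hoelder_conj p) \<beta>) = dual_value p A B i))
     \<and> (\<forall>i<m. convex_problem (dual_feasible A B i) (pnorm (hoelder_conj p)))
     \<and> poly_time_evaluable p (\<lambda>A B. MAX i\<in>{..<dim_row A}. dual_value p A B i)"
proof (intro conjI impI allI)
  show "primal_value p A B = (MAX i\<in>{..<m}. dual_value p A B i)" by (rule duality[OF assms])
  show "\<exists>v\<in>primal_feasible p B. ereal (pnorm \<infinity> (A *\<^sub>v v)) = primal_value p A B"
    if "primal_value p A B \<noteq> \<infinity>"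
    by (rule primal_value_attained[OF assms that])
  show "\<exists>\<beta>\<in>dual_feasible A B i. ereal (pnorm (hoelder_conj p) \<beta>) = dual_value p A B i"
    if i: "i < m" and ne: "dual_feasible A B i \<noteq> {}" for i
  proof -
    have "feasible l n (mat_entries B) (mat_entries A i) \<noteq> {}"
      using ne dual_feasible_iff[OF assms(1,2) i] by blast
    then obtain \<beta> where "\<beta> \<in> feasible l n (mat_entries B) (mat_entries A i)"
      "dual_value p A B i = ereal (pn (hoelder_conj p) l \<beta>)"
      by (rule dual_value_attained[OF assms(1,2) i assms(4)])
    then show ?thesis using feasible_vec[OF assms(1,2) i]
      by (intro bexI[of _ "vec l \<beta>"]) (auto simp: pn_def)
  qed
  show "convex_problem (dual_feasible A B i) (pnorm (hoelder_conj p))" if "i < m" for i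
    by (rule convex_dual_problem[OF assms(1,2) that assms(4)])
  show "poly_time_evaluable p (\<lambda>A B. MAX i\<in>{..<dim_row A}. dual_value p A B i)"
    by (rule poly_time[OF assms(4)])
qed

end
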